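(* Let $\mathcal{K}$ be a field, let $n\ge1$, $r\ge5$ be integers, let $\mathcal{R}=\mathcal{K}[\mathcal{M}]$ be the monomial ring attached to $(n,r)$ in the context, and suppose that $s^{3a_n-3b_1}t^{3b_1}\notin(s^{a_n})\mathcal{R}$. Then for every positive integer $k'$ there is a positive integer $m$ such that $$(s^{k'a_n})=(s^{k'a_n},\ s^{(k'-1)a_n}s^{3a_n-3b_1}t^{3b_1})\cap(s^{k'a_n},\ t^{ma_n})$$ is a primary decomposition of the ideal $(s^{k'a_n})$ of $\mathcal{R}$. Consequently, $\widetilde{\mathcal{R}}=\mathcal{K}[\widetilde{\mathcal{M}}]$, where $\widetilde{\mathcal{M}}=\mathcal{M}\cup\{s^{2a_n-3b_1}t^{3b_1}\}$, is the Macaulayfication of $\mathcal{R}$.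
   Context: Let $\mathcal{K}$ be a field. For integers $n\ge 1$ and $r\ge 5$ put $b_1=r$, $b_2=2r-2$ and $a_i=2r+2i-1$ for $0\le i\le n$. Let $$\mathcal{M}=\{s^{a_n},\ s^{a_n-b_1}t^{b_1},\ s^{a_n-b_2}t^{b_2},\ s^{a_n-a_0}t^{a_0},\ s^{a_n-a_1}t^{a_1},\dots,s^{a_n-a_{n-1}}t^{a_{n-1}},\ t^{a_n}\}\subset\mathcal{K}[s,t],$$ and let $\mathcal{R}=\mathcal{K}[\mathcal{M}]$ be the $\mathcal{K}$-subalgebra of $\mathcal{K}[s,t]$ generated by $\mathcal{M}$. All ideals are ideals of $\mathcal{R}$. A ring $\widetilde{\mathcal{R}}$ is the Macaulayfication of $\mathcal{R}$ if $\mathcal{R}\subseteq\widetilde{\mathcal{R}}$, $\widetilde{\mathcal{R}}$ is Cohen-Macaulay, and $\widetilde{\mathcal{R}}/\mathcal{R}$ has finite length as an $\mathcal{R}$-module (for a monomial curve there is a unique finite Macaulayfication). *)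

theory Defs
  imports "HOL-Algebra.Algebra" "HOL-Algebra.Algebraic_Closure_Type" "HOL-Library.Extended_Nat"
begin

section \<open>Primary decompositions\<close>

definition primary_ideal :: "'a set \<Rightarrow> ('a, 'b) ring_scheme \<Rightarrow> bool" where
  "primary_ideal Q R \<longleftrightarrow> cring R \<and> ideal Q R \<and> Q \<noteq> carrier R \<and>
     (\<forall>x\<in>carrier R. \<forall>y\<in>carrier R.
        x \<otimes>\<^bsub>R\<^esub> y \<in> Q \<longrightarrow> x \<in> Q \<or> (\<exists>k::nat. y [^]\<^bsub>R\<^esub> k \<in> Q))"

text \<open>As usual, a primary decomposition is not required to be irredundant.\<close>

definition primary_decomposition :: "('a, 'b) ring_scheme \<Rightarrow> 'a set \<Rightarrow> 'a set set \<Rightarrow> bool" where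
  "primary_decomposition R I \<Q> \<longleftrightarrow>
     ideal I R \<and> finite \<Q> \<and> \<Q> \<noteq> {} \<and> (\<forall>Q\<in>\<Q>. primary_ideal Q R) \<and> I = \<Inter>\<Q>"


section \<open>Cohen-Macaulay rings\<close>

definition regular_sequence :: "('a, 'b) ring_scheme \<Rightarrow> 'a list \<Rightarrow> bool" where
  "regular_sequence R xs \<longleftrightarrow> set xs \<subseteq> carrier R \<and> Idl\<^bsub>R\<^esub> (set xs) \<noteq> carrier R \<and>
     (\<forall>i<length xs. \<forall>y\<in>carrier R.
        xs ! i \<otimes>\<^bsub>R\<^esub> y \<in> Idl\<^bsub>R\<^esub> (set (take i xs)) \<longrightarrow> y \<in> Idl\<^bsub>R\<^esub> (set (take i xs)))"

definition ideal_depth :: "('a, 'b) ring_scheme \<Rightarrow> 'a set \<Rightarrow> enat" where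
  "ideal_depth R I = Sup {enat (length xs) |xs. set xs \<subseteq> I \<and> regular_sequence R xs}"

definition prime_height :: "('a, 'b) ring_scheme \<Rightarrow> 'a set \<Rightarrow> enat" where
  "prime_height R P = Sup {enat h |h. \<exists>C :: nat \<Rightarrow> 'a set.
     (\<forall>i\<le>h. primeideal (C i) R) \<and> (\<forall>i<h. C i \<subset> C (Suc i)) \<and> C h = P}"

text \<open>
  Global definition, after Eisenbud (Commutative Algebra with a View Toward Algebraic Geometry,
  Section 18.2): no localizations are needed, since depth and height are those of the maximal
  ideal in the ring itself.
\<close>

definition cohen_macaulay :: "('a, 'b) ring_scheme \<Rightarrow> bool" where
  "cohen_macaulay R \<longleftrightarrow> cring R \<and> noetherian_ring R \<and>
     (\<forall>P. maximalideal P R \<longrightarrow> ideal_depth R P = prime_height R P)"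


section \<open>Quotient modules and length\<close>

text \<open>
  The record type of modules extends that of rings; the fields \<open>mult\<close> and \<open>one\<close> play no role
  for modules and are left unspecified in the quotient.
\<close>

definition quotient_module ::
    "('a, 'b, 'c) module_scheme \<Rightarrow> 'b set \<Rightarrow> ('a, 'b set) module" where
  "quotient_module M N = \<lparr>
     carrier = a_rcosets\<^bsub>M\<^esub> N, monoid.mult = undefined, one = undefined,
     ring.zero = N, ring.add = (<+>\<^bsub>M\<^esub>),
     module.smult = (\<lambda>x A. \<Union>y\<in>A. N +>\<^bsub>M\<^esub> (x \<odot>\<^bsub>M\<^esub> y)) \<rparr>"

definition ring_as_module :: "('a, 'b) ring_scheme \<Rightarrow> ('a, 'a) module" where
  "ring_as_module S = \<lparr>
     carrier = carrier S, monoid.mult = monoid.mult S, one = one S,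
     ring.zero = ring.zero S, ring.add = ring.add S, module.smult = monoid.mult S \<rparr>"

definition module_length :: "('a, 'd) ring_scheme \<Rightarrow> ('a, 'b, 'c) module_scheme \<Rightarrow> enat" where
  "module_length R M = Sup {enat k |k. \<exists>C :: nat \<Rightarrow> 'b set.
     (\<forall>i\<le>k. submodule (C i) R M) \<and> (\<forall>i<k. C i \<subset> C (Suc i))}"

definition finite_length :: "('a, 'd) ring_scheme \<Rightarrow> ('a, 'b, 'c) module_scheme \<Rightarrow> bool" where
  "finite_length R M \<longleftrightarrow> module R M \<and> module_length R M \<noteq> \<infinity>"

definition is_macaulayfication :: "'a ring \<Rightarrow> 'a ring \<Rightarrow> bool" where
  "is_macaulayfication R S \<longleftrightarrow>
     subring (carrier R) S \<and> R = S\<lparr>carrier := carrier R\<rparr> \<and>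
     cohen_macaulay S \<and>
     finite_length R (quotient_module (ring_as_module S) (carrier R))"


section \<open>The monomial rings\<close>

text \<open>The polynomial ring \<open>K[s,t]\<close> is \<open>K[t][s]\<close>: the outer variable is \<open>s\<close>, the inner one \<open>t\<close>.\<close>

definition svar :: "'k::field poly poly" where "svar = [:0, 1:]"

definition tvar :: "'k::field poly poly" where "tvar = [:[:0, 1:]:]"

definition constants :: "'k::field poly poly set" where
  "constants = range (\<lambda>c. [:[:c:]:])"

text \<open>
  The locale \<open>subalgebra\<close> of \<open>HOL-Algebra\<close> only describes subspaces (closed under scalars, not under
  products), so the subalgebra generated by \<open>G\<close> is the subring generated by \<open>K\<close> and \<open>G\<close>.
\<close>

definition generated_subalgebra :: "'k::field poly poly set \<Rightarrow> 'k poly poly ring" where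
  "generated_subalgebra G = ring_of_type_algebra
     \<lparr>carrier := generate_ring ring_of_type_algebra (constants \<union> G)\<rparr>"

definition b\<^sub>1 :: "nat \<Rightarrow> nat" where "b\<^sub>1 r = r"

definition b\<^sub>2 :: "nat \<Rightarrow> nat" where "b\<^sub>2 r = 2 * r - 2"

definition a_exp :: "nat \<Rightarrow> nat \<Rightarrow> nat" where "a_exp r i = 2 * r + 2 * i - 1"

definition monomials :: "nat \<Rightarrow> nat \<Rightarrow> 'k::field poly poly set" where
  "monomials n r =
     {svar ^ a_exp r n,
      svar ^ (a_exp r n - b\<^sub>1 r) * tvar ^ b\<^sub>1 r,
      svar ^ (a_exp r n - b\<^sub>2 r) * tvar ^ b\<^sub>2 r} \<union>
     {svar ^ (a_exp r n - a_exp r i) * tvar ^ a_exp r i |i. i < n} \<union>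
     {tvar ^ a_exp r n}"

end

theory Submission
  imports Defs
begin

text \<open>
  The rings and ideals named in the theorem are spanned by monomials, hence determined by a set of
  exponents \<open>(x, y)\<close> of \<open>s\<^sup>x t\<^sup>y\<close>: an algebra generated by monomials consists of the
  polynomials supported in the generated submonoid of \<open>\<nat>\<^sup>2\<close>
  (\<open>generated_subalgebra_monos\<close>), and an ideal generated by monomials of the polynomials supported in
  the union of the translates of that submonoid (\<open>genideal_monos\<close>). Below, \<open>a\<close> stands for \<open>a\<^sub>n\<close>.

  Combinatorics. The sums of \<open>p\<close> of the exponents \<open>2r - 2, a\<^sub>0, \<dots>, a\<^sub>n\<close> are exactly the numbers \<open>z\<close> with
  \<open>p(2r - 2) \<le> z \<le> pa\<close> for which \<open>pa - z\<close> lies in the numerical semigroup \<open>\<langle>2, 2n + 1\<rangle>\<close>. Let \<open>curve_exps\<close> be the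
  exponents of \<open>R\<close>, and let \<open>cm_exps\<close> be the pairs with \<open>a\<close> dividing \<open>x + y\<close> whose components lie
  separately in the two numerical semigroups obtained by projecting \<open>curve_exps\<close>. The former set
  is contained in the latter, and only pairs \<open>(2a - 3r, 3r + fa)\<close> with \<open>f < r\<close> can be missing
  (\<open>cm_exps_cases\<close>, \<open>extra_eventually_in_curve\<close>). So \<open>cm_exps\<close> is the exponent set of the enlarged
  algebra \<open>S\<close>, and \<open>S/R\<close> has dimension at most \<open>r\<close> over \<open>K\<close>, which bounds its length.

  Primary decomposition. The first component consists of the elements of \<open>R\<close> all of whose
  \<open>s\<close>-exponents lie in \<open>k'a + \<langle>2, 2n + 1\<rangle>\<close>; the lowest bad power of \<open>s\<close> in a factor shows
  that it is primary (\<open>primary_s_primary\<close>). The second one contains all monomials of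
  large degree, so an element with nonzero constant term is invertible modulo it
  (\<open>primary_maximal_radical\<close>). The intersection is \<open>(s\<^bsup>k'a\<^esup>)\<close> because the finitely many monomials that
  the first component adds have too small a \<open>t\<close>-exponent once \<open>m = r + 3\<close>.

  Cohen-Macaulayness. All maximal ideals \<open>P\<close> of \<open>S\<close> have to be treated, not only the homogeneous one. Depth
  and height are at most two, since three polynomials in two variables are algebraically
  dependent; the lexicographically lowest term of a relation yields the identity of Coquand and
  Lombardi, which excludes regular sequences and chains of primes of length three alike. For the
  lower bound, \<open>P\<close> contains nonzero polynomials \<open>f(s\<^sup>a)\<close> and \<open>g(t\<^sup>a)\<close>, by an elementary version of
  Zariski's lemma (\<open>maximal_ideal_algebraic\<close>). They form a regular sequence because
  the membership of \<open>(x, y)\<close> in \<open>cm_exps\<close> can be tested on any translate by \<open>(ia, 0)\<close> for \<open>y\<close> and on any translate by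
  \<open>(0, ja)\<close> for \<open>x\<close> and the congruence. A prime that contains \<open>f(s\<^sup>a)\<close> and avoids the powers of \<open>g(t\<^sup>a)\<close> and
  the complement of \<open>P\<close> lies strictly between \<open>0\<close> and \<open>P\<close>, so the height is two as well.
\<close>

section \<open>Subsets of a type as rings\<close>

abbreviation ring_on :: "'a::comm_ring_1 set \<Rightarrow> 'a ring" where
  "ring_on T \<equiv> ring_of_type_algebra\<lparr>carrier := T\<rparr>"

lemma ring_on_simps [simp]:
  "monoid.mult (ring_on T) = (*)" "one (ring_on T) = 1"
  "ring.zero (ring_on T) = 0" "ring.add (ring_on T) = (+)"
  by (simp_all add: ring_of_type_algebra_def)

lemma ring_on_pow [simp]: "x [^]\<^bsub>ring_on T\<^esub> (k::nat) = x ^ k"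
  by (induction k) (simp_all add: mult.commute)

text \<open>
  Subrings are kept as sets in a type, so that calculations use type-class algebra; only the final
  statements are translated to the record \<open>ring_on T\<close>.
\<close>

locale type_subring =
  fixes T :: "'a::comm_ring_1 set"
  assumes one_mem: "1 \<in> T"
    and uminus_mem: "x \<in> T \<Longrightarrow> - x \<in> T"
    and add_mem: "x \<in> T \<Longrightarrow> y \<in> T \<Longrightarrow> x + y \<in> T"
    and mult_mem: "x \<in> T \<Longrightarrow> y \<in> T \<Longrightarrow> x * y \<in> T"
begin

lemma zero_mem: "0 \<in> T"
  using add_mem[OF one_mem uminus_mem[OF one_mem]] by simp

lemma diff_mem: "x \<in> T \<Longrightarrow> y \<in> T \<Longrightarrow> x - y \<in> T"
  using add_mem[OF _ uminus_mem] by fastforce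

lemma power_mem: "x \<in> T \<Longrightarrow> x ^ k \<in> T"
  by (induction k) (auto intro: one_mem mult_mem)

lemma sum_mem: "(\<And>i. i \<in> I \<Longrightarrow> f i \<in> T) \<Longrightarrow> sum f I \<in> T"
  by (induction I rule: infinite_finite_induct) (auto intro: zero_mem add_mem)

lemma cring_on: "cring (ring_on T)"
proof (intro cringI abelian_groupI comm_monoidI)
  fix x assume "x \<in> carrier (ring_on T)"
  then show "\<exists>y\<in>carrier (ring_on T). y \<oplus>\<^bsub>ring_on T\<^esub> x = \<zero>\<^bsub>ring_on T\<^esub>"
    by (intro bexI[of _ "- x"]) (auto intro: uminus_mem)
qed (auto simp: algebra_simps intro: zero_mem one_mem add_mem mult_mem)

lemma a_inv_on: assumes "x \<in> T" shows "\<ominus>\<^bsub>ring_on T\<^esub> x = - x"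
proof -
  interpret cring "ring_on T" by (rule cring_on)
  show ?thesis
    using assms minus_equality[of "- x" x] uminus_mem[OF assms] by simp
qed

definition idl :: "'a set \<Rightarrow> bool" where
  "idl J \<longleftrightarrow> J \<subseteq> T \<and> 0 \<in> J \<and> (\<forall>x\<in>J. \<forall>y\<in>J. x + y \<in> J) \<and> (\<forall>w\<in>T. \<forall>x\<in>J. w * x \<in> J)"

lemma idlD:
  assumes "idl J"
  shows "x \<in> J \<Longrightarrow> x \<in> T" "0 \<in> J" "x \<in> J \<Longrightarrow> y \<in> J \<Longrightarrow> x + y \<in> J"
    "w \<in> T \<Longrightarrow> x \<in> J \<Longrightarrow> w * x \<in> J" "w \<in> T \<Longrightarrow> x \<in> J \<Longrightarrow> x * w \<in> J"
  using assms unfolding idl_def by (auto simp: mult.commute)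

lemma idl_uminus: "idl J \<Longrightarrow> x \<in> J \<Longrightarrow> - x \<in> J"
  using idlD(4)[of J "- 1" x] uminus_mem[OF one_mem] by simp

lemma idl_diff: "idl J \<Longrightarrow> x \<in> J \<Longrightarrow> y \<in> J \<Longrightarrow> x - y \<in> J"
  using idlD(3)[OF _ _ idl_uminus] by fastforce

lemma idl_eq_carrier: "idl J \<Longrightarrow> 1 \<in> J \<Longrightarrow> J = T"
  unfolding idl_def by force

lemma ideal_on_iff: "ideal J (ring_on T) \<longleftrightarrow> idl J"
proof
  assume "ideal J (ring_on T)"
  then interpret ideal J "ring_on T" .
  show "idl J" unfolding idl_def
    using a_subset additive_subgroup.zero_closed[OF is_additive_subgroup]
      additive_subgroup.a_closed[OF is_additive_subgroup] I_l_closed by auto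
next
  assume J: "idl J"
  interpret R: cring "ring_on T" by (rule cring_on)
  show "ideal J (ring_on T)"
  proof (rule idealI[OF R.ring_axioms])
    show "subgroup J (add_monoid (ring_on T))"
    proof (rule subgroup.intro)
      fix x assume x: "x \<in> J"
      then have "inv\<^bsub>add_monoid (ring_on T)\<^esub> x = - x"
        using a_inv_on idlD(1)[OF J] unfolding a_inv_def by blast
      then show "inv\<^bsub>add_monoid (ring_on T)\<^esub> x \<in> J" using idl_uminus[OF J x] by simp
    qed (use idlD[OF J] in auto)
  qed (use idlD[OF J] in auto)
qed

lemma genideal_on: "(Idl\<^bsub>ring_on T\<^esub> G) = \<Inter>{J. idl J \<and> G \<subseteq> J}"
  unfolding genideal_def ideal_on_iff ..

lemma idl_genideal: assumes "G \<subseteq> T" shows "idl (Idl\<^bsub>ring_on T\<^esub> G)"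
proof -
  interpret R: cring "ring_on T" by (rule cring_on)
  show ?thesis using R.genideal_ideal[of G] assms ideal_on_iff by auto
qed

lemma genideal_incl: "x \<in> G \<Longrightarrow> x \<in> Idl\<^bsub>ring_on T\<^esub> G"
  unfolding genideal_on by blast

lemma genideal_least: "idl J \<Longrightarrow> G \<subseteq> J \<Longrightarrow> Idl\<^bsub>ring_on T\<^esub> G \<subseteq> J"
  unfolding genideal_on by blast

lemma genideal_mono: "G \<subseteq> Y \<Longrightarrow> Idl\<^bsub>ring_on T\<^esub> G \<subseteq> Idl\<^bsub>ring_on T\<^esub> Y"
  unfolding genideal_on by blast

lemma idl_principal: assumes "x \<in> T" shows "idl {x * w | w. w \<in> T}"
  unfolding idl_def
proof (intro conjI ballI)
  show "0 \<in> {x * w | w. w \<in> T}" using zero_mem by force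
  fix y z assume "y \<in> {x * w | w. w \<in> T}" "z \<in> {x * w | w. w \<in> T}"
  then show "y + z \<in> {x * w | w. w \<in> T}" using add_mem by (auto simp flip: distrib_left)
next
  fix v y assume "v \<in> T" "y \<in> {x * w | w. w \<in> T}"
  then obtain w where "w \<in> T" "y = x * w" by blast
  then have "v * y = x * (v * w)" "v * w \<in> T" using mult_mem \<open>v \<in> T\<close> by (auto simp: algebra_simps)
  then show "v * y \<in> {x * w | w. w \<in> T}" by blast
qed (use assms mult_mem in auto)

lemma genideal_single: assumes "x \<in> T" shows "Idl\<^bsub>ring_on T\<^esub> {x} = {x * w | w. w \<in> T}"
proof
  show "Idl\<^bsub>ring_on T\<^esub> {x} \<subseteq> {x * w | w. w \<in> T}"
    by (rule genideal_least[OF idl_principal[OF assms]]) (use one_mem in force)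
  show "{x * w | w. w \<in> T} \<subseteq> Idl\<^bsub>ring_on T\<^esub> {x}"
    using idlD(5)[OF idl_genideal[of "{x}"]] genideal_incl[of x "{x}"] assms by auto
qed

lemma genideal_empty: "Idl\<^bsub>ring_on T\<^esub> {} = {0}"
proof
  have "idl {0}" unfolding idl_def using zero_mem by simp
  then show "Idl\<^bsub>ring_on T\<^esub> {} \<subseteq> {0}" by (rule genideal_least) simp
  show "{0} \<subseteq> Idl\<^bsub>ring_on T\<^esub> {}" using idlD(2)[OF idl_genideal] by simp
qed

lemma idl_extend: assumes "idl J" "x \<in> T" shows "idl {j + x * w | j w. j \<in> J \<and> w \<in> T}"
  unfolding idl_def
proof (intro conjI ballI)
  show "{j + x * w | j w. j \<in> J \<and> w \<in> T} \<subseteq> T"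
    using idlD(1)[OF assms(1)] add_mem mult_mem assms(2) by blast
  show "0 \<in> {j + x * w | j w. j \<in> J \<and> w \<in> T}" using zero_mem idlD(2)[OF assms(1)] by force
  fix y z assume "y \<in> {j + x * w | j w. j \<in> J \<and> w \<in> T}" "z \<in> {j + x * w | j w. j \<in> J \<and> w \<in> T}"
  then obtain j w j' w' where "j \<in> J" "w \<in> T" "j' \<in> J" "w' \<in> T" "y = j + x * w" "z = j' + x * w'" by blast
  then have "y + z = (j + j') + x * (w + w')" "j + j' \<in> J" "w + w' \<in> T"
    using idlD(3)[OF assms(1)] add_mem by (auto simp: algebra_simps)
  then show "y + z \<in> {j + x * w | j w. j \<in> J \<and> w \<in> T}" by blast
next
  fix v y assume v: "v \<in> T" and "y \<in> {j + x * w | j w. j \<in> J \<and> w \<in> T}"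
  then obtain j w where "j \<in> J" "w \<in> T" "y = j + x * w" by blast
  then have "v * y = v * j + x * (v * w)" by (simp add: distrib_left mult.left_commute)
  moreover have "v * j \<in> J" "v * w \<in> T"
    using v \<open>j \<in> J\<close> \<open>w \<in> T\<close> idlD(4)[OF assms(1)] mult_mem by blast+
  ultimately show "v * y \<in> {j + x * w | j w. j \<in> J \<and> w \<in> T}" by blast
qed

lemma idl_extend_incl:
  assumes "idl J" "x \<in> T"
  shows "J \<subseteq> {j + x * w | j w. j \<in> J \<and> w \<in> T}" "x \<in> {j + x * w | j w. j \<in> J \<and> w \<in> T}"
proof -
  show "J \<subseteq> {j + x * w | j w. j \<in> J \<and> w \<in> T}" using zero_mem by force
  have "x = 0 + x * 1" by simp
  then show "x \<in> {j + x * w | j w. j \<in> J \<and> w \<in> T}" using one_mem idlD(2)[OF assms(1)] by blast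
qed

lemma primeideal_on_iff:
  "primeideal J (ring_on T) \<longleftrightarrow> idl J \<and> J \<noteq> T \<and> (\<forall>x\<in>T. \<forall>y\<in>T. x * y \<in> J \<longrightarrow> x \<in> J \<or> y \<in> J)"
  unfolding primeideal_def primeideal_axioms_def ideal_on_iff using cring_on by auto

lemma maximalideal_onD:
  assumes "maximalideal P (ring_on T)"
  shows "idl P" "P \<noteq> T" "q \<in> T \<Longrightarrow> q \<notin> P \<Longrightarrow> \<exists>w\<in>T. 1 - q * w \<in> P"
proof -
  show P: "idl P" using assms unfolding maximalideal_def ideal_on_iff by blast
  show "P \<noteq> T" using maximalideal.I_notcarr[OF assms] by auto
  assume q: "q \<in> T" "q \<notin> P"
  let ?J = "{j + q * w | j w. j \<in> P \<and> w \<in> T}"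
  note J = idl_extend[OF P q(1)]
  have JT: "?J \<subseteq> carrier (ring_on T)" using idlD(1)[OF J] by (simp add: subset_iff)
  have "ideal ?J (ring_on T)" using J by (simp only: ideal_on_iff)
  from maximalideal.I_maximal[OF assms this idl_extend_incl(1)[OF P q(1)] JT]
  have "?J = P \<or> ?J = T" by simp
  then have "?J = T" using idl_extend_incl(2)[OF P q(1)] q by blast
  then obtain j w where "j \<in> P" "w \<in> T" "1 = j + q * w" using one_mem by blast
  moreover from this have "1 - q * w = j" by (metis add_diff_cancel_right')
  ultimately show "\<exists>w\<in>T. 1 - q * w \<in> P" by (intro bexI[of _ w]) auto
qed

lemma idl_power_cancel:
  assumes "idl J" "x \<in> T" "w \<in> T" "x ^ m * w \<in> J" "\<And>y. y \<in> T \<Longrightarrow> x * y \<in> J \<Longrightarrow> y \<in> J"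
  shows "w \<in> J"
  using assms(4)
proof (induction m)
  case (Suc m)
  have "x * (x ^ m * w) \<in> J" using Suc.prems by (simp add: mult.assoc)
  then have "x ^ m * w \<in> J" by (rule assms(5)[rotated]) (intro mult_mem power_mem assms(2,3))
  then show ?case by (rule Suc.IH)
qed simp

lemma Union_idl_chain:
  assumes "C \<noteq> {}" "subset.chain {J. idl J} C" shows "idl (\<Union>C)"
proof -
  have C: "\<And>J. J \<in> C \<Longrightarrow> idl J" using assms(2) unfolding subset_chain_def by blast
  show ?thesis unfolding idl_def
  proof (intro conjI ballI)
    show "\<Union>C \<subseteq> T" using C idlD(1) by blast
    show "0 \<in> \<Union>C" using C idlD(2) assms(1) by blast
    fix x y assume "x \<in> \<Union>C" "y \<in> \<Union>C"
    then obtain J K where JK: "J \<in> C" "K \<in> C" "x \<in> J" "y \<in> K" by blast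
    then have "J \<subseteq> K \<or> K \<subseteq> J" using assms(2) unfolding subset_chain_def by blast
    then show "x + y \<in> \<Union>C" using JK C idlD(3) by blast
  next
    fix w x assume "w \<in> T" "x \<in> \<Union>C"
    then show "w * x \<in> \<Union>C" using C idlD(4) by blast
  qed
qed

text \<open>
  The hypothesis on \<open>x0\<close>, \<open>x1\<close>, \<open>x2\<close> is the Coquand-Lombardi condition for Krull
  dimension at most two. Peeling off one layer of the identity at each stage of the flag ends with
  \<open>1 + b2 x2\<close> in the ideal before the last. Ideals generated by the initial segments of a regular
  sequence and chains of primes both form such flags, so that depth and height are bounded at once.
\<close>

lemma flag_of_length_three_improper:
  assumes dim: "\<And>x0 x1 x2. x0 \<in> T \<Longrightarrow> x1 \<in> T \<Longrightarrow> x2 \<in> T \<Longrightarrow>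
      \<exists>(m0::nat) (m1::nat) (m2::nat). \<exists>a0\<in>T. \<exists>a1\<in>T. \<exists>a2\<in>T.
        x0 ^ m0 * (x1 ^ m1 * (x2 ^ m2 * (1 + a2 * x2) + a1 * x1) + a0 * x0) = 0"
    and I: "\<And>i. i \<le> 3 \<Longrightarrow> idl (I i)" "\<And>i. i < 3 \<Longrightarrow> I i \<subseteq> I (Suc i)"
    and x: "\<And>i. i < 3 \<Longrightarrow> x i \<in> I (Suc i)"
    and cancel: "\<And>i w. i < 3 \<Longrightarrow> w \<in> T \<Longrightarrow> x i * w \<in> I i \<Longrightarrow> w \<in> I i"
  shows "1 \<in> I (3::nat)"
proof -
  have J: "idl (I 0)" "idl (I 1)" "idl (I 2)" "idl (I 3)" "I 0 \<subseteq> I 1" "I 1 \<subseteq> I 2" "I 2 \<subseteq> I 3"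
    and y: "x 0 \<in> I 1" "x 1 \<in> I 2" "x 2 \<in> I 3"
    using I(1)[of 0] I(1)[of 1] I(1)[of 2] I(1)[of 3] I(2)[of 0] I(2)[of 1] I(2)[of 2] x[of 0] x[of 1] x[of 2]
    by (auto simp: numeral_2_eq_2 numeral_3_eq_3)
  have yT: "x 0 \<in> T" "x 1 \<in> T" "x 2 \<in> T" using y J idlD(1) by blast+
  have can: "w \<in> I i" if "i < 3" "x i \<in> T" "w \<in> T" "x i ^ m * w \<in> I i" for i w m
    using idl_power_cancel[OF I(1) that(2-4)] cancel that(1) by fastforce
  obtain m0 m1 m2 a0 a1 a2 where a: "a0 \<in> T" "a1 \<in> T" "a2 \<in> T"
    and rel: "x 0 ^ m0 * (x 1 ^ m1 * (x 2 ^ m2 * (1 + a2 * x 2) + a1 * x 1) + a0 * x 0) = 0"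
    using dim[OF yT] by blast
  define c2 where "c2 = 1 + a2 * x 2"
  define c1 where "c1 = x 2 ^ m2 * c2 + a1 * x 1"
  define c0 where "c0 = x 1 ^ m1 * c1 + a0 * x 0"
  have c2: "c2 \<in> T" unfolding c2_def using a yT by (intro add_mem mult_mem one_mem) auto
  have c1: "c1 \<in> T" unfolding c1_def using a yT c2 by (intro add_mem mult_mem power_mem) auto
  have c0: "c0 \<in> T" unfolding c0_def using a yT c1 by (intro add_mem mult_mem power_mem) auto
  have "x 0 ^ m0 * c0 \<in> I 0"
    using rel idlD(2)[OF J(1)] unfolding c0_def c1_def c2_def by simp
  then have "c0 \<in> I 0" using can[OF _ yT(1) c0] by simp
  then have "c0 \<in> I 1" using J by blast
  moreover have "a0 * x 0 \<in> I 1" using idlD(4)[OF J(2) a(1) y(1)] .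
  ultimately have "c0 - a0 * x 0 \<in> I 1" by (rule idl_diff[OF J(2)])
  then have "x 1 ^ m1 * c1 \<in> I 1" unfolding c0_def by simp
  then have "c1 \<in> I 1" using can[OF _ yT(2) c1] by simp
  then have "c1 \<in> I 2" using J by blast
  moreover have "a1 * x 1 \<in> I 2" using idlD(4)[OF J(3) a(2) y(2)] .
  ultimately have "c1 - a1 * x 1 \<in> I 2" by (rule idl_diff[OF J(3)])
  then have "x 2 ^ m2 * c2 \<in> I 2" unfolding c1_def by simp
  then have "c2 \<in> I 2" using can[OF _ yT(3) c2] by simp
  then have "c2 \<in> I 3" using J by blast
  moreover have "a2 * x 2 \<in> I 3" using idlD(4)[OF J(4) a(3) y(3)] .
  ultimately have "c2 - a2 * x 2 \<in> I 3" by (rule idl_diff[OF J(4)])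
  then show ?thesis unfolding c2_def by simp
qed

text \<open>
  Krull's lemma: an ideal that is maximal among those disjoint from the multiplicative set is prime.
\<close>

lemma exists_prime_avoiding:
  assumes J: "idl J" and W: "1 \<in> W" "W \<subseteq> T" "\<And>x y. x \<in> W \<Longrightarrow> y \<in> W \<Longrightarrow> x * y \<in> W"
    and disj: "J \<inter> W = {}"
  obtains Q where "primeideal Q (ring_on T)" "J \<subseteq> Q" "Q \<inter> W = {}"
proof -
  define \<A> where "\<A> = {K. idl K \<and> J \<subseteq> K \<and> K \<inter> W = {}}"
  have "\<exists>M\<in>\<A>. \<forall>G\<in>\<A>. M \<subseteq> G \<longrightarrow> G = M"
  proof (rule subset_Zorn)
    fix C assume C: "subset.chain \<A> C"
    show "\<exists>U\<in>\<A>. \<forall>G\<in>C. G \<subseteq> U"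
    proof (cases "C = {}")
      case True then show ?thesis using J disj unfolding \<A>_def by blast
    next
      case False
      have mem: "\<And>K. K \<in> C \<Longrightarrow> idl K \<and> J \<subseteq> K \<and> K \<inter> W = {}"
        using C unfolding subset_chain_def \<A>_def by auto
      then have "subset.chain {J. idl J} C" using C unfolding subset_chain_def by auto
      then have "idl (\<Union>C)" by (rule Union_idl_chain[OF False])
      moreover have "J \<subseteq> \<Union>C" using False mem by (metis Sup_upper2 ex_in_conv)
      moreover have "\<Union>C \<inter> W = {}" using mem by auto
      ultimately have "\<Union>C \<in> \<A>" unfolding \<A>_def by simp
      then show ?thesis by blast
    qed
  qed
  then obtain Q where QA: "Q \<in> \<A>" and maxA: "\<And>K. K \<in> \<A> \<Longrightarrow> Q \<subseteq> K \<Longrightarrow> K = Q" by metis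
  have Q: "idl Q" "J \<subseteq> Q" "Q \<inter> W = {}" using QA unfolding \<A>_def by auto
  have max: "K = Q" if "idl K" "Q \<subseteq> K" "K \<inter> W = {}" for K
    using maxA[of K] that Q(2) unfolding \<A>_def by simp
  have ext: "\<exists>q\<in>Q. \<exists>w\<in>T. q + x * w \<in> W" if x: "x \<in> T" "x \<notin> Q" for x
  proof (rule ccontr)
    assume "\<not> ?thesis"
    then have "{j + x * w | j w. j \<in> Q \<and> w \<in> T} \<inter> W = {}" by blast
    from max[OF idl_extend[OF Q(1) x(1)] idl_extend_incl(1)[OF Q(1) x(1)] this]
    show False using idl_extend_incl(2)[OF Q(1) x(1)] x(2) by simp
  qed
  have "x \<in> Q \<or> y \<in> Q" if xy: "x \<in> T" "y \<in> T" "x * y \<in> Q" for x y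
  proof (rule ccontr)
    assume "\<not> ?thesis"
    then obtain q w q' w' where h: "q \<in> Q" "w \<in> T" "q + x * w \<in> W" "q' \<in> Q" "w' \<in> T" "q' + y * w' \<in> W"
      using ext xy by meson
    have "(q + x * w) * (q' + y * w') = q' * (q + x * w) + (q * (y * w') + (x * y) * (w * w'))"
      by (simp add: algebra_simps)
    also have "\<dots> \<in> Q"
    proof -
      have "q + x * w \<in> T" "y * w' \<in> T" "w * w' \<in> T" using h xy W(2) mult_mem by auto
      then show ?thesis using idlD(3,5)[OF Q(1)] h(1,4) xy(3) by simp
    qed
    finally show False using W(3)[OF h(3,6)] Q(3) by blast
  qed
  moreover have "Q \<noteq> T" using Q(3) W(1) one_mem by blast
  ultimately show thesis using that Q primeideal_on_iff by blast
qed

end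

section \<open>A criterion for Cohen-Macaulay rings of dimension two\<close>

lemma Sup_enat_eq:
  assumes "P m" "\<And>k. P k \<Longrightarrow> k \<le> m"
  shows "Sup {enat k | k. P k} = enat m"
  by (rule cSup_eq_maximum) (use assms in auto)

locale type_subdomain = type_subring T for T :: "'a::idom set"
begin

text \<open>
  Depth two comes from the regular sequence, and so does a prime strictly between \<open>0\<close> and \<open>P\<close>: take one that contains
  \<open>x1\<close> and is disjoint from the products of powers of \<open>x2\<close> with elements outside \<open>P\<close>. Such a prime
  exists because \<open>x2\<close> is regular modulo \<open>x1\<close>.
\<close>

lemma cohen_macaulayI:
  assumes noeth: "noetherian_ring (ring_on T)"
    and dim: "\<And>x0 x1 x2. x0 \<in> T \<Longrightarrow> x1 \<in> T \<Longrightarrow> x2 \<in> T \<Longrightarrow>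
      \<exists>(m0::nat) (m1::nat) (m2::nat). \<exists>a0\<in>T. \<exists>a1\<in>T. \<exists>a2\<in>T.
        x0 ^ m0 * (x1 ^ m1 * (x2 ^ m2 * (1 + a2 * x2) + a1 * x1) + a0 * x0) = 0"
    and reg: "\<And>P. maximalideal P (ring_on T) \<Longrightarrow> \<exists>x1\<in>P. \<exists>x2\<in>P. x1 \<noteq> 0 \<and>
      (\<forall>y\<in>T. \<forall>z\<in>T. x2 * y = x1 * z \<longrightarrow> (\<exists>w\<in>T. y = x1 * w))"
  shows "cohen_macaulay (ring_on T)"
  unfolding cohen_macaulay_def
proof (intro conjI allI impI)
  show "cring (ring_on T)" by (rule cring_on)
  show "noetherian_ring (ring_on T)" by (rule noeth)
  fix P assume max: "maximalideal P (ring_on T)"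
  note P = maximalideal_onD(1,2)[OF max]
  have Pone: "1 \<notin> P" using P idl_eq_carrier by blast
  interpret R: cring "ring_on T" by (rule cring_on)
  have Pprime: "primeideal P (ring_on T)" using R.maximalideal_prime[OF max] .
  obtain x1 x2 where x: "x1 \<in> P" "x2 \<in> P" "x1 \<noteq> 0"
    and r: "\<And>y z. y \<in> T \<Longrightarrow> z \<in> T \<Longrightarrow> x2 * y = x1 * z \<Longrightarrow> \<exists>w\<in>T. y = x1 * w"
    using reg[OF max] by blast
  have xT: "x1 \<in> T" "x2 \<in> T" using x idlD(1)[OF P(1)] by auto
  have I1: "Idl\<^bsub>ring_on T\<^esub> {x1} = {x1 * w | w. w \<in> T}" by (rule genideal_single[OF xT(1)])
  have r': "y \<in> Idl\<^bsub>ring_on T\<^esub> {x1}" if "y \<in> T" "x2 * y \<in> Idl\<^bsub>ring_on T\<^esub> {x1}" for y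
    using that r unfolding I1 by blast
  have seq: "regular_sequence (ring_on T) [x1, x2]"
    unfolding regular_sequence_def
  proof (intro conjI allI impI ballI)
    show "set [x1, x2] \<subseteq> carrier (ring_on T)" using xT by simp
    have "Idl\<^bsub>ring_on T\<^esub> (set [x1, x2]) \<subseteq> P" by (rule genideal_least[OF P(1)]) (use x in simp)
    then show "Idl\<^bsub>ring_on T\<^esub> (set [x1, x2]) \<noteq> carrier (ring_on T)" using Pone one_mem by auto
    fix i y assume "i < length [x1, x2]" and y: "y \<in> carrier (ring_on T)"
      and m: "[x1, x2] ! i \<otimes>\<^bsub>ring_on T\<^esub> y \<in> Idl\<^bsub>ring_on T\<^esub> (set (take i [x1, x2]))"
    then consider "i = 0" | "i = 1" by (cases i) auto
    then show "y \<in> Idl\<^bsub>ring_on T\<^esub> (set (take i [x1, x2]))"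
      using m y x(3) r' by cases (simp_all add: genideal_empty)
  qed
  have le2: "length xs \<le> 2" if xs: "set xs \<subseteq> P" "regular_sequence (ring_on T) xs" for xs
  proof (rule ccontr)
    assume "\<not> ?thesis"
    then have len: "i < 3 \<Longrightarrow> i < length xs" for i by simp
    have tk: "set (take i xs) \<subseteq> P" for i using xs(1) by (auto dest: in_set_takeD)
    have PT: "P \<subseteq> T" using idlD(1)[OF P(1)] by blast
    have "1 \<in> Idl\<^bsub>ring_on T\<^esub> (set (take 3 xs))"
    proof (rule flag_of_length_three_improper[OF dim, where I = "\<lambda>i. Idl\<^bsub>ring_on T\<^esub> (set (take i xs))" and x = "\<lambda>i. xs ! i"])
      fix i :: nat
      show "idl (Idl\<^bsub>ring_on T\<^esub> (set (take i xs)))" by (rule idl_genideal[OF subset_trans[OF tk PT]])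
      show "Idl\<^bsub>ring_on T\<^esub> (set (take i xs)) \<subseteq> Idl\<^bsub>ring_on T\<^esub> (set (take (Suc i) xs))"
        by (rule genideal_mono[OF set_take_subset_set_take]) simp
      assume i: "i < 3"
      show "xs ! i \<in> Idl\<^bsub>ring_on T\<^esub> (set (take (Suc i) xs))"
        by (rule genideal_incl) (simp add: take_Suc_conv_app_nth len[OF i])
      fix w assume "w \<in> T" "xs ! i * w \<in> Idl\<^bsub>ring_on T\<^esub> (set (take i xs))"
      then show "w \<in> Idl\<^bsub>ring_on T\<^esub> (set (take i xs))"
        using xs(2) len[OF i] unfolding regular_sequence_def by simp
    qed
    then show False using genideal_least[OF P(1) tk] Pone by blast
  qed
  have "ideal_depth (ring_on T) P = Sup {enat k | k. \<exists>xs. k = length xs \<and> set xs \<subseteq> P \<and> regular_sequence (ring_on T) xs}"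
    unfolding ideal_depth_def by (rule arg_cong[of _ _ Sup]) blast
  also have "\<dots> = enat 2"
    by (rule Sup_enat_eq) (use seq x le2 in \<open>auto intro!: exI[of _ "[x1, x2]"]\<close>)
  finally have depth: "ideal_depth (ring_on T) P = enat 2" .
  have "prime_height (ring_on T) P = enat 2" unfolding prime_height_def
  proof (rule Sup_enat_eq)
    define W where "W = {x2 ^ k * w | k w. w \<in> T - P}"
    have prodP: "v * w \<in> T - P" if "v \<in> T - P" "w \<in> T - P" for v w
      using that Pprime mult_mem unfolding primeideal_on_iff by blast
    obtain Q where Q: "primeideal Q (ring_on T)" "Idl\<^bsub>ring_on T\<^esub> {x1} \<subseteq> Q" "Q \<inter> W = {}"
    proof (rule exists_prime_avoiding)
      show "idl (Idl\<^bsub>ring_on T\<^esub> {x1})" by (rule idl_genideal) (use xT in simp)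
      have "1 = x2 ^ 0 * 1" by simp
      then show "1 \<in> W" unfolding W_def using one_mem Pone by blast
      show "W \<subseteq> T" unfolding W_def using mult_mem power_mem xT by blast
      fix v w assume "v \<in> W" "w \<in> W"
      then obtain k v' l w' where "v = x2 ^ k * v'" "w = x2 ^ l * w'" "v' \<in> T - P" "w' \<in> T - P"
        unfolding W_def by blast
      then have "v * w = x2 ^ (k + l) * (v' * w')" "v' * w' \<in> T - P" using prodP by (auto simp: power_add)
      then show "v * w \<in> W" unfolding W_def by blast
    next
      have "w \<in> P" if "w \<in> T" "x2 ^ k * w \<in> Idl\<^bsub>ring_on T\<^esub> {x1}" for k w
      proof -
        have "w \<in> Idl\<^bsub>ring_on T\<^esub> {x1}"
          by (rule idl_power_cancel[OF idl_genideal xT(2) that]) (use xT r' in auto)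
        then show ?thesis using genideal_least[OF P(1), of "{x1}"] x by blast
      qed
      then show "Idl\<^bsub>ring_on T\<^esub> {x1} \<inter> W = {}" unfolding W_def by blast
    qed
    have Q': "idl Q" using Q(1) unfolding primeideal_on_iff by blast
    have "Q \<subseteq> P"
    proof
      fix w assume w: "w \<in> Q"
      show "w \<in> P"
      proof (rule ccontr)
        assume "w \<notin> P"
        then have "x2 ^ 0 * w \<in> W" unfolding W_def using w idlD(1)[OF Q'] by blast
        then show False using w Q(3) by auto
      qed
    qed
    moreover have "x2 \<notin> Q"
    proof -
      have "x2 = x2 ^ 1 * 1" by simp
      then have "x2 \<in> W" unfolding W_def using one_mem Pone by blast
      then show ?thesis using Q(3) by blast
    qed
    ultimately have QP: "Q \<subset> P" using x by blast
    have zero: "primeideal {0} (ring_on T)"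
      unfolding primeideal_on_iff idl_def using zero_mem one_mem by auto
    have "x1 \<in> Q" using Q(2) genideal_incl[of x1 "{x1}"] by blast
    then have zQ: "{0} \<subset> Q" using x(3) idlD(2)[OF Q'] by blast
    define C where "C = (\<lambda>i::nat. if i = 0 then {0} else if i = 1 then Q else P)"
    have "(\<forall>i\<le>2. primeideal (C i) (ring_on T)) \<and> (\<forall>i<2. C i \<subset> C (Suc i)) \<and> C 2 = P"
      using zero Q(1) Pprime zQ QP unfolding C_def by (auto simp: less_2_cases_iff)
    then show "\<exists>C. (\<forall>i\<le>2. primeideal (C i) (ring_on T)) \<and> (\<forall>i<2. C i \<subset> C (Suc i)) \<and> C 2 = P" by blast
  next
    fix h assume "\<exists>C. (\<forall>i\<le>h. primeideal (C i) (ring_on T)) \<and> (\<forall>i<h. C i \<subset> C (Suc i)) \<and> C h = P"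
    then obtain C where C: "\<And>i. i \<le> h \<Longrightarrow> primeideal (C i) (ring_on T)" "\<And>i. i < h \<Longrightarrow> C i \<subset> C (Suc i)"
      by blast
    show "h \<le> 2"
    proof (rule ccontr)
      assume h: "\<not> h \<le> 2"
      have "\<exists>y. y \<in> C (Suc i) - C i" if "i < 3" for i using C(2)[of i] h that by auto
      then obtain y where y: "\<And>i. i < 3 \<Longrightarrow> y i \<in> C (Suc i) - C i" by metis
      have pr: "idl (C i)" "C i \<noteq> T"
        "\<And>v w. v \<in> T \<Longrightarrow> w \<in> T \<Longrightarrow> v * w \<in> C i \<Longrightarrow> v \<in> C i \<or> w \<in> C i" if "i \<le> 3" for i
        using C(1)[of i] h that unfolding primeideal_on_iff by auto
      have "1 \<in> C 3"
      proof (rule flag_of_length_three_improper[OF dim, where I = C and x = y])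
        fix i :: nat assume i: "i < 3"
        show "C i \<subseteq> C (Suc i)" using C(2)[of i] h i by auto
        show yC: "y i \<in> C (Suc i)" using y[OF i] by simp
        fix w assume "w \<in> T" "y i * w \<in> C i"
        moreover have "y i \<in> T" using yC idlD(1)[OF pr(1)[of "Suc i"]] i by simp
        ultimately show "w \<in> C i" using pr(3)[of i "y i" w] y[OF i] i by simp
      qed (use pr in auto)
      then show False using pr[of 3] idl_eq_carrier by simp
    qed
  qed
  then show "ideal_depth (ring_on T) P = prime_height (ring_on T) P" using depth by simp
qed

end

section \<open>Polynomials with prescribed exponents\<close>

inductive_set exp_span :: "(nat \<times> nat) set \<Rightarrow> (nat \<times> nat) set" for E where
  exp_span_zero: "(0, 0) \<in> exp_span E"
| exp_span_add: "(x, y) \<in> E \<Longrightarrow> (x', y') \<in> exp_span E \<Longrightarrow> (x + x', y + y') \<in> exp_span E"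

lemma exp_span_incl: "(x, y) \<in> E \<Longrightarrow> (x, y) \<in> exp_span E"
  using exp_span_add[OF _ exp_span_zero] by fastforce

lemma exp_span_closed:
  "(x, y) \<in> exp_span E \<Longrightarrow> (x', y') \<in> exp_span E \<Longrightarrow> (x + x', y + y') \<in> exp_span E"
  by (induction rule: exp_span.induct) (auto simp: add.assoc intro: exp_span_add)

abbreviation cst :: "'k::field \<Rightarrow> 'k poly poly" where "cst c \<equiv> [:[:c:]:]"

definition st_mono :: "nat \<Rightarrow> nat \<Rightarrow> 'k::field poly poly" where
  "st_mono x y = svar ^ x * tvar ^ y"

text \<open>
  The outer index belongs to \<open>s\<close>, the inner one to \<open>t\<close>.
\<close>

abbreviation coeff2 :: "'k::field poly poly \<Rightarrow> nat \<Rightarrow> nat \<Rightarrow> 'k" where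
  "coeff2 h i j \<equiv> coeff (coeff h i) j"

definition supported :: "(nat \<times> nat) set \<Rightarrow> 'k::field poly poly set" where
  "supported E = {h. \<forall>i j. coeff2 h i j \<noteq> 0 \<longrightarrow> (i, j) \<in> E}"

lemma st_mono_eq_monom: "(st_mono x y :: 'k::field poly poly) = monom (monom 1 y) x"
proof -
  have "(tvar :: 'k poly poly) ^ y = [:monom 1 y:]" for y
    by (induction y) (simp_all add: tvar_def one_pCons monom_Suc)
  moreover have "(svar :: 'k poly poly) ^ x = monom 1 x"
    by (induction x) (simp_all add: svar_def monom_Suc)
  ultimately show ?thesis unfolding st_mono_def by (simp add: smult_monom mult.commute)
qed

lemma st_mono_mult: "st_mono x y * st_mono x' y' = st_mono (x + x') (y + y')"
  by (simp add: st_mono_def power_add ac_simps)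

lemma st_mono_0_0: "st_mono 0 0 = 1" by (simp add: st_mono_def)

lemma st_mono_power: "st_mono x y ^ k = st_mono (x * k) (y * k)"
  by (simp add: st_mono_def power_mult power_mult_distrib)

lemma coeff2_cst_st_mono: "coeff2 (cst c * st_mono x y) i j = (if i = x \<and> j = y then c else 0)"
  by (simp add: st_mono_eq_monom smult_monom)

lemma supportedI: "(\<And>i j. coeff2 h i j \<noteq> 0 \<Longrightarrow> (i, j) \<in> E) \<Longrightarrow> h \<in> supported E"
  unfolding supported_def by blast

lemma supportedD: "h \<in> supported E \<Longrightarrow> coeff2 h i j \<noteq> 0 \<Longrightarrow> (i, j) \<in> E"
  unfolding supported_def by blast

lemma supported_mono: "E \<subseteq> F \<Longrightarrow> supported E \<subseteq> supported F"
  unfolding supported_def by blast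

lemma supported_Int: "supported E \<inter> supported F = supported (E \<inter> F)"
  unfolding supported_def by blast

lemma supported_0: "0 \<in> supported E" by (simp add: supported_def)

lemma supported_add: "f \<in> supported E \<Longrightarrow> g \<in> supported E \<Longrightarrow> f + g \<in> supported E"
  by (rule supportedI) (metis add_0 coeff_add supportedD)

lemma supported_uminus: "f \<in> supported E \<Longrightarrow> - f \<in> supported E"
  by (simp add: supported_def)

lemma cst_st_mono_in_supported: "(x, y) \<in> E \<Longrightarrow> cst c * st_mono x y \<in> supported E"
  by (rule supportedI) (unfold coeff2_cst_st_mono, metis)

lemma st_mono_in_supported: "(x, y) \<in> E \<Longrightarrow> st_mono x y \<in> supported E"
  using cst_st_mono_in_supported[of x y E 1] by (simp flip: one_pCons)

lemma st_mono_in_supported_iff: "st_mono x y \<in> (supported E :: 'k::field poly poly set) \<longleftrightarrow> (x, y) \<in> E"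
proof
  assume "st_mono x y \<in> (supported E :: 'k poly poly set)"
  then show "(x, y) \<in> E" by (rule supportedD) (simp add: st_mono_eq_monom)
qed (rule st_mono_in_supported)

lemma coeff2_mult:
  "coeff2 (f * g) i j = (\<Sum>k\<le>i. \<Sum>l\<le>j. coeff2 f k l * coeff2 g (i - k) (j - l))"
  by (simp add: coeff_mult coeff_sum)

lemma supported_mult:
  assumes "f \<in> supported E" "g \<in> supported F"
    and "\<And>x y x' y'. (x, y) \<in> E \<Longrightarrow> (x', y') \<in> F \<Longrightarrow> (x + x', y + y') \<in> G"
  shows "f * g \<in> supported G"
proof (rule supportedI)
  fix i j assume "coeff2 (f * g) i j \<noteq> 0"
  then obtain k l where kl: "k \<le> i" "l \<le> j" "coeff2 f k l * coeff2 g (i - k) (j - l) \<noteq> 0"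
    unfolding coeff2_mult by (meson atMost_iff sum.not_neutral_contains_not_neutral)
  then have "(k, l) \<in> E" "(i - k, j - l) \<in> F" using assms(1,2) supportedD by fastforce+
  from assms(3)[OF this] kl show "(i, j) \<in> G" by simp
qed

lemma supported_subset_closed:
  fixes A :: "'k::field poly poly set"
  assumes "0 \<in> A" "\<And>f g. f \<in> A \<Longrightarrow> g \<in> A \<Longrightarrow> f + g \<in> A"
    and "\<And>c x y. (x, y) \<in> E \<Longrightarrow> cst c * st_mono x y \<in> A"
  shows "supported E \<subseteq> A"
proof
  fix h :: "'k poly poly" assume h: "h \<in> supported E"
  have sumA: "sum f I \<in> A" if "\<And>i. i \<in> I \<Longrightarrow> f i \<in> A" for f :: "nat \<Rightarrow> 'k poly poly" and I
    using that by (induction I rule: infinite_finite_induct) (auto intro: assms(1,2))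
  have expand: "monom p i = (\<Sum>j\<le>degree p. cst (coeff p j) * st_mono i j)" for p :: "'k poly" and i
  proof (rule poly_eqI, rule poly_eqI)
    fix k m
    have "coeff2 (\<Sum>j\<le>degree p. cst (coeff p j) * st_mono i j) k m
        = (\<Sum>j\<le>degree p. if k = i \<and> m = j then coeff p j else 0)"
      by (simp only: coeff_sum coeff2_cst_st_mono)
    also have "\<dots> = coeff2 (monom p i) k m"
      by (cases "k = i") (auto simp: coeff_eq_0)
    finally show "coeff2 (monom p i) k m = coeff2 (\<Sum>j\<le>degree p. cst (coeff p j) * st_mono i j) k m" ..
  qed
  have "h = (\<Sum>i\<le>degree h. monom (coeff h i) i)" by (simp add: poly_as_sum_of_monoms)
  also have "\<dots> \<in> A"
  proof (rule sumA)
    fix i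
    have "cst (coeff2 h i j) * st_mono i j \<in> A" for j
      using supportedD[OF h, of i j] assms(1,3) by (cases "coeff2 h i j = 0") auto
    then show "monom (coeff h i) i \<in> A" unfolding expand by (intro sumA)
  qed
  finally show "h \<in> A" .
qed

locale exponent_monoid =
  fixes E :: "(nat \<times> nat) set"
  assumes zero_exp: "(0, 0) \<in> E"
    and add_exp: "(x, y) \<in> E \<Longrightarrow> (x', y') \<in> E \<Longrightarrow> (x + x', y + y') \<in> E"
begin

sublocale type_subdomain "supported E :: 'k::field poly poly set"
proof
  show "1 \<in> (supported E :: 'k poly poly set)" using st_mono_in_supported[OF zero_exp] by (simp add: st_mono_0_0)
qed (auto intro: supported_uminus supported_add supported_mult add_exp)

lemma cst_mem: "cst c \<in> supported E"
  using cst_st_mono_in_supported[OF zero_exp, of c] by (simp add: st_mono_0_0)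

lemma idl_supported:
  assumes "F \<subseteq> E" "\<And>x y x' y'. (x, y) \<in> E \<Longrightarrow> (x', y') \<in> F \<Longrightarrow> (x + x', y + y') \<in> F"
  shows "idl (supported F :: 'k::field poly poly set)"
  unfolding idl_def using supported_mono[OF assms(1)] supported_mult[OF _ _ assms(2)]
  by (auto intro: supported_0 supported_add)

lemma genideal_monos:
  assumes F: "F \<subseteq> E"
  defines "H \<equiv> {(x + x', y + y') | x y x' y'. (x, y) \<in> F \<and> (x', y') \<in> E}"
  shows "Idl\<^bsub>ring_on (supported E :: 'k::field poly poly set)\<^esub> {st_mono x y | x y. (x, y) \<in> F} = supported H"
    (is "Idl\<^bsub>_\<^esub> ?G = _")
proof
  have "(x, y) \<in> H" if "(x, y) \<in> F" for x y
    unfolding H_def using that zero_exp by force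
  then have gen: "?G \<subseteq> supported H" using st_mono_in_supported by blast
  have "H \<subseteq> E" unfolding H_def using F add_exp by blast
  moreover have "(x + x', y + y') \<in> H" if "(x, y) \<in> E" "(x', y') \<in> H" for x y x' y'
  proof -
    from that(2) obtain v w v' w' where "(v, w) \<in> F" "(v', w') \<in> E" "x' = v + v'" "y' = w + w'"
      unfolding H_def by blast
    then have "(v' + x, w' + y) \<in> E" "x + x' = v + (v' + x)" "y + y' = w + (w' + y)"
      using add_exp that(1) by auto
    then show ?thesis unfolding H_def using \<open>(v, w) \<in> F\<close> by blast
  qed
  ultimately have "idl (supported H :: 'k poly poly set)" by (rule idl_supported)
  then show "Idl\<^bsub>ring_on (supported E)\<^esub> ?G \<subseteq> supported H" using gen by (rule genideal_least)
  have "?G \<subseteq> supported E" using F st_mono_in_supported by blast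
  note id = idl_genideal[OF this]
  show "supported H \<subseteq> Idl\<^bsub>ring_on (supported E)\<^esub> ?G"
  proof (rule supported_subset_closed)
    fix c x y assume "(x, y) \<in> H"
    then obtain v w v' w' where h: "(v, w) \<in> F" "(v', w') \<in> E" "x = v + v'" "y = w + w'"
      unfolding H_def by blast
    have "st_mono v w \<in> Idl\<^bsub>ring_on (supported E)\<^esub> ?G" by (rule genideal_incl) (use h in blast)
    from idlD(4)[OF id cst_st_mono_in_supported[OF h(2), of c] this]
    show "cst c * st_mono x y \<in> Idl\<^bsub>ring_on (supported E)\<^esub> ?G"
      by (simp add: h st_mono_mult mult.assoc add.commute)
  qed (use idlD[OF id] in auto)
qed

section \<open>Primary monomial ideals\<close>

lemma primary_ideal_onI:
  assumes "idl Q" "1 \<notin> Q"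
    and "\<And>f g. f \<in> supported E \<Longrightarrow> g \<in> supported E \<Longrightarrow> f * g \<in> Q \<Longrightarrow> f \<notin> Q \<Longrightarrow> \<exists>k. g ^ k \<in> Q"
  shows "primary_ideal Q (ring_on (supported E :: 'k::field poly poly set))"
  unfolding primary_ideal_def ideal_on_iff using assms cring_on one_mem by auto

lemma power_graded:
  assumes "g \<in> supported E" "\<And>i j. coeff2 g i j \<noteq> 0 \<Longrightarrow> 1 \<le> \<phi> i j"
    and \<phi>: "\<And>i j i' j'. \<phi> (i + i') (j + j') = \<phi> i j + (\<phi> i' j' :: nat)"
  shows "g ^ k \<in> supported {(x, y). (x, y) \<in> E \<and> k \<le> \<phi> x y}"
proof (induction k)
  case 0
  have "supported {(x, y). (x, y) \<in> E \<and> 0 \<le> \<phi> x y} = supported E" by simp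
  then show ?case using one_mem by simp
next
  case (Suc k)
  have "g \<in> supported {(x, y). (x, y) \<in> E \<and> 1 \<le> \<phi> x y}"
    using assms(1,2) unfolding supported_def by blast
  then show ?case unfolding power_Suc by (rule supported_mult[OF _ Suc.IH]) (use add_exp \<phi> in force)
qed

text \<open>
  If the product lies in the ideal although one factor \<open>f\<close> does not, let \<open>i\<close> be the lowest power of
  \<open>s\<close> in \<open>f\<close> that violates \<open>A\<close>. In the coefficient of \<open>s\<^sup>i\<close> of the product all other
  contributions vanish, and so the other factor has no term free of \<open>s\<close>; its powers then have
  only large \<open>s\<close>-exponents.
\<close>

lemma primary_s_primary:
  fixes A :: "nat \<Rightarrow> bool"
  assumes A: "\<And>x x' y. A x \<Longrightarrow> (x', y) \<in> E \<Longrightarrow> A (x' + x)" "\<not> A 0" "\<And>x. D \<le> x \<Longrightarrow> A x"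
  shows "primary_ideal (supported {(x, y). (x, y) \<in> E \<and> A x})
    (ring_on (supported E :: 'k::field poly poly set))" (is "primary_ideal (supported ?F) _")
proof (rule primary_ideal_onI)
  show "idl (supported ?F)" by (rule idl_supported) (use A(1) add_exp in auto)
  have "st_mono 0 0 \<notin> supported ?F" unfolding st_mono_in_supported_iff using A by simp
  then show "1 \<notin> supported ?F" by (simp add: st_mono_0_0)
  fix f g :: "'k poly poly"
  assume f: "f \<in> supported E" and g: "g \<in> supported E" and fg: "f * g \<in> supported ?F" and nf: "f \<notin> supported ?F"
  have Ag: "A i" if "coeff h i \<noteq> 0" "h \<in> supported ?F" for h :: "'k poly poly" and i
    using that supportedD[of h ?F i] by (metis (mono_tags, lifting) case_prod_conv leading_coeff_0_iff mem_Collect_eq)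
  from nf obtain i j where "coeff2 f i j \<noteq> 0" "(i, j) \<notin> ?F" using supportedI by blast
  then have "coeff f i \<noteq> 0" "\<not> A i" using supportedD[OF f, of i j] by auto
  then have "\<exists>i. coeff f i \<noteq> 0 \<and> \<not> A i" by blast
  then obtain i where i: "coeff f i \<noteq> 0" "\<not> A i" and least: "\<And>k. k < i \<Longrightarrow> coeff f k = 0 \<or> A k"
    using exists_least_iff[of "\<lambda>i. coeff f i \<noteq> 0 \<and> \<not> A i"] by blast
  have other: "coeff f k * coeff g (i - k) = 0" if "k < i" for k
  proof (rule ccontr)
    assume "\<not> ?thesis"
    then have nz: "coeff f k \<noteq> 0" "coeff g (i - k) \<noteq> 0" by auto
    then obtain l where "coeff2 g (i - k) l \<noteq> 0" using leading_coeff_0_iff by blast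
    then have "A (i - k + k)" using A(1) supportedD[OF g] least[OF that] nz by blast
    then show False using i(2) that by simp
  qed
  have "coeff (f * g) i = (\<Sum>k\<le>i. coeff f k * coeff g (i - k))" by (simp add: coeff_mult)
  also have "\<dots> = (\<Sum>k\<in>{i}. coeff f k * coeff g (i - k))"
    by (rule sum.mono_neutral_right) (use other in auto)
  finally have "coeff (f * g) i = coeff f i * coeff g 0" by simp
  moreover have "coeff (f * g) i = 0" using Ag[OF _ fg] i(2) by blast
  ultimately have "coeff g 0 = 0" using i(1) by simp
  then have "1 \<le> i" if "coeff2 g i j \<noteq> 0" for i j using that by (cases i) auto
  then have "g ^ D \<in> supported {(x, y). (x, y) \<in> E \<and> D \<le> x}" by (intro power_graded[OF g]) auto
  then have "g ^ D \<in> supported ?F" using supported_mono[of _ ?F] A(3) by (smt (verit) case_prodE case_prodI mem_Collect_eq subset_iff)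
  then show "\<exists>k. g ^ k \<in> supported ?F" by blast
qed

text \<open>
  Elements without constant term are nilpotent modulo \<open>Q\<close>, and elements with nonzero constant
  term are a unit minus such an element, hence invertible modulo \<open>Q\<close> by the geometric series.
\<close>

lemma primary_maximal_radical:
  assumes Q: "idl Q" "1 \<notin> Q"
    and D: "supported {(x, y). (x, y) \<in> E \<and> D \<le> x + y} \<subseteq> Q"
  shows "primary_ideal Q (ring_on (supported E :: 'k::field poly poly set))"
proof (rule primary_ideal_onI[OF Q])
  fix f g :: "'k poly poly"
  assume f: "f \<in> supported E" and g: "g \<in> supported E" and fg: "f * g \<in> Q" and nf: "f \<notin> Q"
  have nil: "h ^ D \<in> Q" if "h \<in> supported E" "coeff2 h 0 0 = 0" for h
  proof -
    have "1 \<le> i + j" if "coeff2 h i j \<noteq> 0" for i j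
      using that \<open>coeff2 h 0 0 = 0\<close> by (cases "i = 0"; cases "j = 0") auto
    then have "h ^ D \<in> supported {(x, y). (x, y) \<in> E \<and> D \<le> x + y}" by (intro power_graded[OF that(1)]) auto
    then show ?thesis using D by blast
  qed
  have "coeff2 g 0 0 = 0"
  proof (rule ccontr)
    assume c: "coeff2 g 0 0 \<noteq> 0"
    define w where "w = cst (inverse (coeff2 g 0 0))"
    define u where "u = 1 - w * g"
    have u: "u \<in> supported E" unfolding u_def w_def by (intro diff_mem one_mem mult_mem cst_mem g)
    have "coeff2 u 0 0 = 0" unfolding u_def w_def using c by simp
    then have uD: "u ^ D \<in> Q" using nil u by blast
    have "f = w * (f * g) * (\<Sum>i<D. u ^ i) + f * u ^ D"
    proof -
      have "w * (f * g) * (\<Sum>i<D. u ^ i) = f * ((1 - u) * (\<Sum>i<D. u ^ i))" unfolding u_def by (simp add: ac_simps)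
      also have "\<dots> = f * (1 - u ^ D)" by (simp only: one_diff_power_eq)
      finally show ?thesis by (simp add: algebra_simps)
    qed
    also have "\<dots> \<in> Q"
      by (intro idlD(3)[OF Q(1)] idlD(5)[OF Q(1) sum_mem] idlD(4)[OF Q(1)] power_mem u f fg uD)
        (simp add: w_def cst_mem)
    finally show False using nf by simp
  qed
  then show "\<exists>k. g ^ k \<in> Q" using nil g by blast
qed

end

lemma exponent_monoid_span: "exponent_monoid (exp_span E)"
  by unfold_locales (auto intro: exp_span_zero exp_span_closed)

lemma generated_subalgebra_monos:
  "generated_subalgebra {st_mono x y | x y. (x, y) \<in> E} = ring_on (supported (exp_span E) :: 'k::field poly poly set)"
proof -
  interpret exponent_monoid "exp_span E" by (rule exponent_monoid_span)
  let ?R = "ring_of_type_algebra :: 'k poly poly ring"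
  let ?G = "constants \<union> {st_mono x y | x y. (x, y) \<in> E} :: 'k poly poly set"
  interpret U: type_subring "UNIV :: 'k poly poly set" by unfold_locales auto
  have R: "ring_on UNIV = ?R" by (simp add: ring_of_type_algebra_def)
  have sm: "monoid.mult ?R = (*)" "one ?R = 1" "ring.add ?R = (+)" by (simp_all add: ring_of_type_algebra_def)
  have neg: "\<ominus>\<^bsub>?R\<^esub> h = - h" for h using U.a_inv_on[of h] unfolding R by simp
  have mono_gen: "st_mono x y \<in> generate_ring ?R ?G" if "(x, y) \<in> exp_span E" for x y
    using that
  proof induction
    case exp_span_zero
    show ?case using generate_ring.one[of ?R ?G] by (simp add: sm st_mono_0_0)
  next
    case (exp_span_add x y x' y')
    have "st_mono x y \<in> generate_ring ?R ?G" by (rule generate_ring.incl) (use exp_span_add in blast)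
    from generate_ring.eng_mult[OF this exp_span_add.IH] show ?case by (simp add: sm st_mono_mult)
  qed
  have cst_gen: "cst c \<in> generate_ring ?R ?G" for c
    by (rule generate_ring.incl) (simp add: constants_def)
  have "generate_ring ?R ?G = supported (exp_span E)"
  proof
    show "supported (exp_span E) \<subseteq> generate_ring ?R ?G"
    proof (rule supported_subset_closed)
      show "0 \<in> generate_ring ?R ?G" using cst_gen[of 0] by simp
      show "f + g \<in> generate_ring ?R ?G" if "f \<in> generate_ring ?R ?G" "g \<in> generate_ring ?R ?G" for f g
        using generate_ring.eng_add[OF that] by (simp add: sm)
      show "cst c * st_mono x y \<in> generate_ring ?R ?G" if "(x, y) \<in> exp_span E" for c x y
        using generate_ring.eng_mult[OF cst_gen mono_gen[OF that]] by (simp add: sm)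
    qed
    show "generate_ring ?R ?G \<subseteq> supported (exp_span E)"
    proof
      fix h assume "h \<in> generate_ring ?R ?G"
      then show "h \<in> supported (exp_span E)"
      proof induction
        case (incl h)
        then show ?case by (auto simp: constants_def intro: cst_mem st_mono_in_supported exp_span_incl)
      qed (unfold sm neg, auto intro: one_mem uminus_mem add_mem mult_mem)
    qed
  qed
  then show ?thesis unfolding generated_subalgebra_def by simp
qed

section \<open>Algebraic dependence of three polynomials\<close>

text \<open>
  Gaussian elimination. It is used with monomials in three polynomials as unknowns, and
  with the steps of a chain of submodules as unknowns.
\<close>

lemma homogeneous_system_solvable:
  fixes A :: "'i \<Rightarrow> 'j \<Rightarrow> 'k::field"
  assumes "finite I" "finite J" "card I < card J"
  shows "\<exists>c. (\<exists>j\<in>J. c j \<noteq> 0) \<and> (\<forall>i\<in>I. (\<Sum>j\<in>J. c j * A i j) = 0)"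
  using assms
proof (induction I arbitrary: J A rule: finite_induct)
  case empty
  then have "J \<noteq> {}" by auto
  then show ?case by (intro exI[of _ "\<lambda>_. 1"]) auto
next
  case (insert i I)
  show ?case
  proof (cases "\<forall>j\<in>J. A i j = 0")
    case True
    have "card I < card J" using insert.prems insert.hyps by simp
    from insert.IH[OF insert.prems(1) this, of A] obtain c where c: "\<exists>j\<in>J. c j \<noteq> 0" "\<forall>i\<in>I. (\<Sum>j\<in>J. c j * A i j) = 0"
      by blast
    have "(\<Sum>j\<in>J. c j * A i j) = 0" using True by (intro sum.neutral) simp
    then show ?thesis using c by (intro exI[of _ c]) simp
  next
    case False
    then obtain p where p: "p \<in> J" "A i p \<noteq> 0" by blast
    define A' where "A' = (\<lambda>i' j. A i' j - A i' p * A i j / A i p)"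
    have "finite (J - {p})" "card I < card (J - {p})" using insert.prems insert.hyps p(1) by auto
    from insert.IH[OF this, of A'] obtain c where
      c: "\<exists>j\<in>J - {p}. c j \<noteq> 0" "\<forall>i\<in>I. (\<Sum>j\<in>J - {p}. c j * A' i j) = 0" by blast
    define s where "s = (\<Sum>j\<in>J - {p}. c j * A i j)"
    define c' where "c' = c(p := - s / A i p)"
    have split: "(\<Sum>j\<in>J. c' j * A k j) = - s / A i p * A k p + (\<Sum>j\<in>J - {p}. c j * A k j)" for k
      unfolding sum.remove[OF insert.prems(1) p(1)] c'_def by (auto intro!: sum.cong)
    have "(\<Sum>j\<in>J. c' j * A k j) = 0" if "k \<in> insert i I" for k
    proof (cases "k = i")
      case True
      then show ?thesis unfolding split using p(2) by (simp add: s_def)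
    next
      case False
      then have "0 = (\<Sum>j\<in>J - {p}. c j * A' k j)" using c(2) that by simp
      also have "\<dots> = (\<Sum>j\<in>J - {p}. c j * A k j - (A k p / A i p) * (c j * A i j))"
        unfolding A'_def by (simp add: algebra_simps)
      also have "\<dots> = (\<Sum>j\<in>J - {p}. c j * A k j) - (A k p / A i p) * s"
        unfolding s_def by (simp add: sum_subtractf sum_distrib_left)
      finally show ?thesis unfolding split by (simp add: algebra_simps)
    qed
    moreover have "\<exists>j\<in>J. c' j \<noteq> 0" using c(1) unfolding c'_def by auto
    ultimately show ?thesis by blast
  qed
qed

lemma supported_box_power:
  assumes "x \<in> supported ({..d} \<times> {..d})"
  shows "x ^ k \<in> supported ({..k * d} \<times> {..k * d})"
proof (induction k)
  case 0
  show ?case using st_mono_in_supported[of 0 0 "{..0 * d} \<times> {..0 * d}"] by (simp add: st_mono_0_0)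
next
  case (Suc k)
  show ?case unfolding power_Suc by (rule supported_mult[OF assms Suc.IH]) auto
qed

lemma supported_box_exists: "\<exists>d. (x :: 'k::field poly poly) \<in> supported ({..d} \<times> {..d})"
proof -
  let ?N = "Max ((\<lambda>i. degree (coeff x i)) ` {..degree x})"
  have "j \<le> ?N" if "coeff2 x i j \<noteq> 0" for i j
  proof -
    have "coeff x i \<noteq> 0" using that by auto
    then have "i \<le> degree x" by (rule le_degree)
    moreover have "j \<le> degree (coeff x i)" using that by (rule le_degree)
    ultimately show ?thesis by (meson Max_ge atMost_iff finite_atMost finite_imageI imageI le_trans)
  qed
  moreover have "i \<le> degree x" if "coeff2 x i j \<noteq> 0" for i j
    using that by (intro le_degree) auto
  ultimately have "x \<in> supported ({..degree x + ?N} \<times> {..degree x + ?N})"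
    by (intro supportedI) (force intro: trans_le_add1 trans_le_add2)
  then show ?thesis by blast
qed

text \<open>
  Counting: there are \<open>N\<^sup>3\<close> monomials of degree below \<open>N\<close> in each of the three polynomials, while
  their exponents lie in a square whose side grows linearly in \<open>N\<close>.
\<close>

lemma three_polynomials_dependent:
  fixes x0 x1 x2 :: "'k::field poly poly"
  shows "\<exists>N c. (\<exists>i<N. \<exists>j<N. \<exists>k<N. c i j k \<noteq> 0) \<and>
    (\<Sum>i<N. (\<Sum>j<N. (\<Sum>k<N. cst (c i j k) * x2 ^ k) * x1 ^ j) * x0 ^ i) = 0"
proof -
  obtain d0 d1 d2 where d012: "x0 \<in> supported ({..d0} \<times> {..d0})" "x1 \<in> supported ({..d1} \<times> {..d1})"
    "x2 \<in> supported ({..d2} \<times> {..d2})" using supported_box_exists by metis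
  define d where "d = d0 + d1 + d2 + 1"
  have box: "supported ({..e} \<times> {..e}) \<subseteq> supported ({..d} \<times> {..d})" if "e \<le> d" for e
    by (rule supported_mono) (use that in auto)
  have d: "x0 \<in> supported ({..d} \<times> {..d})" "x1 \<in> supported ({..d} \<times> {..d})" "x2 \<in> supported ({..d} \<times> {..d})"
    using box[of d0] box[of d1] box[of d2] d012 unfolding d_def by auto
  \<comment> \<open>The choice makes \<open>(4Nd)\<^sup>2 = N\<^sup>3\<close>.\<close>
  define N where "N = 16 * d * d"
  define I where "I = {..3 * (N * d)} \<times> {..3 * (N * d)}"
  define J where "J = {..<N} \<times> {..<N} \<times> {..<N}"
  define P where "P = (\<lambda>(i, j, k). x2 ^ k * x1 ^ j * x0 ^ i)"
  have d1: "d \<ge> 1" unfolding d_def by simp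
  have "card I = (3 * (N * d) + 1) * (3 * (N * d) + 1)" unfolding I_def by simp
  also have "\<dots> < (4 * (N * d)) * (4 * (N * d))"
  proof -
    have "1 * 1 \<le> N * d" using d1 unfolding N_def by (intro mult_le_mono) auto
    moreover have "N * d \<noteq> 1" using d1 unfolding N_def by auto
    ultimately have "1 < N * d" by linarith
    then have "3 * (N * d) + 1 < 4 * (N * d)" by linarith
    moreover have "0 < N" "0 < d" using d1 unfolding N_def by auto
    ultimately show ?thesis by (intro mult_strict_mono) auto
  qed
  also have "\<dots> = N * N * N" unfolding N_def by (simp add: algebra_simps)
  also have "\<dots> = card J" unfolding J_def by (simp add: card_cartesian_product)
  finally have card: "card I < card J" .
  have "finite I" "finite J" unfolding I_def J_def by auto
  from homogeneous_system_solvable[OF this card, of "\<lambda>(i, j) w. coeff2 (P w) i j"]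
  obtain c where c: "\<exists>w\<in>J. c w \<noteq> 0" "\<And>i j. (i, j) \<in> I \<Longrightarrow> (\<Sum>w\<in>J. c w * coeff2 (P w) i j) = 0"
    by fast
  have PI: "P w \<in> supported I" if "w \<in> J" for w
  proof -
    obtain i j k where w0: "w = (i, j, k)" by (cases w)
    then have w: "w = (i, j, k)" "i < N" "j < N" "k < N" using that unfolding J_def by auto
    have le: "i * d \<le> N * d" "j * d \<le> N * d" "k * d \<le> N * d" using w by (auto intro: mult_le_mono1)
    have "x2 ^ k * x1 ^ j \<in> supported ({..k * d + j * d} \<times> {..k * d + j * d})"
      by (rule supported_mult[OF supported_box_power[OF d(3)] supported_box_power[OF d(2)]]) auto
    moreover have "z + z' \<le> 3 * (N * d)" if "z \<le> k * d + j * d" "z' \<le> i * d" for z z'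
      using that le by linarith
    ultimately have "x2 ^ k * x1 ^ j * x0 ^ i \<in> supported I"
      by (intro supported_mult[OF _ supported_box_power[OF d(1)]]) (auto simp: I_def)
    then show ?thesis unfolding w P_def by simp
  qed
  have "(\<Sum>w\<in>J. cst (c w) * P w) = 0"
  proof (rule poly_eqI, rule poly_eqI)
    fix i j
    have "coeff2 (\<Sum>w\<in>J. cst (c w) * P w) i j = (\<Sum>w\<in>J. c w * coeff2 (P w) i j)"
      by (simp add: coeff_sum)
    also have "\<dots> = 0"
    proof (cases "(i, j) \<in> I")
      case False
      then show ?thesis using PI supportedD by (intro sum.neutral) fastforce
    qed (rule c(2))
    finally show "coeff2 (\<Sum>w\<in>J. cst (c w) * P w) i j = coeff2 0 i j" by simp
  qed
  also have "(\<Sum>w\<in>J. cst (c w) * P w) = (\<Sum>i<N. (\<Sum>j<N. (\<Sum>k<N. cst (c (i, j, k)) * x2 ^ k) * x1 ^ j) * x0 ^ i)"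
    unfolding J_def P_def by (simp add: sum.cartesian_product' sum_distrib_right mult.assoc)
  finally have "(\<Sum>i<N. (\<Sum>j<N. (\<Sum>k<N. cst (c (i, j, k)) * x2 ^ k) * x1 ^ j) * x0 ^ i) = 0" .
  moreover have "\<exists>i<N. \<exists>j<N. \<exists>k<N. c (i, j, k) \<noteq> 0" using c(1) unfolding J_def by auto
  ultimately show ?thesis by (intro exI[of _ N] exI[of _ "\<lambda>i j k. c (i, j, k)"]) simp
qed

lemma (in type_subring) split_lowest_power:
  assumes "x \<in> T" "\<And>i. f i \<in> T" "m < N" "\<And>i. i < m \<Longrightarrow> f i = 0"
  shows "\<exists>b\<in>T. (\<Sum>i<N. f i * x ^ i) = x ^ m * (f m + b * x)"
proof -
  let ?b = "\<Sum>i\<in>{Suc m..<N}. f i * x ^ (i - Suc m)"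
  have "(\<Sum>i<N. f i * x ^ i) = (\<Sum>i\<in>{m..<N}. f i * x ^ i)"
    by (rule sum.mono_neutral_right) (use assms(4) in auto)
  also have "\<dots> = f m * x ^ m + (\<Sum>i\<in>{Suc m..<N}. f i * x ^ i)"
    using assms(3) by (simp add: sum.atLeast_Suc_lessThan)
  also have "(\<Sum>i\<in>{Suc m..<N}. f i * x ^ i) = (\<Sum>i\<in>{Suc m..<N}. x ^ m * x * (f i * x ^ (i - Suc m)))"
  proof (rule sum.cong)
    fix i assume "i \<in> {Suc m..<N}"
    then have "x ^ i = x ^ m * x * x ^ (i - Suc m)"
      by (metis atLeastLessThan_iff le_add_diff_inverse power_Suc2 power_add)
    then show "f i * x ^ i = x ^ m * x * (f i * x ^ (i - Suc m))" by (simp add: ac_simps)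
  qed simp
  also have "\<dots> = x ^ m * x * ?b" by (rule sum_distrib_left[symmetric])
  also have "f m * x ^ m + \<dots> = x ^ m * (f m + ?b * x)" by (simp only: distrib_left ac_simps)
  finally have "(\<Sum>i<N. f i * x ^ i) = x ^ m * (f m + ?b * x)" .
  moreover have "?b \<in> T" by (intro sum_mem mult_mem power_mem assms(1,2))
  ultimately show ?thesis by (rule rev_bexI[rotated])
qed

section \<open>Maximal ideals contain polynomials in one monomial\<close>

text \<open>
  The substitution homomorphism from \<open>K[z]\<close> to \<open>K[s,t]\<close> that sends \<open>z\<close> to \<open>u\<close>.
\<close>

definition eval_at :: "'k::field poly poly \<Rightarrow> 'k poly \<Rightarrow> 'k poly poly" where
  "eval_at u g = poly (map_poly cst g) u"

lemma eval_at_0: "eval_at u 0 = 0" by (simp add: eval_at_def)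

lemma eval_at_pCons: "eval_at u (pCons c g) = cst c + u * eval_at u g"
proof (cases "c = 0 \<and> g = 0")
  case True then show ?thesis by (simp add: eval_at_0)
next
  case False then show ?thesis by (auto simp: eval_at_def map_poly_pCons)
qed

lemma eval_at_const: "eval_at u [:c:] = cst c"
  unfolding eval_at_pCons eval_at_0 by simp

lemma eval_at_1: "eval_at u 1 = 1"
  using eval_at_const[of u 1] by (simp flip: one_pCons)

lemma eval_at_monom: "eval_at u (monom c i) = cst c * u ^ i"
  by (induction i) (simp_all add: monom_0 eval_at_const monom_Suc eval_at_pCons eval_at_0)

lemma eval_at_add: "eval_at u (g + h) = eval_at u g + eval_at u h"
proof -
  have "map_poly cst (g + h) = map_poly cst g + map_poly cst h"
    by (rule poly_eqI) (simp add: coeff_map_poly)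
  then show ?thesis by (simp add: eval_at_def)
qed

lemma eval_at_uminus: "eval_at u (- g) = - eval_at u g"
  using eval_at_add[of u g "- g"] by (simp add: eval_at_0 eq_neg_iff_add_eq_0 add.commute)

lemma eval_at_smult: "eval_at u (smult c g) = cst c * eval_at u g"
proof -
  have "map_poly cst (smult c g) = smult (cst c) (map_poly cst g)"
    by (rule poly_eqI) (simp add: coeff_map_poly)
  then show ?thesis by (simp add: eval_at_def)
qed

lemma eval_at_mult: "eval_at u (g * h) = eval_at u g * eval_at u h"
proof (induction g)
  case (pCons c g)
  then show ?case
    by (simp only: mult_pCons_left eval_at_add eval_at_smult eval_at_pCons distrib_right mult.assoc) simp
qed (simp add: eval_at_0)

lemma eval_at_power: "eval_at u (g ^ m) = eval_at u g ^ m"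
  by (induction m) (simp_all add: eval_at_mult eval_at_1)

lemma eval_at_sum: "eval_at u (sum f I) = (\<Sum>i\<in>I. eval_at u (f i))"
  by (induction I rule: infinite_finite_induct) (simp_all add: eval_at_0 eval_at_add)

text \<open>
  The sum of \<open>P\<close> and the \<open>B\<close>-module generated by a list, with the head of the list split off, as is
  convenient for eliminating generators one by one.
\<close>

primrec lin_span :: "'a::comm_ring_1 set \<Rightarrow> 'a set \<Rightarrow> 'a list \<Rightarrow> 'a set" where
  "lin_span B P [] = P"
| "lin_span B P (e # es) = {b * e + y | b y. b \<in> B \<and> y \<in> lin_span B P es}"

locale plane_algebra = type_subdomain T for T :: "'k::field poly poly set" +
  assumes cst_mem: "cst c \<in> T"
begin

lemma eval_at_mem: "u \<in> T \<Longrightarrow> eval_at u g \<in> T"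
  by (induction g) (simp_all add: eval_at_0 eval_at_pCons zero_mem add_mem mult_mem cst_mem)

text \<open>
  From a relation among the three polynomials cancel the highest possible power of \<open>x0\<close>; what
  remains modulo \<open>x0\<close> is a nontrivial relation between \<open>x1\<close> and \<open>x2\<close>.
\<close>

lemma dependence_modulo_first:
  assumes x: "x0 \<in> T" "x1 \<in> T" "x2 \<in> T"
  shows "\<exists>m N d. \<exists>b\<in>T. (\<exists>j<N. \<exists>k<N. d j k \<noteq> 0) \<and>
    x0 ^ m * ((\<Sum>j<N. (\<Sum>k<N. cst (d j k) * x2 ^ k) * x1 ^ j) + b * x0) = 0"
proof -
  obtain N c where c: "\<exists>i<N. \<exists>j<N. \<exists>k<N. c i j k \<noteq> 0"
    and z: "(\<Sum>i<N. (\<Sum>j<N. (\<Sum>k<N. cst (c i j k) * x2 ^ k) * x1 ^ j) * x0 ^ i) = 0"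
    using three_polynomials_dependent[of x2 x1 x0] by blast
  let ?nz = "\<lambda>i. i < N \<and> (\<exists>j<N. \<exists>k<N. c i j k \<noteq> 0)"
  obtain m where m: "?nz m" and least: "\<And>i. i < m \<Longrightarrow> \<not> ?nz i"
    using exists_least_iff[of ?nz] c by blast
  have fT: "(\<Sum>j<N. (\<Sum>k<N. cst (c i j k) * x2 ^ k) * x1 ^ j) \<in> T" for i
    by (intro sum_mem mult_mem power_mem cst_mem x)
  have f0: "(\<Sum>j<N. (\<Sum>k<N. cst (c i j k) * x2 ^ k) * x1 ^ j) = 0" if "i < m" for i
    using least[OF that] m that by (intro sum.neutral) auto
  from split_lowest_power[where N = N and f = "\<lambda>i. \<Sum>j<N. (\<Sum>k<N. cst (c i j k) * x2 ^ k) * x1 ^ j", OF x(1) fT conjunct1[OF m] f0]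
  obtain b where b: "b \<in> T" "(\<Sum>i<N. (\<Sum>j<N. (\<Sum>k<N. cst (c i j k) * x2 ^ k) * x1 ^ j) * x0 ^ i)
      = x0 ^ m * ((\<Sum>j<N. (\<Sum>k<N. cst (c m j k) * x2 ^ k) * x1 ^ j) + b * x0)"
    by blast
  show ?thesis using m b(1) trans[OF b(2)[symmetric] z] by blast
qed

text \<open>
  The Coquand-Lombardi identity: the lexicographically lowest term of a relation is split off
  one variable at a time.
\<close>

lemma dimension_at_most_two:
  assumes x: "x0 \<in> T" "x1 \<in> T" "x2 \<in> T"
  shows "\<exists>(m0::nat) (m1::nat) (m2::nat). \<exists>b0\<in>T. \<exists>b1\<in>T. \<exists>b2\<in>T.
    x0 ^ m0 * (x1 ^ m1 * (x2 ^ m2 * (1 + b2 * x2) + b1 * x1) + b0 * x0) = 0"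
proof -
  obtain m0 N d b0 where b0: "b0 \<in> T" and nz: "\<exists>j<N. \<exists>k<N. d j k \<noteq> 0"
    and z: "x0 ^ m0 * ((\<Sum>j<N. (\<Sum>k<N. cst (d j k) * x2 ^ k) * x1 ^ j) + b0 * x0) = 0"
    using dependence_modulo_first[OF x] by blast
  let ?nz = "\<lambda>j. j < N \<and> (\<exists>k<N. d j k \<noteq> 0)"
  obtain m1 where m1: "?nz m1" and least1: "\<And>j. j < m1 \<Longrightarrow> \<not> ?nz j"
    using exists_least_iff[of ?nz] nz by blast
  have fT: "(\<Sum>k<N. cst (d j k) * x2 ^ k) \<in> T" for j
    by (intro sum_mem mult_mem power_mem cst_mem x)
  have f0: "(\<Sum>k<N. cst (d j k) * x2 ^ k) = 0" if "j < m1" for j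
    using least1[OF that] m1 that by (intro sum.neutral) auto
  from split_lowest_power[where N = N and f = "\<lambda>j. \<Sum>k<N. cst (d j k) * x2 ^ k", OF x(2) fT conjunct1[OF m1] f0]
  obtain b1 where b1: "b1 \<in> T" and e1: "(\<Sum>j<N. (\<Sum>k<N. cst (d j k) * x2 ^ k) * x1 ^ j)
      = x1 ^ m1 * ((\<Sum>k<N. cst (d m1 k) * x2 ^ k) + b1 * x1)"
    by blast
  let ?nz = "\<lambda>k. k < N \<and> d m1 k \<noteq> 0"
  obtain m2 where m2: "?nz m2" and least2: "\<And>k. k < m2 \<Longrightarrow> \<not> ?nz k"
    using exists_least_iff[of ?nz] m1 by blast
  have f0': "cst (d m1 k) = 0" if "k < m2" for k using least2[OF that] m2 that by simp
  from split_lowest_power[where N = N and f = "\<lambda>k. cst (d m1 k)", OF x(3) cst_mem conjunct1[OF m2] f0']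
  obtain b2 where b2: "b2 \<in> T" and e2: "(\<Sum>k<N. cst (d m1 k) * x2 ^ k) = x2 ^ m2 * (cst (d m1 m2) + b2 * x2)"
    by blast
  define e where "e = cst (inverse (d m1 m2))"
  have e: "e \<in> T" "e * cst (d m1 m2) = 1"
    using m2 cst_mem by (simp_all add: e_def flip: one_pCons)
  have "0 = e * (x0 ^ m0 * (x1 ^ m1 * (x2 ^ m2 * (cst (d m1 m2) + b2 * x2) + b1 * x1) + b0 * x0))"
    using z unfolding e1 e2 by simp
  also have "\<dots> = x0 ^ m0 * (x1 ^ m1 * (x2 ^ m2 * (e * cst (d m1 m2) + e * b2 * x2) + e * b1 * x1) + e * b0 * x0)"
    by (simp only: distrib_left ac_simps)
  finally have "x0 ^ m0 * (x1 ^ m1 * (x2 ^ m2 * (1 + e * b2 * x2) + e * b1 * x1) + e * b0 * x0) = 0"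
    unfolding e(2) by simp
  moreover have "e * b0 \<in> T" "e * b1 \<in> T" "e * b2 \<in> T" using b0 b1 b2 e(1) mult_mem by auto
  ultimately show ?thesis by blast
qed

lemma lin_span_ConsI: "b \<in> B \<Longrightarrow> y \<in> lin_span B P es \<Longrightarrow> b * e + y \<in> lin_span B P (e # es)"
  by (simp, intro exI[of _ b] exI[of _ y]) simp

context
  fixes P B :: "'k poly poly set"
  assumes P: "idl P"
    and B: "type_subring B" "B \<subseteq> T"
begin

interpretation B: type_subring B by (rule B(1))

lemma lin_span_incl: "P \<subseteq> lin_span B P es"
proof (induction es)
  case (Cons e es)
  show ?case
  proof
    fix y assume "y \<in> P"
    then show "y \<in> lin_span B P (e # es)" using Cons.IH lin_span_ConsI[OF B.zero_mem, of y P es e] by auto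
  qed
qed simp

lemma lin_span_gen: "e \<in> set es \<Longrightarrow> e \<in> lin_span B P es"
proof (induction es)
  case (Cons f es)
  show ?case
  proof (cases "e = f")
    case True
    have "0 \<in> lin_span B P es" using lin_span_incl idlD(2)[OF P] by blast
    then show ?thesis using True lin_span_ConsI[OF B.one_mem, of 0 P es f] by simp
  next
    case False
    then have "e \<in> lin_span B P es" using Cons by simp
    then show ?thesis using lin_span_ConsI[OF B.zero_mem, of e P es f] by simp
  qed
qed simp

lemma lin_span_add: "x \<in> lin_span B P es \<Longrightarrow> y \<in> lin_span B P es \<Longrightarrow> x + y \<in> lin_span B P es"
proof (induction es arbitrary: x y)
  case Nil then show ?case using idlD(3)[OF P] by simp
next
  case (Cons e es)
  then obtain b x' c y' where "b \<in> B" "x' \<in> lin_span B P es" "x = b * e + x'"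
    "c \<in> B" "y' \<in> lin_span B P es" "y = c * e + y'" by auto
  moreover from this have "x + y = (b + c) * e + (x' + y')" by (simp add: algebra_simps)
  ultimately show ?case using lin_span_ConsI[OF B.add_mem Cons.IH] by metis
qed

lemma lin_span_mult: "b \<in> B \<Longrightarrow> x \<in> lin_span B P es \<Longrightarrow> b * x \<in> lin_span B P es"
proof (induction es arbitrary: x)
  case Nil then show ?case using idlD(4)[OF P] B(2) by auto
next
  case (Cons e es)
  then obtain c y where "c \<in> B" "y \<in> lin_span B P es" "x = c * e + y" by auto
  moreover from this have "b * x = (b * c) * e + b * y" by (simp add: algebra_simps)
  ultimately show ?case using lin_span_ConsI[OF B.mult_mem Cons.IH] Cons.prems(1) by metis
qed

lemma lin_span_sum: "(\<And>i. i \<in> I \<Longrightarrow> f i \<in> lin_span B P es) \<Longrightarrow> sum f I \<in> lin_span B P es"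
  using lin_span_incl[of es] idlD(2)[OF P]
  by (induction I rule: infinite_finite_induct) (auto intro: lin_span_add)

text \<open>
  Modulo the ideal \<open>P\<close>, if \<open>T\<close> is a finite \<open>B\<close>-module and \<open>q\<close> in \<open>B\<close> is invertible in \<open>T\<close>, then \<open>q\<close> is
  invertible in \<open>B\<close> already. As in Nakayama's lemma, the generators are eliminated one after the other:
  since \<open>e = q (w e)\<close>, multiplying by a suitable element of \<open>1 + qB\<close> moves \<open>e\<close> into the span of the
  remaining generators.
\<close>

lemma inverse_in_base:
  assumes "set es \<subseteq> T" "T \<subseteq> lin_span B P es" "q \<in> B" "w \<in> T" "1 - q * w \<in> P"
  shows "\<exists>b\<in>B. 1 + q * b \<in> P"
proof -
  have "\<exists>b\<in>B. \<forall>x\<in>T. (1 + q * b) * x \<in> P"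
    if "set es \<subseteq> T" "\<exists>b\<in>B. \<forall>x\<in>T. (1 + q * b) * x \<in> lin_span B P es" for es
    using that
  proof (induction es)
    case (Cons e es)
    then obtain b where b: "b \<in> B" "\<And>x. x \<in> T \<Longrightarrow> (1 + q * b) * x \<in> lin_span B P (e # es)" by blast
    have e: "e \<in> T" using Cons.prems by simp
    obtain b' y where by': "b' \<in> B" "y \<in> lin_span B P es" "(1 + q * b) * (w * e) = b' * e + y"
      using b(2)[OF mult_mem[OF assms(4) e]] by auto
    have "(1 + q * (b - b')) * e = (1 + q * b) * e * (1 - q * w) + q * y"
    proof -
      have "(1 + q * b) * e * (1 - q * w) + q * y = (1 + q * b) * e - q * ((1 + q * b) * (w * e)) + q * y"
        by (simp add: algebra_simps)
      then show ?thesis unfolding by'(3) by (simp add: algebra_simps)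
    qed
    moreover have "(1 + q * b) * e * (1 - q * w) \<in> P"
      using b(1) assms(3) B(2) e by (intro idlD(4)[OF P] assms(5) mult_mem add_mem one_mem) auto
    ultimately have 1: "(1 + q * (b - b')) * e \<in> lin_span B P es"
      using lin_span_incl lin_span_add lin_span_mult[OF assms(3) by'(2)] by (metis subsetD)
    have bb: "1 + q * (b - b') \<in> B" using b(1) by'(1) assms(3) by (intro B.add_mem B.mult_mem B.diff_mem B.one_mem)
    define b'' where "b'' = (b - b') + b + q * (b - b') * b"
    have b'': "b'' \<in> B" unfolding b''_def using b(1) by'(1) assms(3) by (intro B.add_mem B.mult_mem B.diff_mem)
    have "(1 + q * b'') * x \<in> lin_span B P es" if x: "x \<in> T" for x
    proof -
      obtain c z where c: "c \<in> B" "z \<in> lin_span B P es" "(1 + q * b) * x = c * e + z" using b(2)[OF x] by auto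
      have "(1 + q * b'') * x = (1 + q * (b - b')) * ((1 + q * b) * x)" unfolding b''_def by (simp add: algebra_simps)
      also have "\<dots> = c * ((1 + q * (b - b')) * e) + (1 + q * (b - b')) * z" unfolding c(3) by (simp add: algebra_simps)
      also have "\<dots> \<in> lin_span B P es"
        by (rule lin_span_add[OF lin_span_mult[OF c(1) 1] lin_span_mult[OF bb c(2)]])
      finally show ?thesis .
    qed
    then show ?case using Cons.IH Cons.prems(1) b'' by auto
  qed simp
  moreover have "\<exists>b\<in>B. \<forall>x\<in>T. (1 + q * b) * x \<in> lin_span B P es"
    using B.zero_mem assms(2) by (intro bexI[of _ 0]) auto
  ultimately obtain b where "b \<in> B" "(1 + q * b) * 1 \<in> P" using assms(1) one_mem by blast
  then show ?thesis by auto
qed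

end

text \<open>
  A form of Zariski's lemma. Suppose that no nonzero polynomial in \<open>u\<close> lies in \<open>P\<close>. The given relation expresses
  \<open>v\<^sup>K\<close> by lower powers of \<open>v\<close> modulo \<open>P\<close>, once its leading coefficient \<open>C\<close>, a polynomial in
  \<open>u\<close>, is inverted. So the field \<open>T/P\<close> is a finite module over \<open>B = K[u, 1/C]\<close>, and by
  \<open>inverse_in_base\<close> every nonzero polynomial in \<open>u\<close> is a unit of \<open>B\<close>. But \<open>q = 1 + uC\<close> is not, because it
  is nonconstant and coprime to \<open>C\<close>.
\<close>

lemma maximal_ideal_algebraic:
  assumes max: "maximalideal P (ring_on T)"
    and uv: "u \<in> T" "v \<in> T"
    and es: "set es \<subseteq> T"
    and span: "\<And>A. (\<And>x y. x \<in> A \<Longrightarrow> y \<in> A \<Longrightarrow> x + y \<in> A) \<Longrightarrow> 0 \<in> A \<Longrightarrow>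
      (\<And>c i j e. e \<in> set es \<Longrightarrow> cst c * u ^ i * (v ^ j * e) \<in> A) \<Longrightarrow> T \<subseteq> A"
    and d: "(\<Sum>j<N. (\<Sum>k<N. cst (d j k) * v ^ k) * u ^ j) \<in> P" "\<exists>j<N. \<exists>k<N. d j k \<noteq> 0"
  shows "\<exists>f. f \<noteq> 0 \<and> eval_at u f \<in> P"
proof (rule ccontr)
  assume "\<not> ?thesis"
  then have inj: "f = 0" if "eval_at u f \<in> P" for f using that by blast
  note P = maximalideal_onD[OF max]
  define g where "g = (\<lambda>k. \<Sum>j<N. monom (d j k) j)"
  have gcoeff: "coeff (g k) j = d j k" if "j < N" for j k
    unfolding g_def using that by (simp add: coeff_sum)
  obtain j k where jk: "j < N" "k < N" "d j k \<noteq> 0" using d(2) by blast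
  then have gk: "g k \<noteq> 0" using gcoeff[OF jk(1), of k] by auto
  define S where "S = {k. k < N \<and> g k \<noteq> 0}"
  define K where "K = Max S"
  have S: "finite S" "k \<in> S" unfolding S_def using gk jk(2) by auto
  then have "K \<in> S" unfolding K_def using Max_in by blast
  then have K: "K < N" "g K \<noteq> 0" unfolding S_def by auto
  have above: "g k = 0" if "k < N" "K < k" for k
  proof (rule ccontr)
    assume "g k \<noteq> 0"
    then have "k \<le> K" unfolding K_def using S(1) that(1) by (intro Max_ge) (auto simp: S_def)
    then show False using that(2) by simp
  qed
  define C where "C = eval_at u (g K)"
  have CT: "C \<in> T" unfolding C_def by (rule eval_at_mem[OF uv(1)])
  obtain C' where C': "C' \<in> T" "1 - C * C' \<in> P" using P(3)[OF CT] inj K(2) C_def by blast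
  have "(\<Sum>j<N. (\<Sum>k<N. cst (d j k) * v ^ k) * u ^ j) = (\<Sum>j<N. \<Sum>k<N. cst (d j k) * u ^ j * v ^ k)"
    by (simp only: sum_distrib_left sum_distrib_right ac_simps)
  also have "\<dots> = (\<Sum>k<N. eval_at u (g k) * v ^ k)"
    unfolding g_def eval_at_sum eval_at_monom sum_distrib_right by (rule sum.swap)
  also have "\<dots> = (\<Sum>k<Suc K. eval_at u (g k) * v ^ k)"
    by (rule sum.mono_neutral_right) (use K above in \<open>auto simp: eval_at_0 not_less Suc_le_eq\<close>)
  finally have G: "(\<Sum>k<K. eval_at u (g k) * v ^ k) + C * v ^ K \<in> P" using d(1) unfolding C_def by simp
  \<comment> \<open>The ring \<open>K[u, 1/C]\<close>, described modulo \<open>P\<close> without reference to \<open>C'\<close>.\<close>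
  define B where "B = {b \<in> T. \<exists>m h. C ^ m * b - eval_at u h \<in> P}"
  have BI: "b \<in> B" if "b \<in> T" "C ^ m * b - eval_at u h \<in> P" for b m h using that unfolding B_def by blast
  have Bu: "eval_at u h \<in> B" for h
    by (rule BI[of _ 0 h]) (use eval_at_mem uv idlD(2)[OF P(1)] in auto)
  have subB: "type_subring B"
  proof
    show "1 \<in> B" using Bu[of 1] by (simp add: eval_at_1)
    fix x y assume x: "x \<in> B"
    then obtain m h where mh: "x \<in> T" "C ^ m * x - eval_at u h \<in> P" unfolding B_def by blast
    have "- (C ^ m * x - eval_at u h) \<in> P" by (rule idl_uminus[OF P(1) mh(2)])
    moreover have "- (C ^ m * x - eval_at u h) = C ^ m * (- x) - eval_at u (- h)"
      unfolding eval_at_uminus by simp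
    ultimately show "- x \<in> B" using BI[of "- x" m] uminus_mem mh(1) by metis
    assume y: "y \<in> B"
    then obtain l k where lk: "y \<in> T" "C ^ l * y - eval_at u k \<in> P" unfolding B_def by blast
    have "C ^ l * (C ^ m * x - eval_at u h) + C ^ m * (C ^ l * y - eval_at u k) \<in> P"
      by (intro idlD(3,4)[OF P(1)] power_mem CT mh lk)
    moreover have "C ^ l * (C ^ m * x - eval_at u h) + C ^ m * (C ^ l * y - eval_at u k)
        = C ^ (m + l) * (x + y) - eval_at u (g K ^ l * h + g K ^ m * k)"
      unfolding eval_at_add eval_at_mult eval_at_power C_def[symmetric] by (simp add: algebra_simps power_add)
    ultimately show "x + y \<in> B" using BI[of "x + y" "m + l"] add_mem mh(1) lk(1) by metis
    have "C ^ l * y * (C ^ m * x - eval_at u h) + eval_at u h * (C ^ l * y - eval_at u k) \<in> P"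
      by (intro idlD(3,4)[OF P(1)] mult_mem eval_at_mem power_mem CT uv mh lk)
    moreover have "C ^ l * y * (C ^ m * x - eval_at u h) + eval_at u h * (C ^ l * y - eval_at u k)
        = C ^ (m + l) * (x * y) - eval_at u (h * k)"
      unfolding eval_at_mult by (simp add: algebra_simps power_add)
    ultimately show "x * y \<in> B" using BI[of "x * y" "m + l"] mult_mem mh(1) lk(1) by metis
  qed
  interpret B: type_subring B by (rule subB)
  have BT: "B \<subseteq> T" unfolding B_def by blast
  have "- (1 - C * C') = C ^ 1 * C' - eval_at u 1" by (simp add: eval_at_1)
  then have C'B: "C' \<in> B" using BI[OF C'(1), of 1 1] idl_uminus[OF P(1) C'(2)] by simp
  define fs where "fs = concat (map (\<lambda>j. map (\<lambda>e. v ^ j * e) es) [0..<K])"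
  have fsT: "set fs \<subseteq> T" unfolding fs_def using es uv by (auto intro: mult_mem power_mem)
  let ?L = "lin_span B P fs"
  note L = lin_span_incl[OF P(1) subB BT] lin_span_gen[OF P(1) subB BT] lin_span_add[OF P(1) subB BT]
    lin_span_mult[OF P(1) subB BT] lin_span_sum[OF P(1) subB BT]
  have v_powers: "v ^ j * e \<in> ?L" if e: "e \<in> set es" for j e
  proof (induction j rule: less_induct)
    case (less j)
    show ?case
    proof (cases "j < K")
      case True
      then have "v ^ j * e \<in> set fs" unfolding fs_def using e by auto
      then show ?thesis by (rule L(2))
    next
      case False
      define i where "i = j - K"
      have j: "j = i + K" unfolding i_def using False by simp
      have eT: "e \<in> T" using e es by blast
      define G where "G = (\<Sum>k<K. eval_at u (g k) * v ^ k) + C * v ^ K"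
      have decomp: "v ^ j * e = ((1 - C * C') * (v ^ j * e) + C' * (v ^ i * e) * G)
          + (\<Sum>k<K. - (C' * eval_at u (g k)) * (v ^ (i + k) * e))"
      proof -
        have "(\<Sum>k<K. - (C' * eval_at u (g k)) * (v ^ (i + k) * e))
            = - (C' * (v ^ i * e) * (\<Sum>k<K. eval_at u (g k) * v ^ k))"
          unfolding sum_distrib_left by (simp add: power_add ac_simps sum_negf)
        then show ?thesis unfolding G_def j by (simp add: algebra_simps power_add)
      qed
      have "v ^ j * e \<in> T" "C' * (v ^ i * e) \<in> T" by (intro mult_mem power_mem uv eT C'(1))+
      then have inP: "(1 - C * C') * (v ^ j * e) + C' * (v ^ i * e) * G \<in> P"
        using G C'(2) idlD(3,4,5)[OF P(1)] unfolding G_def by blast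
      have inL: "(\<Sum>k<K. - (C' * eval_at u (g k)) * (v ^ (i + k) * e)) \<in> ?L"
      proof (rule L(5))
        fix k assume "k \<in> {..<K}"
        then have "v ^ (i + k) * e \<in> ?L" by (intro less.IH) (simp add: j)
        moreover have "- (C' * eval_at u (g k)) \<in> B" by (intro B.uminus_mem B.mult_mem C'B Bu)
        ultimately show "- (C' * eval_at u (g k)) * (v ^ (i + k) * e) \<in> ?L" by (rule L(4)[rotated])
      qed
      show ?thesis
        using L(3)[OF subsetD[OF L(1) inP] inL] by (simp only: decomp[symmetric])
    qed
  qed
  have "T \<subseteq> ?L"
  proof (rule span)
    show "0 \<in> ?L" using L(1) idlD(2)[OF P(1)] by blast
    fix c i j e assume "e \<in> set es"
    then have "eval_at u (monom c i) * (v ^ j * e) \<in> ?L" by (rule L(4)[OF Bu v_powers])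
    then show "cst c * u ^ i * (v ^ j * e) \<in> ?L" unfolding eval_at_monom .
  qed (rule L(3))
  define q where "q = 1 + pCons 0 (g K)"
  have "coeff q 0 = 1" unfolding q_def by simp
  then have "q \<noteq> 0" by auto
  then obtain w where w: "w \<in> T" "1 - eval_at u q * w \<in> P"
    using P(3)[OF eval_at_mem[OF uv(1)]] inj by blast
  obtain b where b: "b \<in> B" "1 + eval_at u q * b \<in> P"
    using inverse_in_base[OF P(1) subB BT fsT \<open>T \<subseteq> ?L\<close> Bu w] by blast
  then obtain m h where mh: "b \<in> T" "C ^ m * b - eval_at u h \<in> P" unfolding B_def by blast
  have "C ^ m * (1 + eval_at u q * b) - eval_at u q * (C ^ m * b - eval_at u h) \<in> P"
    by (intro idl_diff[OF P(1)] idlD(4)[OF P(1)] power_mem CT eval_at_mem uv b mh)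
  also have "C ^ m * (1 + eval_at u q * b) - eval_at u q * (C ^ m * b - eval_at u h) = eval_at u (g K ^ m + q * h)"
    unfolding eval_at_add eval_at_mult eval_at_power C_def[symmetric] by (simp add: algebra_simps)
  finally have "g K ^ m + q * h = 0" by (rule inj)
  then have "g K ^ m = q * (- h)" by (simp add: eq_neg_iff_add_eq_0)
  then have dvd: "q dvd g K ^ m" by (rule dvdI)
  have "q dvd y" if "q dvd g K ^ l * y" for l y
    using that
  proof (induction l)
    case (Suc l)
    have "g K ^ l * y = q * (g K ^ l * y) - [:0, 1:] * (g K ^ Suc l * y)"
      unfolding q_def by (simp add: algebra_simps)
    then have "q dvd g K ^ l * y" using Suc.prems by (metis dvd_diff dvd_mult dvd_triv_left)
    then show ?case by (rule Suc.IH)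
  qed simp
  then have "q dvd 1" using dvd by (metis mult.right_neutral)
  then have "degree q = 0" using is_unit_iff_degree[OF \<open>q \<noteq> 0\<close>] by simp
  moreover have "degree q = Suc (degree (g K))"
    unfolding q_def using K(2) by (subst degree_add_eq_right) simp_all
  ultimately show False by simp
qed

end

section \<open>Regularity of polynomials in one monomial\<close>

lemma eval_at_as_sum: "eval_at u f = (\<Sum>i\<le>degree f. cst (coeff f i) * u ^ i)"
proof -
  have "eval_at u f = eval_at u (\<Sum>i\<le>degree f. monom (coeff f i) i)" by (simp add: poly_as_sum_of_monoms)
  then show ?thesis unfolding eval_at_sum eval_at_monom .
qed

lemma coeff2_cst_st_mono_mult:
  "coeff2 (cst c * st_mono x y * w) i j = (if x \<le> i \<and> y \<le> j then c * coeff2 w (i - x) (j - y) else 0)"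
  by (auto simp: st_mono_eq_monom smult_monom coeff_monom_mult)

lemma supported_sum: "(\<And>i. i \<in> I \<Longrightarrow> f i \<in> supported E) \<Longrightarrow> sum f I \<in> supported E"
  by (induction I rule: infinite_finite_induct) (simp_all add: supported_0 supported_add)

lemma eval_at_monomial_supported:
  "eval_at (st_mono p q) f \<in> supported {(p * i, q * i) | i. True}"
  unfolding eval_at_as_sum st_mono_power
  by (rule supported_sum, rule cst_st_mono_in_supported) blast

text \<open>
  Follow the ray of exponents \<open>(i + pm, j + qm)\<close> to the last one occurring in \<open>w\<close>; multiplied by the leading
  term of \<open>f\<close> it cannot cancel.
\<close>

lemma eval_at_monomial_mult_coeff:
  assumes pq: "p + q > 0" and f: "f \<noteq> 0" and w: "coeff2 w i j \<noteq> 0"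
  shows "\<exists>m. coeff2 (eval_at (st_mono p q) f * w) (i + p * m) (j + q * m) \<noteq> 0"
proof -
  define S where "S = {m. coeff2 w (i + p * m) (j + q * m) \<noteq> 0}"
  obtain d where d: "w \<in> supported ({..d} \<times> {..d})" using supported_box_exists by blast
  have "m \<le> d" if "m \<in> S" for m
  proof -
    have "i + p * m \<le> d" "j + q * m \<le> d" using supportedD[OF d] that unfolding S_def by auto
    moreover have "m \<le> p * m \<or> m \<le> q * m" using pq by (cases p; cases q) auto
    ultimately show ?thesis by linarith
  qed
  then have fin: "finite S" by (meson finite_nat_set_iff_bounded_le)
  have "0 \<in> S" using w unfolding S_def by simp
  define m where "m = Max S"
  have mS: "m \<in> S" unfolding m_def using fin \<open>0 \<in> S\<close> Max_in by blast
  have above: "coeff2 w (i + p * l) (j + q * l) = 0" if "m < l" for l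
    using Max_ge[OF fin, of l] that unfolding m_def S_def by fastforce
  define e where "e = degree f"
  have "coeff2 (eval_at (st_mono p q) f * w) (i + p * (m + e)) (j + q * (m + e))
      = (\<Sum>k\<le>e. coeff2 (cst (coeff f k) * st_mono (p * k) (q * k) * w) (i + p * (m + e)) (j + q * (m + e)))"
    unfolding eval_at_as_sum e_def st_mono_power sum_distrib_right coeff_sum ..
  also have "\<dots> = (\<Sum>k\<in>{e}. coeff2 (cst (coeff f k) * st_mono (p * k) (q * k) * w) (i + p * (m + e)) (j + q * (m + e)))"
  proof (rule sum.mono_neutral_right)
    show "\<forall>k\<in>{..e} - {e}. coeff2 (cst (coeff f k) * st_mono (p * k) (q * k) * w) (i + p * (m + e)) (j + q * (m + e)) = 0"
    proof
      fix k assume "k \<in> {..e} - {e}"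
      then have k: "k < e" by simp
      have s: "z + x * (m + e) - x * k = z + x * (m + e - k)" for x z :: nat
        using k by (simp add: diff_mult_distrib2)
      have "coeff2 w (i + p * (m + e) - p * k) (j + q * (m + e) - q * k) = 0"
        unfolding s by (rule above) (use k in simp)
      then show "coeff2 (cst (coeff f k) * st_mono (p * k) (q * k) * w) (i + p * (m + e)) (j + q * (m + e)) = 0"
        unfolding coeff2_cst_st_mono_mult by simp
    qed
  qed auto
  also have "\<dots> = coeff f e * coeff2 w (i + p * m) (j + q * m)"
    unfolding coeff2_cst_st_mono_mult by (simp add: algebra_simps)
  also have "\<dots> \<noteq> 0" using mS f unfolding S_def e_def by simp
  finally show ?thesis by blast
qed

lemma eval_at_monomial_nonzero:
  assumes "p + q > 0" "f \<noteq> 0" shows "eval_at (st_mono p q) f \<noteq> 0"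
proof
  assume "eval_at (st_mono p q) f = 0"
  moreover have "coeff2 1 0 0 \<noteq> 0" by simp
  ultimately show False using eval_at_monomial_mult_coeff[OF assms, of 1 0 0] by simp
qed

text \<open>
  A substitute for coprimality in \<open>K[t][s]\<close>: consider the highest coefficient of \<open>z\<close> that is not
  divisible by \<open>\<eta>\<close>. Up to a unit it survives modulo \<open>\<eta>\<close> in the product.
\<close>

lemma const_dvd_cancel_unit_leading:
  fixes F z :: "'k::field poly poly"
  assumes c: "lead_coeff F = [:c:]" "c \<noteq> 0" and dvd: "[:\<eta>:] dvd F * z"
  shows "[:\<eta>:] dvd z"
proof (rule ccontr)
  assume "\<not> ?thesis"
  define S where "S = {n. \<not> \<eta> dvd coeff z n}"
  have "n \<le> degree z" if "n \<in> S" for n using that unfolding S_def by (auto intro: le_degree)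
  then have fin: "finite S" by (meson finite_nat_set_iff_bounded_le)
  have ne: "S \<noteq> {}" using \<open>\<not> [:\<eta>:] dvd z\<close> unfolding S_def const_poly_dvd_iff by blast
  define n where "n = Max S"
  have n: "n \<in> S" unfolding n_def using fin ne Max_in by blast
  have above: "\<eta> dvd coeff z l" if "n < l" for l
    using Max_ge[OF fin, of l] that unfolding n_def S_def by fastforce
  define D where "D = degree F"
  let ?t = "\<lambda>k. coeff F k * coeff z (D + n - k)"
  have "\<eta> dvd (\<Sum>k\<in>{..D + n} - {D}. ?t k)"
  proof (rule dvd_sum)
    fix k assume k: "k \<in> {..D + n} - {D}"
    show "\<eta> dvd ?t k"
    proof (cases "k < D")
      case True
      then show ?thesis using above[of "D + n - k"] by simp
    next
      case False
      then show ?thesis using k by (simp add: D_def coeff_eq_0)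
    qed
  qed
  moreover have "\<eta> dvd (\<Sum>k\<le>D + n. ?t k)"
    using dvd unfolding const_poly_dvd_iff coeff_mult by blast
  moreover have "(\<Sum>k\<le>D + n. ?t k) = ?t D + (\<Sum>k\<in>{..D + n} - {D}. ?t k)"
    by (rule sum.remove) auto
  ultimately have "\<eta> dvd ?t D" by (simp add: dvd_add_left_iff)
  then have "\<eta> dvd coeff z n" using c by (simp add: D_def dvd_smult_iff)
  then show False using n unfolding S_def by simp
qed

section \<open>Monomial algebras are Noetherian\<close>

text \<open>
  Dickson's lemma in two variables. Relative to a fixed element, a point that does not dominate it
  lies in one of finitely many columns or rows, each of which has a least element in \<open>L\<close>.
\<close>

lemma finite_basis_product_order:
  fixes L :: "(nat \<times> nat) set"
  shows "\<exists>F\<subseteq>L. finite F \<and> (\<forall>(x, y)\<in>L. \<exists>(x', y')\<in>F. x' \<le> x \<and> y' \<le> y)"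
proof (cases "L = {}")
  case False
  then obtain x0 y0 where 0: "(x0, y0) \<in> L" by auto
  define F1 where "F1 = (\<lambda>x. (x, LEAST y. (x, y) \<in> L)) ` {x. x < x0 \<and> (\<exists>y. (x, y) \<in> L)}"
  define F2 where "F2 = (\<lambda>y. (LEAST x. (x, y) \<in> L, y)) ` {y. y < y0 \<and> (\<exists>x. (x, y) \<in> L)}"
  have F1L: "F1 \<subseteq> L"
  proof
    fix z assume "z \<in> F1"
    then obtain x y where "z = (x, LEAST y. (x, y) \<in> L)" "(x, y) \<in> L" unfolding F1_def by blast
    then show "z \<in> L" using LeastI[of "\<lambda>y. (x, y) \<in> L" y] by simp
  qed
  have F2L: "F2 \<subseteq> L"
  proof
    fix z assume "z \<in> F2"
    then obtain x y where "z = (LEAST x. (x, y) \<in> L, y)" "(x, y) \<in> L" unfolding F2_def by blast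
    then show "z \<in> L" using LeastI[of "\<lambda>x. (x, y) \<in> L" x] by simp
  qed
  have "\<exists>(x', y')\<in>insert (x0, y0) (F1 \<union> F2). x' \<le> x \<and> y' \<le> y" if xy: "(x, y) \<in> L" for x y
  proof -
    consider "x < x0" | "y < y0" | "x0 \<le> x" "y0 \<le> y" by linarith
    then show ?thesis
    proof cases
      case 1
      then have "(x, LEAST y. (x, y) \<in> L) \<in> F1" unfolding F1_def using xy by blast
      moreover have "(LEAST y. (x, y) \<in> L) \<le> y" using xy by (rule Least_le)
      ultimately show ?thesis by blast
    next
      case 2
      then have "(LEAST x. (x, y) \<in> L, y) \<in> F2" unfolding F2_def using xy by blast
      moreover have "(LEAST x. (x, y) \<in> L) \<le> x" using xy by (rule Least_le)
      ultimately show ?thesis by blast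
    next
      case 3 then show ?thesis by blast
    qed
  qed
  moreover have "insert (x0, y0) (F1 \<union> F2) \<subseteq> L" using 0 F1L F2L by blast
  moreover have "finite (insert (x0, y0) (F1 \<union> F2))" unfolding F1_def F2_def by simp
  ultimately show ?thesis by (intro exI[of _ "insert (x0, y0) (F1 \<union> F2)"]) auto
qed simp

lemma finite_basis_modulo:
  fixes L :: "(nat \<times> nat) set"
  assumes "a > 0"
  shows "\<exists>F\<subseteq>L. finite F \<and> (\<forall>(x, y)\<in>L. \<exists>(x', y')\<in>F. \<exists>k l. x = x' + a * k \<and> y = y' + a * l)"
proof -
  define C where "C = (\<lambda>(\<rho>, \<sigma>). {(x, y) \<in> L. x mod a = \<rho> \<and> y mod a = \<sigma>})"
  have "\<forall>c. \<exists>F. F \<subseteq> C c \<and> finite F \<and> (\<forall>(x, y)\<in>C c. \<exists>(x', y')\<in>F. x' \<le> x \<and> y' \<le> y)"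
    by (rule allI, rule finite_basis_product_order)
  from choice[OF this] obtain F where
    F0: "\<forall>c. F c \<subseteq> C c \<and> finite (F c) \<and> (\<forall>(x, y)\<in>C c. \<exists>(x', y')\<in>F c. x' \<le> x \<and> y' \<le> y)"
    by (rule exE)
  have F: "F c \<subseteq> C c" "finite (F c)" for c
    using F0[THEN spec, of c] by simp_all
  have Fle: "\<exists>(x', y')\<in>F c. x' \<le> x \<and> y' \<le> y" if "(x, y) \<in> C c" for c x y
    using bspec[OF conjunct2[OF conjunct2[OF F0[THEN spec, of c]]] that] by simp
  let ?F = "\<Union>c\<in>{..<a} \<times> {..<a}. F c"
  have "\<exists>(x', y')\<in>?F. \<exists>k l. x = x' + a * k \<and> y = y' + a * l" if "(x, y) \<in> L" for x y
  proof -
    let ?c = "(x mod a, y mod a)"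
    have "(x, y) \<in> C ?c" unfolding C_def using that by simp
    then obtain x' y' where xy': "(x', y') \<in> F ?c" "x' \<le> x" "y' \<le> y" using Fle[of x y ?c] by blast
    then have "x' mod a = x mod a" "y' mod a = y mod a" using F(1)[of ?c] unfolding C_def by auto
    then have "a dvd x - x'" "a dvd y - y'" using xy' by (metis mod_eq_dvd_iff_nat)+
    then obtain k l where "x - x' = a * k" "y - y' = a * l" by (auto elim!: dvdE)
    then have "x = x' + a * k" "y = y' + a * l" using xy' by auto
    moreover have "(x', y') \<in> ?F" using xy'(1) assms by (intro UN_I[of ?c]) auto
    ultimately show ?thesis by blast
  qed
  moreover have "?F \<subseteq> L" using F(1) unfolding C_def by fastforce
  ultimately show ?thesis using F(2) by (intro exI[of _ ?F]) auto
qed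

text \<open>
  The exponents of the leading monomial for the lexicographic order with \<open>s\<close> above \<open>t\<close>.
\<close>

definition leading_exps :: "'k::field poly poly \<Rightarrow> nat \<times> nat" where
  "leading_exps h = (degree h, degree (lead_coeff h))"

lemma leading_exps_mono_mult:
  assumes "g \<noteq> 0" "c \<noteq> 0" and q_def: "q = cst c * st_mono x y * g"
  shows "degree q = x + degree g" "degree (lead_coeff q) = y + degree (lead_coeff g)"
    "lead_coeff (lead_coeff q) = c * lead_coeff (lead_coeff g)" "q \<noteq> 0"
proof -
  have q: "q = monom (monom c y) x * g" unfolding q_def by (simp add: st_mono_eq_monom smult_monom)
  have nz: "monom (monom c y) x \<noteq> 0" "monom c y \<noteq> 0" using assms(2) by (auto simp: monom_eq_0_iff)
  show "degree q = x + degree g" unfolding q using nz assms(1) by (simp add: degree_mult_eq degree_monom_eq)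
  have l: "lead_coeff q = monom c y * lead_coeff g"
    unfolding q lead_coeff_mult using nz by (simp add: degree_monom_eq)
  show "degree (lead_coeff q) = y + degree (lead_coeff g)"
    unfolding l using nz assms(1) by (simp add: degree_mult_eq degree_monom_eq)
  show "lead_coeff (lead_coeff q) = c * lead_coeff (lead_coeff g)"
    unfolding l lead_coeff_mult using assms(2) by (simp add: degree_monom_eq)
  show "q \<noteq> 0" unfolding q using nz assms(1) by simp
qed

lemma leading_exps_diff:
  assumes "degree h = degree q" "degree (lead_coeff h) = degree (lead_coeff q)"
    "lead_coeff (lead_coeff h) = lead_coeff (lead_coeff q)" "h - q \<noteq> 0"
  shows "(leading_exps (h - q), leading_exps h) \<in> less_than <*lex*> less_than"
proof -
  have le: "degree (h - q) \<le> degree h" by (rule degree_diff_le) (use assms in auto)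
  show ?thesis
  proof (cases "degree (h - q) = degree h")
    case True
    let ?p = "lead_coeff (h - q)"
    have p: "?p = lead_coeff h - lead_coeff q" using True assms(1) by simp
    have pnz: "?p \<noteq> 0" unfolding leading_coeff_0_iff by (rule assms(4))
    have "degree ?p \<le> degree (lead_coeff h)" unfolding p by (rule degree_diff_le) (use assms in auto)
    moreover have "coeff ?p (degree (lead_coeff h)) = 0" unfolding p using assms by simp
    ultimately have "degree ?p < degree (lead_coeff h)" using pnz by (metis le_neq_implies_less leading_coeff_0_iff)
    then show ?thesis unfolding leading_exps_def using True by simp
  qed (use le in \<open>auto simp: leading_exps_def\<close>)
qed

text \<open>
  The leading exponents of an ideal are finitely generated under translation by \<open>(a, 0)\<close> and
  \<open>(0, a)\<close>, by Dickson's lemma in each of the finitely many residue classes modulo \<open>a\<close>. Elements of the ideal with the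
  corresponding leading exponents generate it, by division with well-founded lexicographic descent.
\<close>

lemma (in exponent_monoid) noetherian_supported:
  assumes a: "a > 0" "(a, 0) \<in> E" "(0, a) \<in> E"
  shows "noetherian_ring (ring_on (supported E :: 'k::field poly poly set))"
proof -
  interpret R: cring "ring_on (supported E :: 'k poly poly set)" by (rule cring_on)
  have ma: "(a * k, a * l) \<in> E" for k l
  proof -
    have "(a * k, 0) \<in> E" by (induction k) (use zero_exp add_exp[OF a(2)] in auto)
    moreover have "(0, a * l) \<in> E" by (induction l) (use zero_exp add_exp[OF a(3)] in auto)
    ultimately show ?thesis using add_exp by fastforce
  qed
  show ?thesis
  proof (rule R.noetherian_ringI)
    fix J assume "ideal J (ring_on (supported E :: 'k poly poly set))"
    then have J: "idl J" unfolding ideal_on_iff .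
    define L where "L = leading_exps ` (J - {0})"
    obtain F where F: "F \<subseteq> L" "finite F"
      and basis: "\<forall>(x, y)\<in>L. \<exists>(x', y')\<in>F. \<exists>k l. x = x' + a * k \<and> y = y' + a * l"
      using finite_basis_modulo[OF a(1), of L] by (elim exE conjE)
    have "\<forall>f\<in>F. \<exists>g. g \<in> J - {0} \<and> leading_exps g = f" using F(1) unfolding L_def by blast
    then obtain g where g: "\<And>f. f \<in> F \<Longrightarrow> g f \<in> J - {0} \<and> leading_exps (g f) = f" by metis
    have gJ: "g ` F \<subseteq> J" using g by blast
    have JT: "J \<subseteq> supported E" using idlD(1)[OF J] by blast
    have I: "idl (Idl\<^bsub>ring_on (supported E)\<^esub> (g ` F))" by (rule idl_genideal) (use gJ JT in blast)
    have "h \<in> Idl\<^bsub>ring_on (supported E)\<^esub> (g ` F)" if "h \<in> J" for h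
      using that
    proof (induction "leading_exps h" arbitrary: h rule: wf_induct_rule[OF wf_lex_prod[OF wf_less_than wf_less_than]])
      case (1 h)
      show ?case
      proof (cases "h = 0")
        case True then show ?thesis using idlD(2)[OF I] by simp
      next
        case False
        then have "leading_exps h \<in> L" unfolding L_def using 1(2) by blast
        from bspec[OF basis this]
        obtain x' y' k l where f: "(x', y') \<in> F" "leading_exps h = (x' + a * k, y' + a * l)"
          by (cases "leading_exps h") auto
        define G where "G = g (x', y')"
        have G: "G \<in> J" "G \<noteq> 0" "leading_exps G = (x', y')" using g[OF f(1)] unfolding G_def by auto
        define c where "c = lead_coeff (lead_coeff h) / lead_coeff (lead_coeff G)"
        have c: "c \<noteq> 0" unfolding c_def using False G(2) by simp
        define q where "q = cst c * st_mono (a * k) (a * l) * G"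
        note q = leading_exps_mono_mult[OF G(2) c q_def]
        have m: "cst c * st_mono (a * k) (a * l) \<in> supported E" by (rule cst_st_mono_in_supported[OF ma])
        have qI: "q \<in> Idl\<^bsub>ring_on (supported E)\<^esub> (g ` F)"
          unfolding q_def by (rule idlD(4)[OF I m genideal_incl]) (use f(1) in \<open>simp add: G_def\<close>)
        have qJ: "q \<in> J" unfolding q_def by (rule idlD(4)[OF J m G(1)])
        have "h - q \<in> Idl\<^bsub>ring_on (supported E)\<^esub> (g ` F)"
        proof (cases "h - q = 0")
          case True then show ?thesis using idlD(2)[OF I] by simp
        next
          case nz: False
          have "(leading_exps (h - q), leading_exps h) \<in> less_than <*lex*> less_than"
          proof (rule leading_exps_diff[OF _ _ _ nz])
            show "degree h = degree q" "degree (lead_coeff h) = degree (lead_coeff q)"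
              using f(2) G(3) q(1,2) unfolding leading_exps_def by auto
            show "lead_coeff (lead_coeff h) = lead_coeff (lead_coeff q)"
              unfolding q(3) c_def using G(2) by simp
          qed
          then show ?thesis using 1(1) idl_diff[OF J 1(2) qJ] by blast
        qed
        from idlD(3)[OF I this qI] show ?thesis by simp
      qed
    qed
    then have "J = Idl\<^bsub>ring_on (supported E)\<^esub> (g ` F)" using genideal_least[OF J gJ] by blast
    then show "\<exists>A\<subseteq>carrier (ring_on (supported E)). finite A \<and> J = Idl\<^bsub>ring_on (supported E)\<^esub> A"
      using F(2) gJ JT by (intro exI[of _ "g ` F"]) auto
  qed
qed

section \<open>The exponents of the curve\<close>

locale monomial_curve =
  fixes n r :: nat
  assumes n_pos: "n \<ge> 1" and r_ge: "r \<ge> 5"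
begin

definition a :: nat where "a = 2 * r + 2 * n - 1"

text \<open>
  The numerical semigroup \<open>\<langle>2, 2n + 1\<rangle>\<close>, which contains every number from \<open>2n\<close> onwards. It is generated by the
  \<open>s\<close>-exponents of the generators, of which \<open>a - a\<^sub>i = 2(n - i)\<close> and \<open>a - (2r - 2) = 2n + 1\<close>.
\<close>

definition left_exp :: "nat \<Rightarrow> bool" where
  "left_exp x \<longleftrightarrow> even x \<or> 2 * n \<le> x"

text \<open>
  The numbers \<open>z\<close> that are sums of \<open>p\<close> of the exponents \<open>2r - 2, a\<^sub>0, \<dots>, a\<^sub>n\<close>; see \<open>block_in_exp_span\<close>. The description by
  an interval and the semigroup \<open>left_exp\<close> makes membership a matter of inequalities and parity.
\<close>

definition block :: "nat \<Rightarrow> nat \<Rightarrow> bool" where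
  "block p z \<longleftrightarrow> p * (2 * r - 2) \<le> z \<and> z \<le> p * a \<and> left_exp (p * a - z)"

text \<open>
  The numerical semigroup generated by the \<open>t\<close>-exponents of the generators.
\<close>

definition right_exp :: "nat \<Rightarrow> bool" where
  "right_exp y \<longleftrightarrow> (\<exists>c p z. y = c * r + z \<and> block p z)"

text \<open>
  At degree \<open>k\<close>, at most \<open>k\<close> generators different from \<open>s\<^sup>a\<close> may be used, \<open>c\<close> of them being the one with \<open>t\<^sup>r\<close>.
\<close>

definition curve_exps :: "(nat \<times> nat) set" where
  "curve_exps = {(x, y). \<exists>k c p z. x + y = k * a \<and> c + p \<le> k \<and> y = c * r + z \<and> block p z}"

definition cm_exps :: "(nat \<times> nat) set" where
  "cm_exps = {(x, y). a dvd x + y \<and> left_exp x \<and> right_exp y}"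

definition gens :: "(nat \<times> nat) set" where
  "gens = {(a, 0), (a - r, r), (a - (2 * r - 2), 2 * r - 2), (0, a)} \<union>
     {(a - (2 * r + 2 * i - 1), 2 * r + 2 * i - 1) | i. i < n}"

lemma a_plus: "a + 1 = 2 * r + 2 * n"
  using r_ge unfolding a_def by simp

lemma odd_a: "odd a"
proof -
  have "even (a + 1)" unfolding a_plus by simp
  then show ?thesis by simp
qed

lemma a_pos: "a > 0" using a_plus n_pos by simp
lemma a_gt_r: "a > r" using a_plus n_pos r_ge by linarith

lemma left_exp_add: "left_exp x \<Longrightarrow> left_exp y \<Longrightarrow> left_exp (x + y)"
  unfolding left_exp_def by auto

lemma left_exp_0: "left_exp 0" unfolding left_exp_def by simp

lemma left_exp_large: "2 * n \<le> x \<Longrightarrow> left_exp x" unfolding left_exp_def by simp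

lemma left_exp_mult: "left_exp x \<Longrightarrow> left_exp (k * x)"
  by (induction k) (auto intro: left_exp_0 left_exp_add)

lemma left_exp_mult_a: "left_exp (k * a)"
  by (intro left_exp_mult left_exp_large) (use a_plus r_ge in linarith)

lemma block_0: "block 0 0" unfolding block_def by (simp add: left_exp_0)

lemma block_add: assumes "block p z" "block p' z'" shows "block (p + p') (z + z')"
proof -
  have e: "(p + p') * a - (z + z') = (p * a - z) + (p' * a - z')"
    using assms unfolding block_def by (simp add: add_mult_distrib)
  have "left_exp ((p * a - z) + (p' * a - z'))" using assms left_exp_add unfolding block_def by blast
  then show ?thesis using assms unfolding block_def e by (simp add: add_mult_distrib add_mono)
qed

lemma block_a: "block f (f * a)"
proof -
  have "2 * r - 2 \<le> a" using a_plus by simp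
  then show ?thesis unfolding block_def by (simp add: left_exp_0)
qed

lemma right_exp_add: assumes "right_exp y" "right_exp y'" shows "right_exp (y + y')"
proof -
  from assms obtain c p z c' p' z' where
    "y = c * r + z" "block p z" "y' = c' * r + z'" "block p' z'" unfolding right_exp_def by blast
  then have "y + y' = (c + c') * r + (z + z')" "block (p + p') (z + z')"
    using block_add by (auto simp: add_mult_distrib)
  then show ?thesis unfolding right_exp_def by blast
qed

text \<open>
  The quotient \<open>p\<close> of \<open>y\<close> by \<open>2r - 2\<close> is so large that the remainder is far below the length \<open>p(2n + 1)\<close> of the interval
  in the definition of \<open>block p\<close>; so \<open>y\<close> lies in that block.
\<close>

lemma right_exp_large: assumes "(2 * r) * (2 * r) \<le> y" shows "right_exp y"
proof -
  define p u where "p = y div (2 * r - 2)" and "u = y mod (2 * r - 2)"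
  have y: "y = p * (2 * r - 2) + u" unfolding p_def u_def by (rule div_mult_mod_eq[symmetric])
  have u: "u < 2 * r - 2" unfolding u_def using r_ge by simp
  have "(2 * r) * (2 * r - 2) \<le> y"
    by (rule le_trans[OF _ assms]) simp
  then have p: "p \<ge> 2 * r"
    unfolding p_def using u by (subst less_eq_div_iff_mult_less_eq) auto
  have a: "a = (2 * r - 2) + (2 * n + 1)" using a_plus r_ge by simp
  have "p * a = p * (2 * r - 2) + p * (2 * n + 1)" unfolding a by (rule add_mult_distrib2)
  moreover have "p * (2 * n + 1) \<ge> u + 2 * n"
  proof -
    have "p * (2 * n + 1) = p * (2 * n) + p" by simp
    moreover have "p * (2 * n) \<ge> 2 * n" using p r_ge by simp
    ultimately show ?thesis using u p by linarith
  qed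
  ultimately have "block p y" unfolding block_def y left_exp_def by auto
  then show ?thesis unfolding right_exp_def by (intro exI[of _ 0] exI[of _ p] exI[of _ y]) simp
qed

lemma curve_expsI:
  "x + y = k * a \<Longrightarrow> c + p \<le> k \<Longrightarrow> y = c * r + z \<Longrightarrow> block p z \<Longrightarrow> (x, y) \<in> curve_exps"
  unfolding curve_exps_def by blast

lemma curve_exps_add:
  assumes "(x, y) \<in> curve_exps" "(x', y') \<in> curve_exps" shows "(x + x', y + y') \<in> curve_exps"
proof -
  from assms obtain k c p z k' c' p' z' where
    h: "x + y = k * a" "c + p \<le> k" "y = c * r + z" "block p z"
    "x' + y' = k' * a" "c' + p' \<le> k'" "y' = c' * r + z'" "block p' z'"
    unfolding curve_exps_def by auto
  show ?thesis
    by (rule curve_expsI[of _ _ "k + k'" "c + c'" "p + p'" "z + z'"])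
      (use h block_add in \<open>auto simp: add_mult_distrib\<close>)
qed

lemma cm_exps_add:
  assumes "(x, y) \<in> cm_exps" "(x', y') \<in> cm_exps" shows "(x + x', y + y') \<in> cm_exps"
proof -
  have "x + x' + (y + y') = (x + y) + (x' + y')" by simp
  then show ?thesis using assms left_exp_add right_exp_add unfolding cm_exps_def
    by (metis (mono_tags, lifting) case_prod_conv dvd_add mem_Collect_eq)
qed

lemma curve_exps_0: "(0, 0) \<in> curve_exps"
  by (rule curve_expsI[of _ _ 0 0 0 0]) (simp_all add: block_0)

lemma s_exp_in_curve: "(k * a, 0) \<in> curve_exps"
  by (rule curve_expsI[of _ _ k 0 0 0]) (simp_all add: block_0)

lemma t_exp_in_curve: "(0, k * a) \<in> curve_exps"
  by (rule curve_expsI[of _ _ k 0 k "k * a"]) (simp_all add: block_a)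

lemma curve_sub_cm: "curve_exps \<subseteq> cm_exps"
proof
  fix w assume "w \<in> curve_exps"
  then obtain x y k c p z where h: "w = (x, y)" "x + y = k * a" "c + p \<le> k" "y = c * r + z" "block p z"
    unfolding curve_exps_def by blast
  have 1: "a - r \<ge> 2 * n" using a_plus r_ge by linarith
  have l: "left_exp (c * (a - r))" using 1 by (intro left_exp_mult left_exp_large)
  obtain q where q: "k = c + p + q" using h(3) le_Suc_ex by blast
  have "z \<le> p * a" using h(5) unfolding block_def by simp
  moreover have "c * r \<le> c * a" using a_gt_r by simp
  moreover have "c * (a - r) = c * a - c * r" by (rule diff_mult_distrib2)
  moreover have "k * a = c * a + p * a + q * a" unfolding q by (simp add: add_mult_distrib)
  ultimately have "x = c * (a - r) + (p * a - z) + q * a"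
    using h(2) unfolding h(4) by linarith
  moreover have "left_exp (p * a - z)" using h(5) unfolding block_def by simp
  ultimately have "left_exp x" using l left_exp_add left_exp_mult_a by metis
  then show "w \<in> cm_exps" using h unfolding cm_exps_def right_exp_def by auto
qed

text \<open>
  Since \<open>4r\<close>, \<open>2r + (2r - 2)\<close> and \<open>2r + a\<^sub>i\<close> for \<open>i < n\<close> are sums of two of the exponents
  \<open>2r - 2, a\<^sub>0, \<dots>, a\<^sub>n\<close>, at most one summand \<open>r\<close> is needed unless all other summands
  equal \<open>a\<^sub>n\<close>, and never more than three.
\<close>
lemma at_most_one_r_or_all_a:
  "block p z \<Longrightarrow> \<exists>c' p' z'. c * r + z = c' * r + z' \<and> block p' z' \<and> (c' \<le> 1 \<or> c' \<le> 3 \<and> z' = p' * a)"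
proof (induction c arbitrary: p z rule: less_induct)
  case (less c)
  show ?case
  proof (cases "c \<ge> 4")
    case True
    have "4 * r - 4 \<le> 4 * r" "4 * r \<le> 2 * a" "2 * a - 4 * r = 2 * (2 * n - 1)" using a_plus n_pos by linarith+
    then have "block 2 (4 * r)" unfolding block_def left_exp_def by simp
    then have "block (2 + p) (4 * r + z)" using block_add less.prems by blast
    from less.IH[OF _ this, of "c - 4"] True
    obtain c' p' z' where "(c - 4) * r + (4 * r + z) = c' * r + z'" "block p' z'" "c' \<le> 1 \<or> c' \<le> 3 \<and> z' = p' * a"
      by auto
    moreover have "(c - 4) * r + (4 * r + z) = c * r + z"
      using True by (metis ab_semigroup_add_class.add_ac(1) add_mult_distrib le_add_diff_inverse2)
    ultimately show ?thesis by metis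
  next
    case c4: False
    show ?thesis
    proof (cases "c \<le> 1 \<or> z = p * a")
      case True
      have "c \<le> 3" using c4 by simp
      then show ?thesis using True less.prems by blast
    next
      case False
      have zp: "z < p * a" using False less.prems unfolding block_def by simp
      have l: "left_exp (p * a - z)" using less.prems unfolding block_def by simp
      have n2: "2 * n \<le> (p * a - z) + (2 * n - 1)" using zp by linarith
      have e: "(1 + p) * a - (2 * r + z) = (p * a - z) + (2 * n - 1)"
        "2 * r + z \<le> (1 + p) * a" using zp a_plus n_pos by auto
      have "(1 + p) * (2 * r - 2) \<le> 2 * r + z" using less.prems unfolding block_def add_mult_distrib by linarith
      then have "block (1 + p) (2 * r + z)" unfolding block_def using e n2 left_exp_large by simp
      from less.IH[OF _ this, of "c - 2"] False
      obtain c' p' z' where "(c - 2) * r + (2 * r + z) = c' * r + z'" "block p' z'" "c' \<le> 1 \<or> c' \<le> 3 \<and> z' = p' * a"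
        by auto
      moreover have "(c - 2) * r + (2 * r + z) = c * r + z"
        using False by (metis (no_types, lifting) One_nat_def Suc_1 ab_semigroup_add_class.add_ac(1) add_mult_distrib le_add_diff_inverse2 not_less_eq_eq)
      ultimately show ?thesis by metis
    qed
  qed
qed

text \<open>
  Write \<open>x + y = ka\<close> and \<open>y = cr + z\<close> with \<open>c\<close> and \<open>z\<close> as in \<open>at_most_one_r_or_all_a\<close>. If \<open>c + p > k\<close>, then mostly \<open>y\<close> is so large that it lies
  in \<open>block k\<close>, where the required condition on \<open>ka - y = x\<close> holds by assumption. The only
  exception is \<open>c = 3\<close>, \<open>z = pa\<close> and \<open>k = p + 2\<close>.
\<close>

lemma cm_exps_cases:
  assumes "(x, y) \<in> cm_exps"
  shows "(x, y) \<in> curve_exps \<or> (\<exists>f. x + 3 * r = 2 * a \<and> y = 3 * r + f * a)"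
proof -
  from assms obtain k where k: "x + y = k * a" unfolding cm_exps_def dvd_def by (auto simp: mult.commute)
  have lx: "left_exp x" using assms unfolding cm_exps_def by simp
  from assms obtain c0 p0 z0 where "y = c0 * r + z0" "block p0 z0" unfolding cm_exps_def right_exp_def by auto
  with at_most_one_r_or_all_a obtain c p z where y: "y = c * r + z" and b: "block p z" and c: "c \<le> 1 \<or> c \<le> 3 \<and> z = p * a"
    by metis
  have xk: "k * a - y = x" "y \<le> k * a" using k by auto
  have blk: "(x, y) \<in> curve_exps" if "k * (2 * r - 2) \<le> y"
    by (rule curve_expsI[of _ _ k 0 k y]) (use that k lx xk in \<open>auto simp: block_def\<close>)
  show ?thesis
  proof (cases "c + p \<le> k")
    case True then show ?thesis using curve_expsI[OF k True y b] by simp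
  next
    case kp: False
    show ?thesis
    proof (cases "c \<le> 1")
      case True
      then have "k \<le> p" using kp by linarith
      then have "k * (2 * r - 2) \<le> p * (2 * r - 2)" by simp
      also have "\<dots> \<le> y" using b y unfolding block_def by simp
      finally show ?thesis using blk by simp
    next
      case False
      then have c': "2 \<le> c" "c \<le> 3" "z = p * a" using c by auto
      have "p < k"
      proof (rule ccontr)
        assume "\<not> p < k"
        then have "k * a \<le> p * a" by simp
        moreover have "c * r > 0" using c' r_ge by simp
        ultimately show False using k unfolding y c'(3) by linarith
      qed
      then consider "k = p + 1" | "k = p + 2" "c = 3" using kp c' by linarith
      then show ?thesis
      proof cases
        case 1
        have "p * (2 * r - 2) \<le> z" using b unfolding block_def by simp
        moreover have "2 * r - 2 \<le> c * r"
          using mult_le_mono1[OF c'(1), of r] by linarith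
        ultimately have "k * (2 * r - 2) \<le> y" unfolding 1 y by simp
        then show ?thesis using blk by simp
      next
        case 2
        have "x + 3 * r = 2 * a" using k y c' 2 by simp
        then show ?thesis using y c' 2 by auto
      qed
    qed
  qed
qed

lemma three_r_le: "left_exp (2 * a - 3 * r)" "3 * r < 2 * a"
  using a_plus n_pos r_ge by (auto intro!: left_exp_large)

lemma extra_in_cm: "(2 * a - 3 * r, 3 * r + f * a) \<in> cm_exps"
proof -
  have "right_exp (3 * r + f * a)"
    unfolding right_exp_def using block_a by blast
  moreover have "2 * a - 3 * r + (3 * r + f * a) = (2 + f) * a" using three_r_le(2) by (simp add: algebra_simps)
  ultimately show ?thesis unfolding cm_exps_def using three_r_le(1) by simp
qed

text \<open>
  For \<open>f\<close> large the lower bound in the definition of \<open>block (f + 2)\<close> is met, because \<open>a\<close> exceeds \<open>2r - 2\<close>.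
\<close>

lemma extra_eventually_in_curve:
  assumes "f \<ge> r" shows "(2 * a - 3 * r, 3 * r + f * a) \<in> curve_exps"
proof -
  have s: "2 * a - 3 * r + (3 * r + f * a) = (2 + f) * a" using three_r_le(2) by (simp add: algebra_simps)
  have d: "(2 + f) * a - (3 * r + f * a) = 2 * a - 3 * r" by (simp add: algebra_simps)
  have "f * (2 * r - 2) + r \<le> f * a"
  proof -
    have "f * (2 * r - 2) + r \<le> f * (2 * r - 2 + 1)" using assms by (simp add: algebra_simps)
    also have "\<dots> \<le> f * a" using a_plus r_ge by (intro mult_le_mono2) linarith
    finally show ?thesis .
  qed
  then have "(2 + f) * (2 * r - 2) \<le> 3 * r + f * a" by (simp add: algebra_simps)
  then have "block (2 + f) (3 * r + f * a)"
    unfolding block_def d using three_r_le s by simp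
  then show ?thesis by (intro curve_expsI[of _ _ "2 + f" 0 "2 + f"]) (use s in auto)
qed

lemma three_r_in_curve: "(k * a + 3 * a - 3 * r, 3 * r) \<in> curve_exps"
  by (rule curve_expsI[of _ _ "k + 3" 3 0 0]) (use a_gt_r block_0 in \<open>auto simp: algebra_simps\<close>)

text \<open>
  Peel off one generator with \<open>s\<close>-exponent \<open>2n + 1\<close>, \<open>2n\<close> or a smaller even number, depending on the parity
  and the size of the remaining \<open>s\<close>-exponent, in such a way that the lower bound on \<open>z\<close> is kept.
\<close>

lemma block_in_exp_span: "block p z \<Longrightarrow> (p * a - z, z) \<in> exp_span gens"
proof (induction p arbitrary: z)
  case 0
  then show ?case unfolding block_def using exp_span_zero by simp
next
  case (Suc p)
  define x where "x = Suc p * a - z"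
  have z: "Suc p * (2 * r - 2) \<le> z" "z \<le> Suc p * a" "left_exp x" using Suc.prems unfolding block_def x_def by auto
  have xz: "x + z = p * a + a" using z unfolding x_def by simp
  have a: "a = (2 * r - 2) + (2 * n + 1)" using a_plus r_ge by simp
  have step: ?case if g: "(x1, z1) \<in> gens" and s: "x1 + z1 = a" and le: "x1 \<le> x" "z1 + p * (2 * r - 2) \<le> z"
    and l: "left_exp (x - x1)" for x1 z1
  proof -
    have e: "p * a - (z - z1) = x - x1" using xz s le by linarith
    have "z - z1 \<le> p * a" using xz s le by linarith
    then have "block p (z - z1)" unfolding block_def e using le l by auto
    from Suc.IH[OF this] have "(x - x1, z - z1) \<in> exp_span gens" unfolding e .
    from exp_span_add[OF g this] have "(x1 + (x - x1), z1 + (z - z1)) \<in> exp_span gens" .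
    then show ?thesis using le unfolding x_def[symmetric] by simp
  qed
  have g1: "(2 * n + 1, 2 * r - 2) \<in> gens" unfolding gens_def a by auto
  have g2: "(2 * i, a - 2 * i) \<in> gens" if "i \<le> n" for i
  proof (cases "i = 0")
    case False
    have e: "2 * r + 2 * (n - i) - 1 = a - 2 * i" "n - i < n" using that False a_plus r_ge by auto
    have "(a - (2 * r + 2 * (n - i) - 1), 2 * r + 2 * (n - i) - 1) \<in> gens"
      unfolding gens_def using e(2) by blast
    then have "(a - (a - 2 * i), a - 2 * i) \<in> gens" unfolding e(1) .
    moreover have "a - (a - 2 * i) = 2 * i" using that a_plus r_ge by simp
    ultimately show ?thesis by simp
  qed (simp add: gens_def)
  have "Suc p * a = Suc p * (2 * r - 2) + Suc p * (2 * n + 1)" unfolding a by (rule add_mult_distrib2)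
  then have zmin: "x = Suc p * (2 * n + 1)" if "z = Suc p * (2 * r - 2)"
    using xz that by simp
  consider "odd x" | "even x" "x < 2 * n" | "x = Suc p * (2 * n + 1)"
    | "even x" "2 * n \<le> x" "z \<noteq> Suc p * (2 * r - 2)"
    using zmin by linarith
  then show ?case
  proof cases
    case 1
    then have "2 * n + 1 \<le> x" using z(3) unfolding left_exp_def by (cases "x = 2 * n") auto
    moreover then have "even (x - (2 * n + 1))" using 1 by simp
    ultimately show ?thesis using z(1) a by (intro step[OF g1]) (auto simp: left_exp_def)
  next
    case 2
    then obtain i where i: "x = 2 * i" by blast
    have "z = a - x + p * a" using xz 2 a by linarith
    moreover have "p * (2 * r - 2) \<le> p * a" by (rule mult_le_mono2) (simp add: a)
    ultimately have "(a - 2 * i) + p * (2 * r - 2) \<le> z" unfolding i by linarith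
    moreover have "i \<le> n" "2 * i \<le> a" using 2 a i by auto
    ultimately show ?thesis by (intro step[OF g2[of i]]) (auto simp: i left_exp_0)
  next
    case 3
    then have "x - (2 * n + 1) = p * (2 * n + 1)" by simp
    moreover have "left_exp (p * (2 * n + 1))" by (cases p) (auto intro: left_exp_0 left_exp_large)
    ultimately show ?thesis using z(1) a 3 by (intro step[OF g1]) auto
  next
    case 4
    then have "(a - 2 * n) + p * (2 * r - 2) \<le> z" using z(1) a by simp
    then show ?thesis using 4 a by (intro step[OF g2[of n]]) (auto simp: left_exp_def)
  qed
qed

lemma exp_span_mult: "(x, y) \<in> exp_span E \<Longrightarrow> (k * x, k * y) \<in> exp_span E"
  by (induction k) (auto intro: exp_span_zero exp_span_closed)

lemma gens_sub_curve: "gens \<subseteq> curve_exps"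
proof
  fix w assume "w \<in> gens"
  then consider "w = (1 * a, 0)" | "w = (a - r, r)" | "w = (a - (2 * r - 2), 2 * r - 2)" | "w = (0, 1 * a)"
    | i where "i < n" "w = (a - (2 * r + 2 * i - 1), 2 * r + 2 * i - 1)"
    unfolding gens_def by auto
  then show "w \<in> curve_exps"
  proof cases
    case 1 then show ?thesis using s_exp_in_curve by blast
  next
    case 2 show ?thesis unfolding 2 by (rule curve_expsI[of _ _ 1 1 0 0]) (use a_gt_r block_0 in auto)
  next
    case 3 
    have "a - (2 * r - 2) \<ge> 2 * n" using a_plus r_ge by linarith
    then show ?thesis unfolding 3 
      by (intro curve_expsI[of _ _ 1 0 1]) (use a_plus r_ge left_exp_large in \<open>auto simp: block_def\<close>)
  next
    case 4 then show ?thesis using t_exp_in_curve by blast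
  next
    case (5 i)
    have "a - (2 * r + 2 * i - 1) = 2 * (n - i)" using a_plus 5 r_ge by linarith
    then show ?thesis unfolding 5
      by (intro curve_expsI[of _ _ 1 0 1]) (use a_plus 5 r_ge odd_a in \<open>auto simp: block_def left_exp_def\<close>)
  qed
qed

lemma exp_span_gens: "exp_span gens = curve_exps"
proof
  show "exp_span gens \<subseteq> curve_exps"
  proof (rule subrelI)
    fix x y assume "(x, y) \<in> exp_span gens"
    then show "(x, y) \<in> curve_exps"
      by induction (use gens_sub_curve curve_exps_0 curve_exps_add in auto)
  qed
  show "curve_exps \<subseteq> exp_span gens"
  proof (rule subrelI)
    fix x y assume "(x, y) \<in> curve_exps"
    then obtain k c p z where h: "x + y = k * a" "c + p \<le> k" "y = c * r + z" "block p z"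
      unfolding curve_exps_def by auto
    obtain q where q: "k = c + p + q" using h(2) le_Suc_ex by blast
    have "z \<le> p * a" using h(4) unfolding block_def by simp
    moreover have "c * r \<le> c * a" using a_gt_r by simp
  moreover have "c * (a - r) = c * a - c * r" by (rule diff_mult_distrib2)
  moreover have "k * a = c * a + p * a + q * a" unfolding q by (simp add: add_mult_distrib)
    ultimately have x: "x = c * (a - r) + ((p * a - z) + q * a)"
      using h(1) unfolding h(3) by linarith
    have y: "y = c * r + (z + q * 0)" using h(3) by simp
    have g: "(a - r, r) \<in> exp_span gens" "(a, 0) \<in> exp_span gens"
      unfolding gens_def by (rule exp_span_incl; simp)+
    show "(x, y) \<in> exp_span gens" unfolding x y
      by (rule exp_span_closed[OF exp_span_mult[OF g(1)]
          exp_span_closed[OF block_in_exp_span[OF h(4)] exp_span_mult[OF g(2)]]])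
  qed
qed

lemma exp_span_gens_extra: "exp_span (gens \<union> {(2 * a - 3 * r, 3 * r)}) = cm_exps"
  (is "exp_span ?G = _")
proof
  have sub: "(x, y) \<in> exp_span ?G" if "(x, y) \<in> exp_span gens" for x y
    using that by induction (simp_all add: exp_span_zero exp_span_add)
  show "exp_span ?G \<subseteq> cm_exps"
  proof (rule subrelI)
    fix x y assume "(x, y) \<in> exp_span ?G"
    then show "(x, y) \<in> cm_exps"
    proof induction
      case exp_span_zero then show ?case using curve_exps_0 curve_sub_cm by blast
    next
      case (exp_span_add x y x' y')
      then have "(x, y) \<in> cm_exps" using gens_sub_curve curve_sub_cm extra_in_cm[of 0] by auto
      then show ?case using exp_span_add.IH by (rule cm_exps_add)
    qed
  qed
  show "cm_exps \<subseteq> exp_span ?G"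
  proof (rule subrelI)
    fix x y assume "(x, y) \<in> cm_exps"
    then consider "(x, y) \<in> curve_exps" | f where "x + 3 * r = 2 * a" "y = 3 * r + f * a"
      using cm_exps_cases by blast
    then show "(x, y) \<in> exp_span ?G"
    proof cases
      case 1 then show ?thesis using sub exp_span_gens by simp
    next
      case (2 f)
      have "(0, f * a) \<in> exp_span ?G" using sub exp_span_gens t_exp_in_curve by simp
      moreover have "(2 * a - 3 * r, 3 * r) \<in> exp_span ?G" by (rule exp_span_incl) simp
      ultimately have "(2 * a - 3 * r + 0, 3 * r + f * a) \<in> exp_span ?G" by (intro exp_span_closed)
      moreover have "x = 2 * a - 3 * r" using 2 by simp
      ultimately show ?thesis using 2 by simp
    qed
  qed
qed

end

section \<open>The enlarged algebra is Cohen-Macaulay\<close>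

lemma (in exponent_monoid) plane_algebra_supported:
  "plane_algebra (supported E :: 'k::field poly poly set)"
  by unfold_locales (rule cst_mem)

context monomial_curve
begin

sublocale curve: exponent_monoid curve_exps
  by unfold_locales (use curve_exps_0 curve_exps_add in auto)

sublocale cm: exponent_monoid cm_exps
  by unfold_locales (use curve_exps_0 curve_sub_cm cm_exps_add in auto)

lemma axes_in_cm: "(a, 0) \<in> cm_exps" "(0, a) \<in> cm_exps"
  using s_exp_in_curve[of 1] t_exp_in_curve[of 1] curve_sub_cm by auto

text \<open>
  The algebra is a finite module over \<open>K[s\<^sup>a, t\<^sup>a]\<close>, generated by the monomials in a box.
\<close>

lemma cm_exps_reduce:
  "(x, y) \<in> cm_exps \<Longrightarrow> \<exists>i j x0 y0. x = a * i + x0 \<and> y = a * j + y0 \<and> (x0, y0) \<in> cm_exps \<and>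
     x0 < 2 * n + a \<and> y0 < (2 * r) * (2 * r) + a"
proof (induction "x + y" arbitrary: x y rule: less_induct)
  case less
  have xy: "a dvd x + y" "left_exp x" "right_exp y" using less.prems unfolding cm_exps_def by auto
  consider "2 * n + a \<le> x" | "(2 * r) * (2 * r) + a \<le> y" | "x < 2 * n + a" "y < (2 * r) * (2 * r) + a"
    by linarith
  then show ?case
  proof cases
    case 1
    have "x - a + y = x + y - a" using 1 by simp
    then have "a dvd x - a + y" using dvd_diff_nat[OF xy(1) dvd_refl] by simp
    then have "(x - a, y) \<in> cm_exps" using xy 1 left_exp_large[of "x - a"] unfolding cm_exps_def by simp
    moreover have "x - a + y < x + y" using 1 a_pos by linarith
    ultimately obtain i j x0 y0 where h: "x - a = a * i + x0" "y = a * j + y0" "(x0, y0) \<in> cm_exps"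
      "x0 < 2 * n + a" "y0 < (2 * r) * (2 * r) + a" using less.hyps by meson
    then have "x = a * Suc i + x0" using 1 by simp
    then show ?thesis using h by blast
  next
    case 2
    have "x + (y - a) = x + y - a" using 2 by simp
    then have "a dvd x + (y - a)" using dvd_diff_nat[OF xy(1) dvd_refl] by simp
    then have "(x, y - a) \<in> cm_exps" using xy 2 right_exp_large[of "y - a"] unfolding cm_exps_def by simp
    moreover have "x + (y - a) < x + y" using 2 a_pos by linarith
    ultimately obtain i j x0 y0 where h: "x = a * i + x0" "y - a = a * j + y0" "(x0, y0) \<in> cm_exps"
      "x0 < 2 * n + a" "y0 < (2 * r) * (2 * r) + a" using less.hyps by meson
    then have "y = a * Suc j + y0" using 2 by simp
    then show ?thesis using h by blast
  next
    case 3
    then show ?thesis using less.prems by (intro exI[of _ 0] exI[of _ x] exI[of _ y]) simp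
  qed
qed

text \<open>
  The relation needed for \<open>maximal_ideal_algebraic\<close> comes from the algebraic dependence of
  a nonzero element \<open>x\<close> of \<open>P\<close>, \<open>s\<^sup>a\<close> and \<open>t\<^sup>a\<close>, read modulo \<open>x\<close>. The situation is symmetric in \<open>s\<^sup>a\<close> and \<open>t\<^sup>a\<close>.
\<close>

lemma maximal_ideal_contains_polynomials:
  fixes P :: "'k::field poly poly set"
  assumes max: "maximalideal P (ring_on (supported cm_exps))"
  shows "\<exists>f. f \<noteq> 0 \<and> eval_at (st_mono a 0) f \<in> P" "\<exists>f. f \<noteq> 0 \<and> eval_at (st_mono 0 a) f \<in> P"
proof -
  interpret A: plane_algebra "supported cm_exps :: 'k poly poly set" by (rule cm.plane_algebra_supported)
  note P = cm.maximalideal_onD[OF max]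
  define u v where "u = (st_mono a 0 :: 'k poly poly)" and "v = (st_mono 0 a :: 'k poly poly)"
  have uv: "u \<in> supported cm_exps" "v \<in> supported cm_exps"
    unfolding u_def v_def by (rule st_mono_in_supported[OF axes_in_cm(1)], rule st_mono_in_supported[OF axes_in_cm(2)])
  have "\<exists>x\<in>P. x \<noteq> 0"
  proof (cases "u \<in> P")
    case True
    moreover have "u \<noteq> 0" unfolding u_def by (simp add: st_mono_eq_monom monom_eq_0_iff)
    ultimately show ?thesis by blast
  next
    case False
    then obtain w where w: "1 - u * w \<in> P" using P(3)[OF uv(1)] by blast
    have "coeff2 (u * w) 0 0 = 0" unfolding coeff2_mult u_def using a_pos by (simp add: st_mono_eq_monom)
    then have "coeff2 (1 - u * w) 0 0 = 1" by simp
    then have "1 - u * w \<noteq> 0" by (metis coeff_0 zero_neq_one)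
    then show ?thesis using w by blast
  qed
  then obtain x where x: "x \<in> P" "x \<noteq> 0" by blast
  have xT: "x \<in> supported cm_exps" using cm.idlD(1)[OF P(1) x(1)] .
  have rel: "\<exists>N d. (\<Sum>j<N. (\<Sum>k<N. cst (d j k) * v' ^ k) * u' ^ j) \<in> P \<and> (\<exists>j<N. \<exists>k<N. d j k \<noteq> 0)"
    if "u' \<in> supported cm_exps" "v' \<in> supported cm_exps" for u' v'
  proof -
    note dep = A.dependence_modulo_first[OF xT that]
    obtain m N d b where b: "b \<in> supported cm_exps" and nz: "\<exists>j<N. \<exists>k<N. d j k \<noteq> 0"
      and z: "x ^ m * ((\<Sum>j<N. (\<Sum>k<N. cst (d j k) * v' ^ k) * u' ^ j) + b * x) = 0"
      using dep by blast
    have "(\<Sum>j<N. (\<Sum>k<N. cst (d j k) * v' ^ k) * u' ^ j) + b * x = 0" using z x(2) by simp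
    then have eq: "(\<Sum>j<N. (\<Sum>k<N. cst (d j k) * v' ^ k) * u' ^ j) = - (b * x)" by (simp add: eq_neg_iff_add_eq_0)
    have "(\<Sum>j<N. (\<Sum>k<N. cst (d j k) * v' ^ k) * u' ^ j) \<in> P"
      unfolding eq by (rule cm.idl_uminus[OF P(1) cm.idlD(4)[OF P(1) b x(1)]])
    from conjI[OF this nz] show ?thesis by (intro exI[of _ N], intro exI[of _ d])
  qed
  define Box where "Box = {(x, y) \<in> cm_exps. x < 2 * n + a \<and> y < (2 * r) * (2 * r) + a}"
  have "finite ((\<lambda>(x, y). st_mono x y :: 'k poly poly) ` Box)"
    by (rule finite_imageI, rule finite_subset[of _ "{..<2 * n + a} \<times> {..<(2 * r) * (2 * r) + a}"])
      (auto simp: Box_def)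
  then obtain es where es: "set es = (\<lambda>(x, y). st_mono x y :: 'k poly poly) ` Box" using finite_list by blast
  have esT: "set es \<subseteq> supported cm_exps" unfolding es Box_def by (auto intro: st_mono_in_supported)
  have span: "supported cm_exps \<subseteq> A" if A: "\<And>x y. x \<in> A \<Longrightarrow> y \<in> A \<Longrightarrow> x + y \<in> A" "0 \<in> A"
      "\<And>c i j e. e \<in> set es \<Longrightarrow> cst c * u ^ i * (v ^ j * e) \<in> A" for A
  proof (rule supported_subset_closed[OF A(2,1)])
    fix c :: 'k and x y assume "(x, y) \<in> cm_exps"
    from cm_exps_reduce[OF this] obtain i j x0 y0 where h: "x = a * i + x0" "y = a * j + y0" "(x0, y0) \<in> Box"
      unfolding Box_def by auto
    then have "st_mono x0 y0 \<in> set es" unfolding es by force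
    from A(3)[OF this, of c i j] show "cst c * st_mono x y \<in> A"
      unfolding h(1,2) u_def v_def st_mono_power mult.assoc st_mono_mult by simp
  qed
  have span': "supported cm_exps \<subseteq> A" if A: "\<And>x y. x \<in> A \<Longrightarrow> y \<in> A \<Longrightarrow> x + y \<in> A" "0 \<in> A"
      "\<And>c i j e. e \<in> set es \<Longrightarrow> cst c * v ^ i * (u ^ j * e) \<in> A" for A
  proof (rule span[OF A(1,2)])
    fix c i j e assume "e \<in> set es"
    from A(3)[OF this, of c j i] show "cst c * u ^ i * (v ^ j * e) \<in> A" by (simp only: ac_simps)
  qed
  obtain N d where "(\<Sum>j<N. (\<Sum>k<N. cst (d j k) * v ^ k) * u ^ j) \<in> P" "\<exists>j<N. \<exists>k<N. d j k \<noteq> 0"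
    using rel[OF uv] by blast
  from A.maximal_ideal_algebraic[OF max uv esT span this]
  show "\<exists>f. f \<noteq> 0 \<and> eval_at (st_mono a 0) f \<in> P" unfolding u_def by blast
  obtain N d where "(\<Sum>j<N. (\<Sum>k<N. cst (d j k) * u ^ k) * v ^ j) \<in> P" "\<exists>j<N. \<exists>k<N. d j k \<noteq> 0"
    using rel[OF uv(2,1)] by blast
  from A.maximal_ideal_algebraic[OF max uv(2,1) esT span' this]
  show "\<exists>f. f \<noteq> 0 \<and> eval_at (st_mono 0 a) f \<in> P" unfolding v_def by blast
qed

text \<open>
  In \<open>K[s,t]\<close> the factors \<open>F\<close> and \<open>H\<close> are coprime, so \<open>y = F w\<close> and \<open>z = H w\<close>. Multiplication by
  \<open>F\<close> moves \<open>s\<close>-exponents only, so that \<open>y\<close> controls the \<open>t\<close>-exponents of \<open>w\<close>; likewise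
  \<open>z\<close> controls its \<open>s\<close>-exponents and the congruence modulo \<open>a\<close>. This is where it matters that
  \<open>cm_exps\<close> is given by separate conditions.
\<close>

lemma s_t_polynomials_regular:
  fixes f g :: "'k::field poly"
  assumes f: "f \<noteq> 0" and g: "g \<noteq> 0"
  defines "F \<equiv> eval_at (st_mono a 0) f" and "H \<equiv> eval_at (st_mono 0 a) g"
  assumes yz: "y \<in> supported cm_exps" "z \<in> supported cm_exps" "H * y = F * z"
  shows "\<exists>w\<in>supported cm_exps. y = F * w"
proof -
  have nz: "F \<noteq> 0" "H \<noteq> 0"
    unfolding F_def H_def using a_pos eval_at_monomial_nonzero[OF _ f, of a 0] eval_at_monomial_nonzero[OF _ g, of 0 a] by auto
  have "coeff2 F (degree F) j = 0" if "j \<noteq> 0" for j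
    using supportedD[OF eval_at_monomial_supported[of a 0 f], of "degree F" j] that unfolding F_def by auto
  then have lead: "lead_coeff F = [:coeff2 F (degree F) 0:]"
    by (intro poly_eqI) (simp add: coeff_pCons split: nat.split)
  have lnz: "coeff2 F (degree F) 0 \<noteq> 0" using nz(1) lead by (metis leading_coeff_0_iff pCons_0_0)
  have "coeff H i = 0" if "i \<noteq> 0" for i
  proof (rule poly_eqI)
    fix j show "coeff2 H i j = coeff 0 j"
      using supportedD[OF eval_at_monomial_supported[of 0 a g], of i j] that unfolding H_def by auto
  qed
  then have H: "H = [:coeff H 0:]" by (intro poly_eqI) (simp add: coeff_pCons split: nat.split)
  have "[:coeff H 0:] dvd F * z" unfolding H[symmetric] yz(3)[symmetric] by simp
  from const_dvd_cancel_unit_leading[OF lead lnz this] obtain w where "z = [:coeff H 0:] * w" by (rule dvdE)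
  then have z: "z = H * w" unfolding H[symmetric] .
  then have "H * (y - F * w) = 0" using yz(3) by (simp add: algebra_simps)
  then have y: "y = F * w" using nz(2) by simp
  have "w \<in> supported cm_exps"
  proof (rule supportedI)
    fix i j assume wij: "coeff2 w i j \<noteq> 0"
    obtain m where "coeff2 (F * w) (i + a * m) (j + 0 * m) \<noteq> 0"
      using eval_at_monomial_mult_coeff[OF _ f wij, of a 0] a_pos unfolding F_def by auto
    then have "(i + a * m, j) \<in> cm_exps" using supportedD[OF yz(1)] unfolding y by simp
    then have "right_exp j" unfolding cm_exps_def by simp
    moreover obtain l where "coeff2 (H * w) (i + 0 * l) (j + a * l) \<noteq> 0"
      using eval_at_monomial_mult_coeff[OF _ g wij, of 0 a] a_pos unfolding H_def by auto
    then have "(i, j + a * l) \<in> cm_exps" using supportedD[OF yz(2)] unfolding z by simp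
    then have "left_exp i" "a dvd i + j + a * l" unfolding cm_exps_def by (auto simp: add.assoc)
    then have "left_exp i" "a dvd i + j" by (auto simp: dvd_add_left_iff)
    ultimately show "(i, j) \<in> cm_exps" unfolding cm_exps_def by simp
  qed
  then show ?thesis using y by blast
qed

lemma cohen_macaulay_cm: "cohen_macaulay (ring_on (supported cm_exps :: 'k::field poly poly set))"
proof (rule cm.cohen_macaulayI)
  interpret A: plane_algebra "supported cm_exps :: 'k poly poly set" by (rule cm.plane_algebra_supported)
  show "noetherian_ring (ring_on (supported cm_exps :: 'k poly poly set))"
    by (rule cm.noetherian_supported[OF a_pos axes_in_cm])
  show "\<exists>m0 m1 m2. \<exists>b0\<in>supported cm_exps. \<exists>b1\<in>supported cm_exps. \<exists>b2\<in>supported cm_exps.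
      x0 ^ m0 * (x1 ^ m1 * (x2 ^ m2 * (1 + b2 * x2) + b1 * x1) + b0 * x0) = 0"
    if "x0 \<in> supported cm_exps" "x1 \<in> supported cm_exps" "x2 \<in> supported cm_exps" for x0 x1 x2 :: "'k poly poly"
    using A.dimension_at_most_two[OF that] .
  fix P :: "'k poly poly set" assume max: "maximalideal P (ring_on (supported cm_exps))"
  obtain f g where fg: "f \<noteq> 0" "eval_at (st_mono a 0) f \<in> P" "g \<noteq> 0" "eval_at (st_mono 0 a) g \<in> P"
    using maximal_ideal_contains_polynomials[OF max] by blast
  have "eval_at (st_mono a 0) f \<noteq> 0" by (rule eval_at_monomial_nonzero[OF _ fg(1)]) (use a_pos in simp)
  then show "\<exists>x1\<in>P. \<exists>x2\<in>P. x1 \<noteq> 0 \<and> (\<forall>y\<in>supported cm_exps. \<forall>z\<in>supported cm_exps. x2 * y = x1 * z \<longrightarrow>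
      (\<exists>w\<in>supported cm_exps. y = x1 * w))"
    using fg(2,4) s_t_polynomials_regular[OF fg(1,3)] by blast
qed

end

section \<open>Quotients by a subring\<close>

definition coset :: "'a::comm_ring_1 set \<Rightarrow> 'a \<Rightarrow> 'a set" where
  "coset A x = {h + x | h. h \<in> A}"

locale type_subring_pair = T: type_subring T + U: type_subring U
  for T U :: "'a::comm_ring_1 set" +
  assumes sub: "T \<subseteq> U"
begin

abbreviation "whole \<equiv> ring_as_module (ring_on U)"
abbreviation "quot \<equiv> quotient_module whole T"

lemma coset_eq_iff: "coset T x = coset T y \<longleftrightarrow> x - y \<in> T"
proof
  assume "coset T x = coset T y"
  moreover have "x \<in> coset T x" unfolding coset_def using T.zero_mem by force
  ultimately show "x - y \<in> T" unfolding coset_def by auto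
next
  assume xy: "x - y \<in> T"
  have "h + x \<in> coset T y" if "h \<in> T" for h
  proof -
    have "h + x = (h + (x - y)) + y" by simp
    then show ?thesis unfolding coset_def using T.add_mem[OF that xy] by blast
  qed
  moreover have "h + y \<in> coset T x" if "h \<in> T" for h
  proof -
    have "h + y = (h - (x - y)) + x" by simp
    then show ?thesis unfolding coset_def using T.diff_mem[OF that xy] by blast
  qed
  ultimately show "coset T x = coset T y" unfolding coset_def by blast
qed

lemma rcoset_eq: "T +>\<^bsub>whole\<^esub> x = coset T x"
  unfolding a_r_coset_def' coset_def by (auto simp: ring_as_module_def)

lemma carrier_quot: "carrier quot = coset T ` U"
  unfolding quotient_module_def A_RCOSETS_def' rcoset_eq by (auto simp: ring_as_module_def)

lemma zero_quot: "\<zero>\<^bsub>quot\<^esub> = coset T 0"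
  by (simp add: quotient_module_def coset_def)

lemma add_quot: "coset T x \<oplus>\<^bsub>quot\<^esub> coset T y = coset T (x + y)"
proof -
  have "coset T x \<oplus>\<^bsub>quot\<^esub> coset T y = {p + q | p q. p \<in> coset T x \<and> q \<in> coset T y}"
    by (auto simp: quotient_module_def set_add_def' ring_as_module_def)
  also have "\<dots> = coset T (x + y)"
  proof
    show "{p + q | p q. p \<in> coset T x \<and> q \<in> coset T y} \<subseteq> coset T (x + y)"
    proof
      fix z assume "z \<in> {p + q | p q. p \<in> coset T x \<and> q \<in> coset T y}"
      then obtain h k where "h \<in> T" "k \<in> T" "z = (h + x) + (k + y)" unfolding coset_def by blast
      then have "z = (h + k) + (x + y)" "h + k \<in> T" using T.add_mem by (auto simp: algebra_simps)
      then show "z \<in> coset T (x + y)" unfolding coset_def by blast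
    qed
    show "coset T (x + y) \<subseteq> {p + q | p q. p \<in> coset T x \<and> q \<in> coset T y}"
    proof
      fix z assume "z \<in> coset T (x + y)"
      then obtain h where "h \<in> T" "z = (h + x) + (0 + y)" unfolding coset_def by (auto simp: add.assoc)
      then show "z \<in> {p + q | p q. p \<in> coset T x \<and> q \<in> coset T y}" unfolding coset_def using T.zero_mem by blast
    qed
  qed
  finally show ?thesis .
qed

lemma smult_quot: assumes "c \<in> T" shows "c \<odot>\<^bsub>quot\<^esub> coset T x = coset T (c * x)"
proof -
  have "c \<odot>\<^bsub>quot\<^esub> coset T x = (\<Union>y\<in>coset T x. coset T (c * y))"
    by (simp add: quotient_module_def rcoset_eq, simp add: ring_as_module_def)
  also have "\<dots> = coset T (c * x)"
  proof -
    have "coset T (c * y) = coset T (c * x)" if y: "y \<in> coset T x" for y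
    proof -
      obtain h where "h \<in> T" "y = h + x" using y unfolding coset_def by blast
      then have "c * y - c * x = c * h" by (simp add: algebra_simps)
      moreover have "c * h \<in> T" using T.mult_mem[OF assms \<open>h \<in> T\<close>] .
      ultimately show ?thesis unfolding coset_eq_iff by simp
    qed
    moreover have "x \<in> coset T x" unfolding coset_def using T.zero_mem by force
    ultimately show ?thesis by blast
  qed
  finally show ?thesis .
qed

lemma module_quot: "module (ring_on T) quot"
proof (rule moduleI)
  show "cring (ring_on T)" by (rule T.cring_on)
  show "abelian_group quot"
  proof (rule abelian_groupI)
    show "\<zero>\<^bsub>quot\<^esub> \<in> carrier quot" unfolding zero_quot carrier_quot using U.zero_mem by blast
    fix p assume "p \<in> carrier quot"
    then obtain x where x: "x \<in> U" "p = coset T x" unfolding carrier_quot by blast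
    show "\<zero>\<^bsub>quot\<^esub> \<oplus>\<^bsub>quot\<^esub> p = p" unfolding zero_quot x add_quot by simp
    have "coset T (- x) \<in> carrier quot" "coset T (- x) \<oplus>\<^bsub>quot\<^esub> p = \<zero>\<^bsub>quot\<^esub>"
      unfolding carrier_quot zero_quot x add_quot using U.uminus_mem[OF x(1)] by auto
    then show "\<exists>q\<in>carrier quot. q \<oplus>\<^bsub>quot\<^esub> p = \<zero>\<^bsub>quot\<^esub>" by blast
    fix q assume "q \<in> carrier quot"
    then obtain y where y: "y \<in> U" "q = coset T y" unfolding carrier_quot by blast
    show "p \<oplus>\<^bsub>quot\<^esub> q \<in> carrier quot" unfolding x y add_quot carrier_quot using U.add_mem[OF x(1) y(1)] by blast
    show "p \<oplus>\<^bsub>quot\<^esub> q = q \<oplus>\<^bsub>quot\<^esub> p" unfolding x y add_quot by (simp add: add.commute)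
    fix s assume "s \<in> carrier quot"
    then obtain z where z: "z \<in> U" "s = coset T z" unfolding carrier_quot by blast
    show "(p \<oplus>\<^bsub>quot\<^esub> q) \<oplus>\<^bsub>quot\<^esub> s = p \<oplus>\<^bsub>quot\<^esub> (q \<oplus>\<^bsub>quot\<^esub> s)" unfolding x y z add_quot by (simp add: add.assoc)
  qed
  fix p assume "p \<in> carrier quot"
  then obtain x where x: "x \<in> U" "p = coset T x" unfolding carrier_quot by blast
  show "\<one>\<^bsub>ring_on T\<^esub> \<odot>\<^bsub>quot\<^esub> p = p" using smult_quot[OF T.one_mem] unfolding x by simp
  fix c assume "c \<in> carrier (ring_on T)"
  then have c: "c \<in> T" by simp
  show "c \<odot>\<^bsub>quot\<^esub> p \<in> carrier quot"
    unfolding x smult_quot[OF c] carrier_quot using U.mult_mem[OF subsetD[OF sub c] x(1)] by blast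
  {
    fix q assume "q \<in> carrier quot"
    then obtain y where y: "y \<in> U" "q = coset T y" unfolding carrier_quot by blast
    show "c \<odot>\<^bsub>quot\<^esub> (p \<oplus>\<^bsub>quot\<^esub> q) = (c \<odot>\<^bsub>quot\<^esub> p) \<oplus>\<^bsub>quot\<^esub> (c \<odot>\<^bsub>quot\<^esub> q)"
      unfolding x y add_quot smult_quot[OF c] by (simp add: distrib_left)
  }
  fix d assume "d \<in> carrier (ring_on T)"
  then have d: "d \<in> T" by simp
  show "(c \<oplus>\<^bsub>ring_on T\<^esub> d) \<odot>\<^bsub>quot\<^esub> p = (c \<odot>\<^bsub>quot\<^esub> p) \<oplus>\<^bsub>quot\<^esub> (d \<odot>\<^bsub>quot\<^esub> p)"
    using smult_quot[OF T.add_mem[OF c d]] unfolding x smult_quot[OF c] smult_quot[OF d] add_quot by (simp add: distrib_right)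
  show "(c \<otimes>\<^bsub>ring_on T\<^esub> d) \<odot>\<^bsub>quot\<^esub> p = c \<odot>\<^bsub>quot\<^esub> (d \<odot>\<^bsub>quot\<^esub> p)"
    using smult_quot[OF T.mult_mem[OF c d]] unfolding x smult_quot[OF c] smult_quot[OF d] by (simp add: mult.assoc)
qed

text \<open>
  Submodules of the quotient are replaced by the modules between \<open>T\<close> and \<open>U\<close> that they come from.
\<close>

lemma submodule_preimage:
  assumes "submodule D (ring_on T) quot"
  defines "V \<equiv> {x \<in> U. coset T x \<in> D}"
  shows "D = coset T ` V" "T \<subseteq> V" "x \<in> V \<Longrightarrow> y \<in> V \<Longrightarrow> x + y \<in> V" "c \<in> T \<Longrightarrow> x \<in> V \<Longrightarrow> c * x \<in> V"
proof -
  interpret submodule D "ring_on T" quot by fact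
  have DQ: "D \<subseteq> coset T ` U" using subset unfolding carrier_quot[symmetric] by simp
  then show "D = coset T ` V" unfolding V_def by blast
  show "T \<subseteq> V"
  proof
    fix x assume x: "x \<in> T"
    then have "coset T x = coset T 0" unfolding coset_eq_iff by simp
    moreover have "coset T 0 \<in> D" using one_closed zero_quot by simp
    ultimately show "x \<in> V" unfolding V_def using x sub by auto
  qed
  show "x + y \<in> V" if "x \<in> V" "y \<in> V"
    using that m_closed[of "coset T x" "coset T y"] U.add_mem unfolding V_def by (simp add: add_quot)
  show "c * x \<in> V" if "c \<in> T" "x \<in> V"
    using that smult_closed[of c "coset T x"] U.mult_mem sub unfolding V_def by (auto simp: smult_quot)
qed

end

section \<open>The Macaulayfication\<close>

context monomial_curve
begin

lemma extra_exps_eq: "x + 3 * r = 2 * a \<longleftrightarrow> x = 2 * a - 3 * r"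
  using three_r_le(2) by auto

lemma supported_curveI:
  assumes "h \<in> supported cm_exps" "\<And>f. f < r \<Longrightarrow> coeff2 h (2 * a - 3 * r) (3 * r + f * a) = 0"
  shows "h \<in> supported curve_exps"
proof (rule supportedI)
  fix i j assume nz: "coeff2 h i j \<noteq> 0"
  then consider "(i, j) \<in> curve_exps" | f where "i = 2 * a - 3 * r" "j = 3 * r + f * a"
    using cm_exps_cases[OF supportedD[OF assms(1)]] extra_exps_eq by blast
  then show "(i, j) \<in> curve_exps"
  proof cases
    case (2 f)
    then have "\<not> f < r" using assms(2) nz by blast
    then show ?thesis unfolding 2 using extra_eventually_in_curve by simp
  qed
qed

text \<open>
  An element of the larger algebra lies in the smaller one if its coefficients at \<open>r\<close> places
  vanish. A chain with more than \<open>r\<close> proper steps is impossible: pick an element from each step; some nontrivial linear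
  combination has these coefficients zero, so it lies in the bottom submodule, and then so does its topmost
  term in the submodule before its own step.
\<close>

lemma finite_length_quotient:
  "finite_length (ring_on (supported curve_exps :: 'k::field poly poly set))
     (quotient_module (ring_as_module (ring_on (supported cm_exps))) (supported curve_exps))"
proof -
  let ?T = "supported curve_exps :: 'k poly poly set"
  let ?U = "supported cm_exps :: 'k poly poly set"
  interpret pair: type_subring_pair ?T ?U
    by unfold_locales (rule supported_mono[OF curve_sub_cm])
  have len: "k \<le> r" if C: "\<And>i. i \<le> k \<Longrightarrow> submodule (C i) (ring_on ?T) pair.quot" "\<And>i. i < k \<Longrightarrow> C i \<subset> C (Suc i)" for k C
  proof (rule ccontr)
    assume "\<not> k \<le> r"
    define V where "V = (\<lambda>i. {x \<in> ?U. coset ?T x \<in> C i})"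
    have V: "C i = coset ?T ` V i" "?T \<subseteq> V i" if "i \<le> k" for i
      using pair.submodule_preimage(1,2)[OF C(1)[OF that]] unfolding V_def by simp_all
    have V_add: "x + y \<in> V i" if "i \<le> k" "x \<in> V i" "y \<in> V i" for i x y
      using pair.submodule_preimage(3)[OF C(1)[OF that(1)] that(2,3)[unfolded V_def]] unfolding V_def .
    have V_mult: "cst c * x \<in> V i" if "i \<le> k" "x \<in> V i" for i c x
      using pair.submodule_preimage(4)[OF C(1)[OF that(1)] curve.cst_mem that(2)[unfolded V_def]] unfolding V_def .
    have V_zero: "0 \<in> V i" if "i \<le> k" for i using V(2)[OF that] supported_0 by blast
    have "\<exists>x. x \<in> V (Suc i) - V i" if i: "i < k" for i
    proof -
      have "C i \<noteq> C (Suc i)" "C i \<subseteq> C (Suc i)" using C(2)[OF i] by auto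
      then have "\<not> V (Suc i) \<subseteq> V i" using V(1)[of i] V(1)[of "Suc i"] i by auto
      then show ?thesis by blast
    qed
    then obtain h where h: "\<And>i. i < k \<Longrightarrow> h i \<in> V (Suc i) - V i" by metis
    have mono: "V i \<subseteq> V j" if "i \<le> j" "j \<le> k" for i j
      using that
    proof (induction j)
      case (Suc j)
      show ?case
      proof (cases "i = Suc j")
        case False
        then have "V i \<subseteq> V j" using Suc by simp
        moreover have "V j \<subseteq> V (Suc j)" using C(2)[of j] Suc.prems unfolding V_def by auto
        ultimately show ?thesis by blast
      qed simp
    qed simp
    have "card {..<r} < card {..<k}" using \<open>\<not> k \<le> r\<close> by simp
    from homogeneous_system_solvable[OF _ _ this, of "\<lambda>f i. coeff2 (h i) (2 * a - 3 * r) (3 * r + f * a)"]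
    obtain c where c: "\<exists>i\<in>{..<k}. c i \<noteq> 0"
      "\<forall>f\<in>{..<r}. (\<Sum>i<k. c i * coeff2 (h i) (2 * a - 3 * r) (3 * r + f * a)) = 0" by auto
    define S where "S = {i. i < k \<and> c i \<noteq> 0}"
    define l where "l = Max S"
    have "finite S" "S \<noteq> {}" unfolding S_def using c(1) by auto
    then have lS: "l \<in> S" and lmax: "\<And>i. i \<in> S \<Longrightarrow> i \<le> l" unfolding l_def by auto
    have lk: "l < k" "c l \<noteq> 0" using lS unfolding S_def by auto
    have ll: "l \<le> k" using lk(1) by simp
    have sumV: "(\<Sum>i\<in>I. cst (c i) * h i) \<in> V l" if "\<And>i. i \<in> I \<Longrightarrow> i < l" for I
      using that
    proof (induction I rule: infinite_finite_induct)
      case (insert i I)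
      have i: "i < l" using insert.prems by blast
      have "h i \<in> V (Suc i)" using h[of i] i lk(1) by simp
      moreover have "V (Suc i) \<subseteq> V l" using mono[of "Suc i" l] i ll by simp
      ultimately have "cst (c i) * h i \<in> V l" using V_mult[OF ll] by blast
      moreover have "(\<Sum>i\<in>I. cst (c i) * h i) \<in> V l" using insert.IH insert.prems by blast
      ultimately show ?case unfolding sum.insert[OF insert.hyps] by (rule V_add[OF ll])
    qed (simp_all add: V_zero[OF ll])
    have hU: "h i \<in> ?U" if "i < k" for i using h[OF that] unfolding V_def by blast
    define g where "g = (\<Sum>i<k. cst (c i) * h i)"
    have "g \<in> ?U" unfolding g_def by (intro cm.sum_mem cm.mult_mem cm.cst_mem hU) simp
    moreover have "coeff2 g (2 * a - 3 * r) (3 * r + f * a) = 0" if "f < r" for f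
    proof -
      have "coeff2 g (2 * a - 3 * r) (3 * r + f * a) = (\<Sum>i<k. c i * coeff2 (h i) (2 * a - 3 * r) (3 * r + f * a))"
        unfolding g_def by (simp add: coeff_sum)
      then show ?thesis using c(2) that by simp
    qed
    ultimately have "g \<in> ?T" by (rule supported_curveI)
    then have gV: "g \<in> V l" using V(2)[OF ll] by blast
    have "g = (\<Sum>i\<in>{..l}. cst (c i) * h i)"
      unfolding g_def
    proof (rule sum.mono_neutral_right)
      show "\<forall>i\<in>{..<k} - {..l}. cst (c i) * h i = 0"
      proof
        fix i assume "i \<in> {..<k} - {..l}"
        then have "c i = 0" using lmax[of i] unfolding S_def by fastforce
        then show "cst (c i) * h i = 0" by simp
      qed
    qed (use lk in auto)
    also have "\<dots> = cst (c l) * h l + (\<Sum>i<l. cst (c i) * h i)"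
      by (simp add: lessThan_Suc_atMost[symmetric])
    finally have g: "g = cst (c l) * h l + (\<Sum>i<l. cst (c i) * h i)" .
    have "(\<Sum>i<l. cst (c i) * h i) \<in> V l" by (rule sumV) simp
    then have gV': "g + cst (- 1) * (\<Sum>i<l. cst (c i) * h i) \<in> V l" by (rule V_add[OF ll gV V_mult[OF ll]])
    have neg: "cst (- 1) = (- 1 :: 'k poly poly)" by (simp only: one_pCons minus_pCons minus_zero)
    have "g + cst (- 1) * (\<Sum>i<l. cst (c i) * h i) = cst (c l) * h l"
      unfolding g neg by (simp only: mult_minus1 add_diff_cancel_right' flip: diff_conv_add_uminus)
    with gV' have "cst (c l) * h l \<in> V l" by (simp only:)
    then have "cst (inverse (c l)) * (cst (c l) * h l) \<in> V l" by (rule V_mult[OF ll])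
    moreover have "cst (inverse (c l)) * cst (c l) = 1" using lk(2) by (simp flip: one_pCons)
    then have "cst (inverse (c l)) * (cst (c l) * h l) = h l" by (simp only: mult.assoc[symmetric] mult_1)
    ultimately have "h l \<in> V l" by (simp only:)
    then show False using h[OF lk(1)] by blast
  qed
  have "module_length (ring_on ?T) pair.quot \<le> enat r"
    unfolding module_length_def
  proof (rule Sup_least)
    fix e assume "e \<in> {enat k |k. \<exists>C. (\<forall>i\<le>k. submodule (C i) (ring_on ?T) pair.quot) \<and> (\<forall>i<k. C i \<subset> C (Suc i))}"
    then obtain k C where "e = enat k" "\<forall>i\<le>k. submodule (C i) (ring_on ?T) pair.quot" "\<forall>i<k. C i \<subset> C (Suc i)"
      by blast
    then show "e \<le> enat r" using len[of k C] by simp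
  qed
  then have "module_length (ring_on ?T) pair.quot \<noteq> \<infinity>" by (auto dest: enat_ile)
  then show ?thesis unfolding finite_length_def using pair.module_quot by simp
qed

lemma macaulayfication_curve:
  "is_macaulayfication (ring_on (supported curve_exps :: 'k::field poly poly set)) (ring_on (supported cm_exps))"
  unfolding is_macaulayfication_def
proof (intro conjI)
  interpret U: cring "ring_on (supported cm_exps :: 'k poly poly set)" by (rule cm.cring_on)
  have sub: "supported curve_exps \<subseteq> (supported cm_exps :: 'k poly poly set)" by (rule supported_mono[OF curve_sub_cm])
  show "subring (carrier (ring_on (supported curve_exps :: 'k poly poly set))) (ring_on (supported cm_exps))"
  proof (rule U.subringI)
    fix h :: "'k poly poly" assume h: "h \<in> carrier (ring_on (supported curve_exps))"
    then have "\<ominus>\<^bsub>ring_on (supported cm_exps)\<^esub> h = - h" using sub by (intro cm.a_inv_on) auto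
    then show "\<ominus>\<^bsub>ring_on (supported cm_exps)\<^esub> h \<in> carrier (ring_on (supported curve_exps))"
      using h curve.uminus_mem by simp
  qed (use sub curve.one_mem curve.mult_mem curve.add_mem in auto)
  show "cohen_macaulay (ring_on (supported cm_exps :: 'k poly poly set))" by (rule cohen_macaulay_cm)
  show "finite_length (ring_on (supported curve_exps :: 'k poly poly set))
     (quotient_module (ring_as_module (ring_on (supported cm_exps))) (carrier (ring_on (supported curve_exps))))"
    using finite_length_quotient by simp
qed simp

section \<open>The primary decomposition\<close>

text \<open>
  The exponents of the component of the ideal of \<open>s\<^sup>d\<close> whose radical is generated by the monomials divisible by \<open>s\<close>.
\<close>

definition cm_component :: "nat \<Rightarrow> (nat \<times> nat) set" where
  "cm_component d = {(x, y). (x, y) \<in> curve_exps \<and> (d \<le> x \<and> left_exp (x - d))}"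

text \<open>
  The exponents of the component whose radical is the irrelevant maximal ideal.
\<close>

definition max_component :: "nat \<Rightarrow> nat \<Rightarrow> (nat \<times> nat) set" where
  "max_component d e = {(x + x', y + y') | x y x' y'. (x, y) \<in> {(d, 0), (0, e)} \<and> (x', y') \<in> curve_exps}"

lemma genideal_s_power:
  "Idl\<^bsub>ring_on (supported curve_exps)\<^esub> {st_mono (k * a) 0 :: 'k::field poly poly}
     = supported {(k * a + x, y) | x y. (x, y) \<in> curve_exps}"
proof -
  have "{st_mono (k * a) 0 :: 'k poly poly} = {st_mono x y | x y. (x, y) \<in> {(k * a, 0)}}" by auto
  moreover have "{(x + x', y + y') | x y x' y'. (x, y) \<in> {(k * a, 0)} \<and> (x', y') \<in> curve_exps}
      = {(k * a + x, y) | x y. (x, y) \<in> curve_exps}" by auto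
  ultimately show ?thesis
    using curve.genideal_monos[of "{(k * a, 0)}", where ?'k = 'k] s_exp_in_curve by simp
qed

text \<open>
  If \<open>(x, y)\<close> is in the component, then \<open>(x - ka, y)\<close> is in \<open>cm_exps\<close>; hence it is in
  \<open>curve_exps\<close> or of the form \<open>(2a - 3r, 3r + fa)\<close>.
\<close>

lemma translates_cm_component:
  assumes k: "k \<ge> 1"
  defines "F \<equiv> {(k * a, 0), (k * a + (2 * a - 3 * r), 3 * r)}"
  shows "F \<subseteq> curve_exps"
    and "{(x + x', y + y') | x y x' y'. (x, y) \<in> F \<and> (x', y') \<in> curve_exps} = cm_component (k * a)"
      (is "?H = _")
proof -
  have "k * a + (2 * a - 3 * r) = (k - 1) * a + 3 * a - 3 * r"
    using k three_r_le(2) by (cases k) auto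
  then have e: "(k * a + (2 * a - 3 * r), 3 * r) \<in> curve_exps" using three_r_in_curve[of "k - 1"] by simp
  then show F: "F \<subseteq> curve_exps" unfolding F_def using s_exp_in_curve by blast
  have left: "left_exp x" if "(x, y) \<in> curve_exps" for x y
    using that curve_sub_cm unfolding cm_exps_def by blast
  have "(x + x', y + y') \<in> cm_component (k * a)" if xy: "(x, y) \<in> F" "(x', y') \<in> curve_exps" for x y x' y'
  proof -
    have mem: "(x + x', y + y') \<in> curve_exps" using curve_exps_add F xy by blast
    consider "x = k * a" | "x = k * a + (2 * a - 3 * r)" using xy(1) unfolding F_def by auto
    then have "k * a \<le> x + x' \<and> left_exp (x + x' - k * a)"
    proof cases
      case 1 then show ?thesis using left[OF xy(2)] by simp
    next
      case 2
      then have "x + x' - k * a = (2 * a - 3 * r) + x'" by simp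
      then show ?thesis using left_exp_add[OF three_r_le(1) left[OF xy(2)]] 2 by simp
    qed
    then show ?thesis using mem unfolding cm_component_def by simp
  qed
  then have "?H \<subseteq> cm_component (k * a)" by blast
  moreover have "(x, y) \<in> ?H" if xy: "(x, y) \<in> cm_component (k * a)" for x y
  proof -
    define x' where "x' = x - k * a"
    have x: "x = k * a + x'" "left_exp x'" "(x, y) \<in> curve_exps"
      using xy unfolding cm_component_def x'_def by auto
    then have "a dvd k * a + (x' + y)" "right_exp y"
      using curve_sub_cm unfolding cm_exps_def by (auto simp: add.assoc)
    then have "(x', y) \<in> cm_exps" using x(2) unfolding cm_exps_def by (simp add: dvd_add_right_iff)
    then consider "(x', y) \<in> curve_exps" | f where "x' = 2 * a - 3 * r" "y = 3 * r + f * a"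
      using cm_exps_cases extra_exps_eq by blast
    then show ?thesis
    proof cases
      case 1
      have "(x, y) = (k * a + x', 0 + y)" "(k * a, 0) \<in> F" unfolding F_def x(1) by auto
      then show ?thesis using 1 by blast
    next
      case (2 f)
      have "(x, y) = (k * a + (2 * a - 3 * r) + 0, 3 * r + f * a)" "(k * a + (2 * a - 3 * r), 3 * r) \<in> F"
        unfolding F_def x(1) 2 by auto
      then show ?thesis using t_exp_in_curve[of f] by blast
    qed
  qed
  ultimately show "?H = cm_component (k * a)" by auto
qed

lemma genideal_cm_component:
  assumes k: "k \<ge> 1"
  shows "Idl\<^bsub>ring_on (supported curve_exps)\<^esub>
      {st_mono (k * a) 0, st_mono (k * a + (2 * a - 3 * r)) (3 * r) :: 'k::field poly poly}
     = supported (cm_component (k * a))"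
proof -
  let ?F = "{(k * a, 0), (k * a + (2 * a - 3 * r), 3 * r)}"
  have "{st_mono (k * a) 0, st_mono (k * a + (2 * a - 3 * r)) (3 * r) :: 'k poly poly}
      = {st_mono x y | x y. (x, y) \<in> ?F}" by auto
  then show ?thesis
    using curve.genideal_monos[OF translates_cm_component(1)[OF k], where ?'k = 'k]
    unfolding translates_cm_component(2)[OF k] by simp
qed

lemma genideal_max_component:
  "Idl\<^bsub>ring_on (supported curve_exps)\<^esub> {st_mono (k * a) 0, st_mono 0 (m * a) :: 'k::field poly poly}
     = supported (max_component (k * a) (m * a))"
proof -
  let ?F = "{(k * a, 0), (0, m * a)}"
  have "{st_mono (k * a) 0, st_mono 0 (m * a) :: 'k poly poly} = {st_mono x y | x y. (x, y) \<in> ?F}" by auto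
  moreover have "?F \<subseteq> curve_exps" using s_exp_in_curve t_exp_in_curve by blast
  ultimately show ?thesis
    unfolding max_component_def using curve.genideal_monos[of ?F, where ?'k = 'k] by simp
qed

lemma primary_cm_component:
  assumes "k \<ge> 1"
  shows "primary_ideal (supported (cm_component (k * a))) (ring_on (supported curve_exps :: 'k::field poly poly set))"
  unfolding cm_component_def
proof (rule curve.primary_s_primary)
  fix x x' y assume A: "k * a \<le> x \<and> left_exp (x - k * a)" and "(x', y) \<in> curve_exps"
  then have l: "left_exp x'" using curve_sub_cm unfolding cm_exps_def by blast
  have e: "x' + x - k * a = x' + (x - k * a)" using A by simp
  show "k * a \<le> x' + x \<and> left_exp (x' + x - k * a)"
    unfolding e using left_exp_add[OF l, of "x - k * a"] A trans_le_add2 by blast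
next
  show "\<not> (k * a \<le> 0 \<and> left_exp (0 - k * a))" using assms a_pos by simp
  fix x assume "k * a + 2 * n \<le> x"
  then show "k * a \<le> x \<and> left_exp (x - k * a)" by (simp add: left_exp_large)
qed

text \<open>
  One of \<open>x\<close> and \<open>y\<close> is large. Then subtracting \<open>ka\<close> from \<open>x\<close>, respectively \<open>ma\<close> from \<open>y\<close>, keeps the pair
  in \<open>cm_exps\<close> and away from the finitely many pairs outside \<open>curve_exps\<close>.
\<close>

lemma curve_exps_far_out:
  assumes xy: "(x, y) \<in> curve_exps"
    and far: "k * a + 2 * a + 2 * n + (m * a + (2 * r) * (2 * r) + 3 * r + r * a) \<le> x + y"
  shows "(x, y) \<in> max_component (k * a) (m * a)"
proof -
  have cm: "a dvd x + y" "left_exp x" "right_exp y" using xy curve_sub_cm unfolding cm_exps_def by auto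
  consider "k * a + 2 * a + 2 * n \<le> x" | "m * a + (2 * r) * (2 * r) + 3 * r + r * a \<le> y" using far by linarith
  then show ?thesis
  proof cases
    case 1
    define x' where "x' = x - k * a"
    have x: "x = k * a + x'" "2 * a + 2 * n \<le> x'" using 1 unfolding x'_def by linarith+
    then have "(x', y) \<in> cm_exps" using cm left_exp_large[of x'] unfolding cm_exps_def
      by (simp add: add.assoc dvd_add_right_iff)
    moreover have "x' \<noteq> 2 * a - 3 * r" using x(2) r_ge three_r_le(2) by linarith
    ultimately have "(x', y) \<in> curve_exps" using cm_exps_cases extra_exps_eq by blast
    moreover have "(x, y) = (k * a + x', 0 + y)" using x by simp
    ultimately show ?thesis unfolding max_component_def by blast
  next
    case 2
    define y' where "y' = y - m * a"
    have y: "y = m * a + y'" "(2 * r) * (2 * r) + 3 * r + r * a \<le> y'" using 2 unfolding y'_def by linarith+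
    have "a dvd m * a + (x + y')" using cm(1) unfolding y(1) by (simp add: ac_simps)
    then have "(x, y') \<in> cm_exps" using cm(2) right_exp_large[of y'] y(2) unfolding cm_exps_def
      by (simp add: dvd_add_right_iff)
    then consider "(x, y') \<in> curve_exps" | f where "x = 2 * a - 3 * r" "y' = 3 * r + f * a"
      using cm_exps_cases extra_exps_eq by blast
    then have "(x, y') \<in> curve_exps"
    proof cases
      case (2 f)
      then have "r * a \<le> f * a" using y(2) by linarith
      then have "r \<le> f" using a_pos by simp
      then show ?thesis using extra_eventually_in_curve 2 by simp
    qed
    moreover have "(x, y) = (0 + x, m * a + y')" using y by simp
    ultimately show ?thesis unfolding max_component_def by blast
  qed
qed

lemma primary_max_component:
  assumes "k \<ge> 1" "m \<ge> 1"
  shows "primary_ideal (supported (max_component (k * a) (m * a))) (ring_on (supported curve_exps :: 'k::field poly poly set))"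
proof (rule curve.primary_maximal_radical)
  have "{st_mono (k * a) 0, st_mono 0 (m * a) :: 'k poly poly} \<subseteq> supported curve_exps"
    using s_exp_in_curve t_exp_in_curve by (auto intro: st_mono_in_supported)
  from curve.idl_genideal[OF this] show "curve.idl (supported (max_component (k * a) (m * a)) :: 'k poly poly set)"
    unfolding genideal_max_component .
  have "(0, 0) \<notin> max_component (k * a) (m * a)" unfolding max_component_def using assms a_pos by auto
  then have "(st_mono 0 0 :: 'k poly poly) \<notin> supported (max_component (k * a) (m * a))"
    unfolding st_mono_in_supported_iff .
  then show "(1 :: 'k poly poly) \<notin> supported (max_component (k * a) (m * a))" unfolding st_mono_0_0 .
  show "supported {(x, y). (x, y) \<in> curve_exps \<and> k * a + 2 * a + 2 * n + (m * a + (2 * r) * (2 * r) + 3 * r + r * a) \<le> x + y}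
      \<subseteq> (supported (max_component (k * a) (m * a)) :: 'k poly poly set)"
    by (rule supported_mono) (use curve_exps_far_out in auto)
qed

text \<open>
  A pair in the first component that does not come from \<open>s\<^bsup>ka\<^esup>\<close> is \<open>(ka + 2a - 3r, 3r + fa)\<close> with
  \<open>f < r\<close>. Its second entry is below \<open>(r + 3)a\<close>, since \<open>r < a\<close>, so it is not in the second component.
\<close>

lemma components_Int:
  assumes k: "k \<ge> 1"
  shows "cm_component (k * a) \<inter> max_component (k * a) ((r + 3) * a) = {(k * a + x, y) | x y. (x, y) \<in> curve_exps}"
    (is "?L = ?I")
proof
  show "?L \<subseteq> ?I"
  proof (rule subrelI)
    fix x y assume xy: "(x, y) \<in> ?L"
    then have "(x, y) \<in> {(x + x', y + y') | x y x' y'. (x, y) \<in> {(k * a, 0), (k * a + (2 * a - 3 * r), 3 * r)} \<and> (x', y') \<in> curve_exps}"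
      unfolding translates_cm_component(2)[OF k] by blast
    then consider "(x, y) \<in> ?I"
      | x' y' where "(x', y') \<in> curve_exps" "x = k * a + (2 * a - 3 * r) + x'" "y = 3 * r + y'" by force
    then show "(x, y) \<in> ?I"
    proof cases
      case (2 x' y')
      have "(2 * a - 3 * r + x', 3 * r + y') \<in> cm_exps"
        using cm_exps_add[OF _ subsetD[OF curve_sub_cm 2(1)]] extra_in_cm[of 0] by simp
      then consider "(2 * a - 3 * r + x', 3 * r + y') \<in> curve_exps" | f where "x' = 0" "y' = f * a"
        using cm_exps_cases extra_exps_eq by fastforce
      then show ?thesis
      proof cases
        case 1
        then show ?thesis unfolding 2 by (auto simp: add.assoc)
      next
        case (2 f)
        note xy' = \<open>x = k * a + (2 * a - 3 * r) + x'\<close> \<open>y = 3 * r + y'\<close>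
        from xy have "(x, y) \<in> max_component (k * a) ((r + 3) * a)" by blast
        then consider "(x, y) \<in> ?I" | "(r + 3) * a \<le> y" unfolding max_component_def by auto
        then show ?thesis
        proof cases
          case 2
          have "(r + 3) * a = r * a + 3 * a" by (simp add: algebra_simps)
          then have "r * a < f * a" using 2 a_gt_r unfolding xy'(2) \<open>y' = f * a\<close> by linarith
          then have "r \<le> f" by simp
          then have "(2 * a - 3 * r, y) \<in> curve_exps"
            unfolding xy'(2) \<open>y' = f * a\<close> by (rule extra_eventually_in_curve)
          then show ?thesis unfolding xy'(1) \<open>x' = 0\<close> by auto
        qed
      qed
    qed
  qed
  show "?I \<subseteq> ?L"
  proof (rule subrelI)
    fix x y assume "(x, y) \<in> ?I"
    then obtain x' where x: "x = k * a + x'" "(x', y) \<in> curve_exps" by blast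
    then have "(x, y) = (k * a + x', 0 + y)" by simp
    then have "(x, y) \<in> max_component (k * a) ((r + 3) * a)"
      "(x, y) \<in> {(x + x', y + y') | x y x' y'. (x, y) \<in> {(k * a, 0), (k * a + (2 * a - 3 * r), 3 * r)} \<and> (x', y') \<in> curve_exps}"
      unfolding max_component_def using x(2) by blast+
    then show "(x, y) \<in> ?L" unfolding translates_cm_component(2)[OF k] by blast
  qed
qed

lemma primary_decomposition_s_power:
  assumes k: "k \<ge> 1"
  shows "primary_decomposition (ring_on (supported curve_exps :: 'k::field poly poly set))
    (Idl\<^bsub>ring_on (supported curve_exps)\<^esub> {st_mono (k * a) 0})
    {Idl\<^bsub>ring_on (supported curve_exps)\<^esub> {st_mono (k * a) 0, st_mono (k * a + (2 * a - 3 * r)) (3 * r)},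
     Idl\<^bsub>ring_on (supported curve_exps)\<^esub> {st_mono (k * a) 0, st_mono 0 ((r + 3) * a)}}"
proof -
  have "{st_mono (k * a) 0 :: 'k poly poly} \<subseteq> supported curve_exps"
    using s_exp_in_curve by (auto intro: st_mono_in_supported)
  from curve.idl_genideal[OF this]
  have "ideal (Idl\<^bsub>ring_on (supported curve_exps)\<^esub> {st_mono (k * a) 0 :: 'k poly poly}) (ring_on (supported curve_exps))"
    unfolding curve.ideal_on_iff .
  moreover have "Idl\<^bsub>ring_on (supported curve_exps)\<^esub> {st_mono (k * a) 0 :: 'k poly poly}
      = supported (cm_component (k * a)) \<inter> supported (max_component (k * a) ((r + 3) * a))"
    unfolding genideal_s_power supported_Int components_Int[OF k] ..
  ultimately show ?thesis
    unfolding primary_decomposition_def genideal_cm_component[OF k] genideal_max_component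
    using primary_cm_component[OF k] primary_max_component[OF k, of "r + 3"] by auto
qed

section \<open>The theorem\<close>

lemma monomials_eq:
  "(monomials n r :: 'k::field poly poly set) = {st_mono x y | x y. (x, y) \<in> gens}"
proof -
  have a: "a_exp r n = a" by (simp add: a_exp_def a_def)
  have image: "{st_mono x y | x y. (x, y) \<in> E} = (\<lambda>(x, y). st_mono x y :: 'k poly poly) ` E" for E by force
  have range: "(\<lambda>(x, y). st_mono x y :: 'k poly poly) ` {(a - (2 * r + 2 * i - 1), 2 * r + 2 * i - 1) | i. i < n}
      = {svar ^ (a - a_exp r i) * tvar ^ a_exp r i | i. i < n}"
    by (auto simp: st_mono_def a_exp_def)
  show ?thesis
    unfolding monomials_def a b\<^sub>1_def b\<^sub>2_def image gens_def image_Un image_insert range prod.case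
    by (auto simp: st_mono_def)
qed

end

theorem mainTheorem5:
  fixes n r a b :: nat
    and M :: "'k::field poly poly set"
    and R :: "'k poly poly ring"
  assumes "n \<ge> 1" and "r \<ge> 5"
    and "a = a_exp r n" and "b = b\<^sub>1 r"
    and "M = monomials n r"
    and "R = generated_subalgebra M"
    and "svar ^ (3 * a - 3 * b) * tvar ^ (3 * b) \<notin> Idl\<^bsub>R\<^esub> {svar ^ a}"
  shows "(\<forall>k'\<ge>1. \<exists>m\<ge>1. primary_decomposition R
            (Idl\<^bsub>R\<^esub> {svar ^ (k' * a)})
            {Idl\<^bsub>R\<^esub> {svar ^ (k' * a), svar ^ ((k' - 1) * a) * (svar ^ (3 * a - 3 * b) * tvar ^ (3 * b))},
             Idl\<^bsub>R\<^esub> {svar ^ (k' * a), tvar ^ (m * a)}}) \<and>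
         is_macaulayfication R
           (generated_subalgebra (M \<union> {svar ^ (2 * a - 3 * b) * tvar ^ (3 * b)}))"
proof -
  interpret monomial_curve n r by unfold_locales (use assms in auto)
  have ab: "a = monomial_curve.a n r" "b = r" using assms by (simp_all add: a_exp_def a_def b\<^sub>1_def)
  have R: "R = ring_on (supported curve_exps)"
    unfolding assms(6,5) monomials_eq generated_subalgebra_monos exp_span_gens ..
  have "M \<union> {svar ^ (2 * a - 3 * b) * tvar ^ (3 * b)}
      = {st_mono x y | x y. (x, y) \<in> gens \<union> {(2 * monomial_curve.a n r - 3 * r, 3 * r)}}"
    unfolding assms(5) monomials_eq ab st_mono_def[symmetric] by auto
  then have S: "generated_subalgebra (M \<union> {svar ^ (2 * a - 3 * b) * tvar ^ (3 * b)})
      = (ring_on (supported cm_exps) :: 'k poly poly ring)"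
    by (simp only: generated_subalgebra_monos exp_span_gens_extra)
  have s: "svar ^ k = (st_mono k 0 :: 'k poly poly)" "tvar ^ k = (st_mono 0 k :: 'k poly poly)" for k
    by (simp_all add: st_mono_def)
  have "primary_decomposition R (Idl\<^bsub>R\<^esub> {svar ^ (k' * a)})
      {Idl\<^bsub>R\<^esub> {svar ^ (k' * a), svar ^ ((k' - 1) * a) * (svar ^ (3 * a - 3 * b) * tvar ^ (3 * b))},
       Idl\<^bsub>R\<^esub> {svar ^ (k' * a), tvar ^ ((r + 3) * a)}}" if k: "k' \<ge> 1" for k'
  proof -
    have e: "k' * a + (2 * a - 3 * r) = (k' - 1) * a + (3 * a - 3 * r)"
      using k three_r_le(2) unfolding ab by (cases k') auto
    have "svar ^ ((k' - 1) * a) * (svar ^ (3 * a - 3 * b) * tvar ^ (3 * b))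
        = (st_mono (k' * a + (2 * a - 3 * r)) (3 * r) :: 'k poly poly)"
      unfolding st_mono_def ab(2) e power_add by (simp only: mult.assoc)
    then show ?thesis
      using primary_decomposition_s_power[OF k, where ?'k = 'k] unfolding R s(1)[symmetric] s(2)[symmetric] ab by simp
  qed
  then have "\<exists>m\<ge>1. primary_decomposition R (Idl\<^bsub>R\<^esub> {svar ^ (k' * a)})
      {Idl\<^bsub>R\<^esub> {svar ^ (k' * a), svar ^ ((k' - 1) * a) * (svar ^ (3 * a - 3 * b) * tvar ^ (3 * b))},
       Idl\<^bsub>R\<^esub> {svar ^ (k' * a), tvar ^ (m * a)}}" if "k' \<ge> 1" for k'
    using that by (intro exI[of _ "r + 3"]) simp
  moreover have "is_macaulayfication R
           (generated_subalgebra (M \<union> {svar ^ (2 * a - 3 * b) * tvar ^ (3 * b)}))"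
    unfolding S unfolding R by (rule macaulayfication_curve)
  ultimately show ?thesis by blast
qed

end
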